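(* Let $(K,\leq)$ be a partially ordered set (not necessarily directed) and let $\{K_i\subset K\mid i\in I\}$ be the family of all maximal directed subsets of $K$. Let $N=\{n_{ba}\in\mathbb{N}\mid a,b\in K,\ a\leq b\}$ be a set (indexed family) of natural numbers satisfying the factorization equalities $n_{ca}=n_{cb}\cdot n_{ba}$ for all $a,b,c\in K$ with $a\leq b$ and $b\leq c$, and let $\mathcal{F}=(K,\{\mathcal{T}_a\},\{\sigma_{ba}\})$ be the inductive system of Toeplitz algebras over $K$ defined by $N$. For $i\in I$ let $\mathcal{F}_i$ denote the inductive subsystem of $\mathcal{F}$ over $K_i$. Then there exists a family $\{\mathbb{Q}_{M_i}\subset\mathbb{Q}\mid i\in I\}$ of subgroups of the group of rational numbers (each $M_i$ being a sequence of natural numbers) and an isomorphism $$\prod_{i\in I}\varinjlim\mathcal{F}_i\simeq\prod_{i\in I}C^*_r(\mathbb{Q}_{M_i}^+)$$ between direct products of $C^*$-algebras, in the category of unital $C^*$-algebras and unital $*$-homomorphisms.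
   Context: $\mathbb{N}$ denotes the positive integers. A subset of a partially ordered set is directed if it is nonempty and every two of its elements have a common upper bound in it; a maximal directed subset is a directed subset maximal with respect to inclusion. For a sequence $M=(m_1,m_2,\ldots)$ with $m_s\in\mathbb{N}$, $\mathbb{Q}_M:=\left\{\frac{m}{m_1m_2\cdots m_s}\mid m\in\mathbb{Z},\ s\in\mathbb{N}\right\}$, a subgroup of the additive group $\mathbb{Q}$. For a subgroup $\Gamma\subset\mathbb{Q}$ put $\Gamma^+:=\Gamma\cap[0,+\infty)$, an additive semigroup. Let $\{e_g\mid g\in\Gamma^+\}$ be the canonical orthonormal basis of the Hilbert space $l^2(\Gamma^+)$ of square summable complex-valued functions on $\Gamma^+$. For $g\in\Gamma^+$ let $V_g\in B(l^2(\Gamma^+))$ be the isometry with $V_ge_h=e_{g+h}$ for $h\in\Gamma^+$. The reduced semigroup $C^*$-algebra $C^*_r(\Gamma^+)$ is the $C^*$-subalgebra of $B(l^2(\Gamma^+))$ generated by $\{V_g\mid g\in\Gamma^+\}$. For $\Gamma=\mathbb{Z}$ write $\mathcal{T}:=C^*_r(\mathbb{Z}^+)$ (the Toeplitz algebra) and $T:=V_1$, so $T^n=V_n$. Known fact (consequence of Coburn's theorem): for every $n\in\mathbb{N}$ there is a unique unital $*$-homomorphism $\varphi:\mathcal{T}\to\mathcal{T}$ with $\varphi(T)=T^n$, and it is isometric. The inductive system of Toeplitz algebras over the partially ordered set $K$ defined by $N$ is $\mathcal{F}=(K,\{\mathcal{T}_a\},\{\sigma_{ba}\})$, where $\mathcal{T}_a=\mathcal{T}$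 for all $a\in K$ and, for $a\leq b$, $\sigma_{ba}:\mathcal{T}_a\to\mathcal{T}_b$ is the unique unital $*$-homomorphism with $\sigma_{ba}(T)=T^{n_{ba}}$. Then $\sigma_{aa}=\mathrm{id}$ and $\sigma_{ca}=\sigma_{cb}\circ\sigma_{ba}$ for $a\leq b\leq c$. The inductive subsystem $\mathcal{F}_i$ of $\mathcal{F}$ over $K_i$ is the restriction of $\mathcal{F}$ to $K_i$, i.e. the inductive system of Toeplitz algebras over the directed set $(K_i,\leq)$ defined by $\{n_{ba}\in N\mid a,b\in K_i\}$. The inductive limit $\varinjlim\mathcal{G}$ of an inductive system $\mathcal{G}=(L,\{\mathfrak{A}_a\},\{\sigma_{ba}\})$ of unital $C^*$-algebras with unital injective connecting $*$-homomorphisms over a directed set $L$ is a unital $C^*$-algebra $\mathfrak{A}$ together with unital injective $*$-homomorphisms $\sigma^L_a:\mathfrak{A}_a\to\mathfrak{A}$ $(a\in L)$ such that $\sigma^L_a=\sigma^L_b\circ\sigma_{ba}$ whenever $a\leq b$, and $\mathfrak{A}$ is the norm closure of $\bigcup_{a\in L}\sigma^L_a(\mathfrak{A}_a)$. It always exists and is unique up to a unique $*$-isomorphism compatible with the maps $\sigma^L_a$. The direct product $\prod_{i\in I}\mathfrak{B}_i$ of $C^*$-algebras is the $C^*$-algebra of all families $(f_i)_{i\in I}$, $f_i\in\mathfrak{B}_i$, with $\|(f_i)\|:=\sup_i\|f_i\|<+\infty$, under pointwise operations and the supremum norm. *)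

theory Defs
  imports "HOL-Analysis.Analysis" "HOL-Algebra.Module"
begin

section \<open>Directed subsets\<close>

definition directed_subset :: "'k::order set \<Rightarrow> 'k set \<Rightarrow> bool" where
  "directed_subset K D \<longleftrightarrow>
     D \<subseteq> K \<and> D \<noteq> {} \<and> (\<forall>a\<in>D. \<forall>b\<in>D. \<exists>c\<in>D. a \<le> c \<and> b \<le> c)"

definition maximal_directed_subsets :: "'k::order set \<Rightarrow> 'k set set" where
  "maximal_directed_subsets K =
     {D. directed_subset K D \<and> (\<forall>D'. directed_subset K D' \<and> D \<subseteq> D' \<longrightarrow> D' = D)}"


section \<open>Unital C*-algebras\<close>

text \<open>The scalar multiplication of a C*-algebra is the field \<^const>\<open>smult\<close> of the
  module record of HOL-Algebra, with complex scalars.\<close>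

record 'a cstar = "(complex, 'a) module" +
  star :: "'a \<Rightarrow> 'a"
  nrm :: "'a \<Rightarrow> real"

text \<open>The zero algebra is admitted: it is the direct product of the empty family.\<close>

locale unital_cstar_algebra = ring A for A :: "'a cstar" (structure) +
  assumes smult_closed: "x \<in> carrier A \<Longrightarrow> c \<odot> x \<in> carrier A"
    and smult_l_distr: "x \<in> carrier A \<Longrightarrow> (c + d) \<odot> x = c \<odot> x \<oplus> d \<odot> x"
    and smult_r_distr:
      "x \<in> carrier A \<Longrightarrow> y \<in> carrier A \<Longrightarrow> c \<odot> (x \<oplus> y) = c \<odot> x \<oplus> c \<odot> y"
    and smult_assoc1: "x \<in> carrier A \<Longrightarrow> (c * d) \<odot> x = c \<odot> (d \<odot> x)"
    and smult_one: "x \<in> carrier A \<Longrightarrow> 1 \<odot> x = x"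
    and smult_mult_left:
      "x \<in> carrier A \<Longrightarrow> y \<in> carrier A \<Longrightarrow> (c \<odot> x) \<otimes> y = c \<odot> (x \<otimes> y)"
    and smult_mult_right:
      "x \<in> carrier A \<Longrightarrow> y \<in> carrier A \<Longrightarrow> x \<otimes> (c \<odot> y) = c \<odot> (x \<otimes> y)"
    and star_closed: "x \<in> carrier A \<Longrightarrow> star A x \<in> carrier A"
    and star_star: "x \<in> carrier A \<Longrightarrow> star A (star A x) = x"
    and star_add:
      "x \<in> carrier A \<Longrightarrow> y \<in> carrier A \<Longrightarrow> star A (x \<oplus> y) = star A x \<oplus> star A y"
    and star_smult: "x \<in> carrier A \<Longrightarrow> star A (c \<odot> x) = cnj c \<odot> star A x"
    and star_mult:
      "x \<in> carrier A \<Longrightarrow> y \<in> carrier A \<Longrightarrow> star A (x \<otimes> y) = star A y \<otimes> star A x"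
    and nrm_nonneg: "x \<in> carrier A \<Longrightarrow> 0 \<le> nrm A x"
    and nrm_eq_0_iff: "x \<in> carrier A \<Longrightarrow> nrm A x = 0 \<longleftrightarrow> x = \<zero>"
    and nrm_triangle:
      "x \<in> carrier A \<Longrightarrow> y \<in> carrier A \<Longrightarrow> nrm A (x \<oplus> y) \<le> nrm A x + nrm A y"
    and nrm_smult: "x \<in> carrier A \<Longrightarrow> nrm A (c \<odot> x) = cmod c * nrm A x"
    and nrm_mult:
      "x \<in> carrier A \<Longrightarrow> y \<in> carrier A \<Longrightarrow> nrm A (x \<otimes> y) \<le> nrm A x * nrm A y"
    and cstar_identity: "x \<in> carrier A \<Longrightarrow> nrm A (star A x \<otimes> x) = (nrm A x)\<^sup>2"
    and complete:
      "(\<And>k::nat. X k \<in> carrier A) \<Longrightarrow>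
       (\<And>e. 0 < e \<Longrightarrow> \<exists>N. \<forall>k\<ge>N. \<forall>l\<ge>N. nrm A (X k \<ominus> X l) < e) \<Longrightarrow>
       \<exists>x\<in>carrier A. (\<lambda>k. nrm A (X k \<ominus> x)) \<longlonglongrightarrow> 0"

definition unital_star_hom :: "'a cstar \<Rightarrow> 'b cstar \<Rightarrow> ('a \<Rightarrow> 'b) set" where
  "unital_star_hom A B =
     {h \<in> ring_hom A B.
        (\<forall>c. \<forall>x\<in>carrier A. h (c \<odot>\<^bsub>A\<^esub> x) = c \<odot>\<^bsub>B\<^esub> h x) \<and>
        (\<forall>x\<in>carrier A. h (star A x) = star B (h x))}"

definition unital_star_isomorphic :: "'a cstar \<Rightarrow> 'b cstar \<Rightarrow> bool" where
  "unital_star_isomorphic A B \<longleftrightarrow>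
     (\<exists>h \<in> unital_star_hom A B. bij_betw h (carrier A) (carrier B))"

definition cstar_subalgebra :: "'a set \<Rightarrow> 'a cstar \<Rightarrow> bool" where
  "cstar_subalgebra B A \<longleftrightarrow>
     B \<subseteq> carrier A \<and> \<zero>\<^bsub>A\<^esub> \<in> B \<and>
     (\<forall>x\<in>B. \<forall>y\<in>B. x \<oplus>\<^bsub>A\<^esub> y \<in> B \<and> x \<otimes>\<^bsub>A\<^esub> y \<in> B) \<and>
     (\<forall>c. \<forall>x\<in>B. c \<odot>\<^bsub>A\<^esub> x \<in> B) \<and>
     (\<forall>x\<in>B. star A x \<in> B) \<and>
     (\<forall>X. \<forall>x\<in>carrier A.
        (\<forall>k::nat. X k \<in> B) \<and> (\<lambda>k. nrm A (X k \<ominus>\<^bsub>A\<^esub> x)) \<longlonglongrightarrow> 0 \<longrightarrow> x \<in> B)"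

definition cstar_generated :: "'a cstar \<Rightarrow> 'a set \<Rightarrow> 'a cstar" where
  "cstar_generated A G = A\<lparr>carrier := \<Inter>{B. cstar_subalgebra B A \<and> G \<subseteq> B}\<rparr>"

text \<open>The supremum norm; the inserted 0 only matters for the empty index set.\<close>

definition cstar_product :: "'i set \<Rightarrow> ('i \<Rightarrow> 'a cstar) \<Rightarrow> ('i \<Rightarrow> 'a) cstar" where
  "cstar_product I A =
     \<lparr>carrier = {f \<in> \<Pi>\<^sub>E i\<in>I. carrier (A i). bdd_above ((\<lambda>i. nrm (A i) (f i)) ` I)},
      mult = (\<lambda>f g. \<lambda>i\<in>I. f i \<otimes>\<^bsub>A i\<^esub> g i),
      one = (\<lambda>i\<in>I. \<one>\<^bsub>A i\<^esub>),
      zero = (\<lambda>i\<in>I. \<zero>\<^bsub>A i\<^esub>),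
      add = (\<lambda>f g. \<lambda>i\<in>I. f i \<oplus>\<^bsub>A i\<^esub> g i),
      smult = (\<lambda>c f. \<lambda>i\<in>I. c \<odot>\<^bsub>A i\<^esub> f i),
      star = (\<lambda>f. \<lambda>i\<in>I. star (A i) (f i)),
      nrm = (\<lambda>f. Sup (insert 0 ((\<lambda>i. nrm (A i) (f i)) ` I)))\<rparr>"

text \<open>\<open>is_inductive_limit L \<AA> \<sigma> A \<tau>\<close>: the algebra \<open>A\<close> with the maps \<open>\<tau> a\<close> from \<open>\<AA> a\<close> to \<open>A\<close>
  is the inductive limit of the system over the directed set \<open>L\<close> with algebras \<open>\<AA> a\<close> and
  connecting maps \<open>\<sigma> b a\<close> from \<open>\<AA> a\<close> to \<open>\<AA> b\<close> for \<open>a \<le> b\<close>.\<close>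

definition is_inductive_limit ::
  "'k::order set \<Rightarrow> ('k \<Rightarrow> 'a cstar) \<Rightarrow> ('k \<Rightarrow> 'k \<Rightarrow> 'a \<Rightarrow> 'a) \<Rightarrow> 'c cstar \<Rightarrow> ('k \<Rightarrow> 'a \<Rightarrow> 'c) \<Rightarrow> bool"
where
  "is_inductive_limit L \<AA> \<sigma> A \<tau> \<longleftrightarrow>
     unital_cstar_algebra A \<and>
     (\<forall>a\<in>L. \<tau> a \<in> unital_star_hom (\<AA> a) A \<and> inj_on (\<tau> a) (carrier (\<AA> a))) \<and>
     (\<forall>a\<in>L. \<forall>b\<in>L. a \<le> b \<longrightarrow> (\<forall>x\<in>carrier (\<AA> a). \<tau> a x = \<tau> b (\<sigma> b a x))) \<and>
     (\<forall>x\<in>carrier A. \<forall>e>0. \<exists>a\<in>L. \<exists>y\<in>carrier (\<AA> a). nrm A (\<tau> a y \<ominus>\<^bsub>A\<^esub> x) < e)"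


section \<open>Bounded operators on square summable functions\<close>

text \<open>Functions on \<open>S\<close> are represented by functions that vanish outside \<open>S\<close>.\<close>

definition ell2 :: "'g set \<Rightarrow> ('g \<Rightarrow> complex) set" where
  "ell2 S = {f. (\<forall>x. x \<notin> S \<longrightarrow> f x = 0) \<and> (\<lambda>x. (cmod (f x))\<^sup>2) summable_on S}"

definition ell2_inner :: "'g set \<Rightarrow> ('g \<Rightarrow> complex) \<Rightarrow> ('g \<Rightarrow> complex) \<Rightarrow> complex" where
  "ell2_inner S f g = (\<Sum>\<^sub>\<infinity>x\<in>S. f x * cnj (g x))"

definition ell2_norm :: "'g set \<Rightarrow> ('g \<Rightarrow> complex) \<Rightarrow> real" where
  "ell2_norm S f = sqrt (\<Sum>\<^sub>\<infinity>x\<in>S. (cmod (f x))\<^sup>2)"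

definition ell2_basis :: "'g \<Rightarrow> 'g \<Rightarrow> complex" where
  "ell2_basis h = (\<lambda>x. if x = h then 1 else 0)"

type_synonym 'g ell2_op = "('g \<Rightarrow> complex) \<Rightarrow> ('g \<Rightarrow> complex)"

text \<open>Operators are undefined outside \<^const>\<open>ell2\<close>, so that equality of operators is
  equality of functions.\<close>

definition bounded_ops :: "'g set \<Rightarrow> 'g ell2_op set" where
  "bounded_ops S =
     {A \<in> ell2 S \<rightarrow>\<^sub>E ell2 S.
        (\<forall>f\<in>ell2 S. \<forall>g\<in>ell2 S. A (\<lambda>x. f x + g x) = (\<lambda>x. A f x + A g x)) \<and>
        (\<forall>c. \<forall>f\<in>ell2 S. A (\<lambda>x. c * f x) = (\<lambda>x. c * A f x)) \<and>
        (\<exists>C. \<forall>f\<in>ell2 S. ell2_norm S (A f) \<le> C * ell2_norm S f)}"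

definition adjoint_op :: "'g set \<Rightarrow> 'g ell2_op \<Rightarrow> 'g ell2_op" where
  "adjoint_op S A = (THE B. B \<in> bounded_ops S \<and>
     (\<forall>f\<in>ell2 S. \<forall>g\<in>ell2 S. ell2_inner S (A f) g = ell2_inner S f (B g)))"

definition B_ell2 :: "'g set \<Rightarrow> 'g ell2_op cstar" where
  "B_ell2 S =
     \<lparr>carrier = bounded_ops S,
      mult = compose (ell2 S),
      one = (\<lambda>f\<in>ell2 S. f),
      zero = (\<lambda>f\<in>ell2 S. (\<lambda>x. 0)),
      add = (\<lambda>A B. \<lambda>f\<in>ell2 S. (\<lambda>x. A f x + B f x)),
      smult = (\<lambda>c A. \<lambda>f\<in>ell2 S. (\<lambda>x. c * A f x)),
      star = adjoint_op S,
      nrm = (\<lambda>A. Sup {ell2_norm S (A f) | f. f \<in> ell2 S \<and> ell2_norm S f \<le> 1})\<rparr>"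


section \<open>Reduced semigroup C*-algebras\<close>

definition positive_part :: "rat set \<Rightarrow> rat set" where
  "positive_part \<Gamma> = {g \<in> \<Gamma>. 0 \<le> g}"

text \<open>The isometry \<open>V\<^sub>g\<close>, written as translation by \<open>g\<close>; for an additive semigroup \<open>S\<close> and
  \<open>g \<in> S\<close> the translate of a function vanishing outside \<open>S\<close> vanishes outside \<open>S\<close>.\<close>

definition shift_op :: "rat set \<Rightarrow> rat \<Rightarrow> rat ell2_op" where
  "shift_op S g = (\<lambda>f\<in>ell2 S. (\<lambda>h. f (h - g)))"

lemma ell2_basis_in_ell2: "h \<in> S \<Longrightarrow> ell2_basis h \<in> ell2 S"
proof -
  assume "h \<in> S"
  moreover have "(\<lambda>x. (cmod (ell2_basis h x))\<^sup>2) summable_on S"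
  proof (rule summable_on_cong_neutral[THEN iffD1])
    show "(\<lambda>x. (cmod (ell2_basis h x))\<^sup>2) summable_on {h}"
      by (rule summable_on_finite) simp
  qed (use \<open>h \<in> S\<close> in \<open>auto simp: ell2_basis_def\<close>)
  ultimately show ?thesis
    by (auto simp: ell2_def ell2_basis_def)
qed

lemma shift_op_ell2_basis:
  "h \<in> S \<Longrightarrow> shift_op S g (ell2_basis h) = ell2_basis (g + h)"
  by (auto simp: shift_op_def ell2_basis_in_ell2) (auto simp: ell2_basis_def fun_eq_iff)

lemma shift_op_isometry:
  assumes S: "\<And>x y. x \<in> S \<Longrightarrow> y \<in> S \<Longrightarrow> x + y \<in> S" and g: "g \<in> S" and f: "f \<in> ell2 S"
  shows "shift_op S g f \<in> ell2 S" and "ell2_norm S (shift_op S g f) = ell2_norm S f"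
proof -
  let ?u = "\<lambda>x. (cmod (f (x - g)))\<^sup>2"
  have z: "x \<notin> S \<Longrightarrow> f x = 0" for x
    using f by (simp add: ell2_def)
  have inj: "inj_on ((+) g) S"
    by simp
  have sub: "(+) g ` S \<subseteq> S"
    using S g by auto
  have out: "?u x = 0" if "x \<in> S - (+) g ` S" for x
  proof -
    have "x - g \<notin> S"
    proof
      assume "x - g \<in> S"
      then have "g + (x - g) \<in> (+) g ` S" by (rule imageI)
      with that show False by simp
    qed
    then show ?thesis by (simp add: z)
  qed
  have comp: "?u \<circ> (+) g = (\<lambda>x. (cmod (f x))\<^sup>2)"
    by (simp add: fun_eq_iff)
  have "?u summable_on (+) g ` S"
    using f by (subst summable_on_reindex[OF inj]) (simp add: comp ell2_def)
  then have "?u summable_on S"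
    by (rule summable_on_cong_neutral[THEN iffD1, rotated -1]) (use sub out in auto)
  moreover have "f (x - g) = 0" if "x \<notin> S" for x
  proof (rule z)
    show "x - g \<notin> S"
      using S[OF g, of "x - g"] that by auto
  qed
  ultimately show "shift_op S g f \<in> ell2 S"
    using f by (simp add: shift_op_def ell2_def)
  have "infsum ?u S = infsum ?u ((+) g ` S)"
    by (rule infsum_cong_neutral) (use sub out in auto)
  also have "\<dots> = infsum (\<lambda>x. (cmod (f x))\<^sup>2) S"
    by (simp add: infsum_reindex[OF inj] comp)
  finally show "ell2_norm S (shift_op S g f) = ell2_norm S f"
    using f by (simp add: shift_op_def ell2_norm_def)
qed

definition reduced_cstar :: "rat set \<Rightarrow> rat ell2_op cstar" where
  "reduced_cstar \<Gamma> =
     cstar_generated (B_ell2 (positive_part \<Gamma>))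
       (shift_op (positive_part \<Gamma>) ` positive_part \<Gamma>)"

text \<open>Only the terms \<open>M 1, M 2, \<dots>\<close> of the sequence are used.\<close>

definition Q_seq :: "(nat \<Rightarrow> nat) \<Rightarrow> rat set" where
  "Q_seq M = {of_int m / of_nat (\<Prod>j=1..s. M j) | m s. 1 \<le> s}"


section \<open>Toeplitz algebras\<close>

definition toeplitz :: "rat ell2_op cstar" where
  "toeplitz = reduced_cstar \<int>"

definition toeplitz_T :: "rat ell2_op" where
  "toeplitz_T = shift_op (positive_part \<int>) 1"

text \<open>The unital *-endomorphism of the Toeplitz algebra sending \<open>T\<close> to \<open>T\<^sup>n\<close>; it exists and is
  unique for \<open>n \<ge> 1\<close>, as a function on the carrier.\<close>

definition toeplitz_hom :: "nat \<Rightarrow> rat ell2_op \<Rightarrow> rat ell2_op" where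
  "toeplitz_hom n = (THE \<phi>. \<phi> \<in> unital_star_hom toeplitz toeplitz \<and>
     \<phi> \<in> extensional (carrier toeplitz) \<and>
     \<phi> toeplitz_T = toeplitz_T [^]\<^bsub>toeplitz\<^esub> n)"

end

theory Submission
  imports Defs
begin

text \<open>Fix a maximal directed subset \<open>D\<close> and \<open>o \<in> D\<close>, and let
  \<open>\<Gamma>\<close> be the union of the groups \<open>(1 / n b o) \<int>\<close> over the
  \<open>b \<ge> o\<close> in \<open>D\<close>. Decomposing
  \<open>l\<^sup>2(\<Gamma>\<^sup>+)\<close> along the cosets of \<open>(1 / n b o)
  \<int>\<close> exhibits the translation by \<open>1 / n b o\<close> as a multiple of the
  unilateral shift \<open>T\<close>, which gives homomorphisms \<open>\<psi> b\<close> from the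
  Toeplitz algebra to \<open>C\<^sup>*\<^sub>r(\<Gamma>\<^sup>+)\<close> that are compatible
  with the connecting maps. Both the \<open>\<psi> b\<close> and the maps \<open>\<tau>
  b\<close> into the inductive limit are isometric, because the norm of \<open>x\<close> in the
  Toeplitz algebra is determined by the products \<open>p\<^sub>w x p\<^sub>v\<close> with
  operators of rank one. So the closure of the relation \<open>\<tau> b x \<leftrightarrow>
  \<psi> b x\<close> is the graph of an isometric isomorphism, and isometric isomorphisms of the
  factors induce an isomorphism of the products.\<close>

subsection \<open>Square summable functions\<close>

text \<open>An inductive limit supplies injective homomorphisms with no information on norms, and
  homomorphisms are not continuous by definition, so every estimate has to come out of the algebra.
  With \<open>P = 1 - T T*\<close> a product of \<open>x\<close> with two rank one operators is
  \<open><x v, w> P\<close>. A homomorphism that does not kill \<open>P\<close> therefore keeps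
  every matrix coefficient of \<open>x\<close> as a multiple of one fixed nonzero element, and this
  bounds the norm of \<open>x\<close> from above; contractivity gives the other half. The
  amplification over the integers also yields the existence of \<open>toeplitz_hom\<close>. The base
  point normalises the denominators: \<open>n o o = 1\<close>, and factorization makes
  \<open>n b o\<close> a divisor of \<open>n c o\<close> for \<open>b \<le> c\<close>. The identity
  \<open>n c b * (1 / n c o) = 1 / n b o\<close> is what makes the maps \<open>\<psi> b\<close>
  compatible. The directed set may be uncountable, but its denominators are natural numbers, so a
  single sequence \<open>M\<close> reaches all of them. Norm preservation is carried along with
  bijectivity because the direct product consists of the norm-bounded families.\<close>

lemma ell2I:
  assumes "\<And>x. x \<notin> S \<Longrightarrow> f x = 0"
    and le: "\<And>F. finite F \<Longrightarrow> F \<subseteq> S \<Longrightarrow> L2_set (\<lambda>x. cmod (f x)) F \<le> C"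
  shows "f \<in> ell2 S" and "ell2_norm S f \<le> C"
proof -
  have C0: "0 \<le> C"
    using le[of "{}"] by simp
  have fin: "sum (\<lambda>x. (cmod (f x))\<^sup>2) F \<le> C\<^sup>2" if "finite F" "F \<subseteq> S" for F
    using le[OF that] C0 unfolding L2_set_def
    by (metis real_sqrt_le_iff real_sqrt_abs2 power2_eq_square abs_of_nonneg)
  have s: "(\<lambda>x. (cmod (f x))\<^sup>2) summable_on S"
    by (rule nonneg_bdd_above_summable_on) (auto intro!: bdd_aboveI2[where M="C\<^sup>2"] fin)
  then show "f \<in> ell2 S"
    using assms(1) by (simp add: ell2_def)
  have "infsum (\<lambda>x. (cmod (f x))\<^sup>2) S \<le> C\<^sup>2"
    by (rule infsum_le_finite_sums[OF s]) (auto intro: fin)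
  then show "ell2_norm S f \<le> C"
    unfolding ell2_norm_def using C0 real_le_lsqrt by blast
qed

lemma ell2_norm_nonneg [simp]: "0 \<le> ell2_norm S f"
  by (simp add: ell2_norm_def infsum_nonneg)

lemma ell2_outside: "f \<in> ell2 S \<Longrightarrow> x \<notin> S \<Longrightarrow> f x = 0"
  by (simp add: ell2_def)

lemma L2_set_le_ell2_norm:
  assumes "f \<in> ell2 S" "finite F" "F \<subseteq> S"
  shows "L2_set (\<lambda>x. cmod (f x)) F \<le> ell2_norm S f"
  unfolding L2_set_def ell2_norm_def
  by (intro real_sqrt_le_mono finite_sum_le_infsum) (use assms in \<open>auto simp: ell2_def\<close>)

lemma cmod_le_ell2_norm:
  assumes "f \<in> ell2 S"
  shows "cmod (f x) \<le> ell2_norm S f"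
proof (cases "x \<in> S")
  case True
  then show ?thesis
    using L2_set_le_ell2_norm[OF assms, of "{x}"] by simp
qed (use ell2_outside[OF assms] in simp)

lemma ell2_zero [simp]: "(\<lambda>x. 0) \<in> ell2 S" "ell2_norm S (\<lambda>x. 0) = 0"
  by (auto simp: ell2_def ell2_norm_def)

lemma ell2_norm_eq_0:
  assumes "f \<in> ell2 S" "ell2_norm S f = 0"
  shows "f = (\<lambda>x. 0)"
  using cmod_le_ell2_norm[OF assms(1)] assms(2) by (simp add: fun_eq_iff)

lemma ell2_add:
  assumes "f \<in> ell2 S" "g \<in> ell2 S"
  shows "(\<lambda>x. f x + g x) \<in> ell2 S"
    and "ell2_norm S (\<lambda>x. f x + g x) \<le> ell2_norm S f + ell2_norm S g"
proof -
  have *: "L2_set (\<lambda>x. cmod (f x + g x)) F \<le> ell2_norm S f + ell2_norm S g"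
    if "finite F" "F \<subseteq> S" for F
  proof -
    have "L2_set (\<lambda>x. cmod (f x + g x)) F \<le> L2_set (\<lambda>x. cmod (f x) + cmod (g x)) F"
      by (rule L2_set_mono) (auto intro: norm_triangle_ineq)
    also have "\<dots> \<le> L2_set (\<lambda>x. cmod (f x)) F + L2_set (\<lambda>x. cmod (g x)) F"
      by (rule L2_set_triangle_ineq)
    also have "\<dots> \<le> ell2_norm S f + ell2_norm S g"
      using L2_set_le_ell2_norm assms that by (intro add_mono) auto
    finally show ?thesis .
  qed
  show "(\<lambda>x. f x + g x) \<in> ell2 S"
    and "ell2_norm S (\<lambda>x. f x + g x) \<le> ell2_norm S f + ell2_norm S g"
    by (rule ell2I[OF _ *]; use assms in \<open>simp add: ell2_outside\<close>)+
qed

lemma ell2_scale: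
  assumes "f \<in> ell2 S"
  shows "(\<lambda>x. c * f x) \<in> ell2 S" and "ell2_norm S (\<lambda>x. c * f x) = cmod c * ell2_norm S f"
proof -
  show "(\<lambda>x. c * f x) \<in> ell2 S"
    using assms by (auto simp: ell2_def norm_mult power_mult_distrib intro: summable_on_cmult_right)
  show "ell2_norm S (\<lambda>x. c * f x) = cmod c * ell2_norm S f"
    by (simp add: ell2_norm_def norm_mult power_mult_distrib infsum_cmult_right' real_sqrt_mult)
qed

lemma ell2_diff:
  assumes "f \<in> ell2 S" "g \<in> ell2 S"
  shows "(\<lambda>x. f x - g x) \<in> ell2 S"
    and "ell2_norm S (\<lambda>x. f x - g x) \<le> ell2_norm S f + ell2_norm S g"
  using ell2_add[OF assms(1) ell2_scale(1)[OF assms(2), of "-1"]] ell2_scale(2)[OF assms(2), of "-1"]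
  by simp_all

lemma ell2_sum:
  assumes "\<And>i. i \<in> F \<Longrightarrow> f i \<in> ell2 S"
  shows "(\<lambda>x. \<Sum>i\<in>F. f i x) \<in> ell2 S"
  using assms by (induction F rule: infinite_finite_induct) (auto intro: ell2_add)

section \<open>Inner products of square summable functions\<close>

lemma ell2_product_summable:
  assumes "f \<in> ell2 S" "g \<in> ell2 S"
  shows "(\<lambda>x. cmod (f x * cnj (g x))) summable_on S"
    and "(\<lambda>x. f x * cnj (g x)) summable_on S"
proof -
  show "(\<lambda>x. cmod (f x * cnj (g x))) summable_on S"
    by (rule abs_summable_product)
      (use assms in \<open>simp_all add: ell2_def norm_mult power2_eq_square\<close>)
  then show "(\<lambda>x. f x * cnj (g x)) summable_on S"
    by (rule abs_summable_summable)
qed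

lemma ell2_inner_bound:
  assumes "f \<in> ell2 S" "g \<in> ell2 S"
  shows "cmod (ell2_inner S f g) \<le> ell2_norm S f * ell2_norm S g"
proof -
  have "cmod (ell2_inner S f g) \<le> (\<Sum>\<^sub>\<infinity>x\<in>S. cmod (f x * cnj (g x)))"
    unfolding ell2_inner_def by (rule norm_infsum_bound[OF ell2_product_summable(1)[OF assms]])
  also have "\<dots> \<le> ell2_norm S f * ell2_norm S g"
  proof (rule infsum_le_finite_sums[OF ell2_product_summable(1)[OF assms]])
    fix F assume F: "finite F" "F \<subseteq> S"
    have "(\<Sum>x\<in>F. cmod (f x * cnj (g x))) \<le> L2_set (\<lambda>x. cmod (f x)) F * L2_set (\<lambda>x. cmod (g x)) F"
      using L2_set_mult_ineq[of "\<lambda>x. cmod (f x)" "\<lambda>x. cmod (g x)" F] by (simp add: norm_mult)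
    also have "\<dots> \<le> ell2_norm S f * ell2_norm S g"
      using L2_set_le_ell2_norm assms F by (intro mult_mono) auto
    finally show "(\<Sum>x\<in>F. cmod (f x * cnj (g x))) \<le> ell2_norm S f * ell2_norm S g" .
  qed
  finally show ?thesis .
qed

lemma ell2_inner_add_left:
  assumes "f \<in> ell2 S" "g \<in> ell2 S" "h \<in> ell2 S"
  shows "ell2_inner S (\<lambda>x. f x + g x) h = ell2_inner S f h + ell2_inner S g h"
  unfolding ell2_inner_def using assms
  by (simp add: distrib_right infsum_add ell2_product_summable)

lemma ell2_inner_scale_left: "ell2_inner S (\<lambda>x. c * f x) h = c * ell2_inner S f h"
  unfolding ell2_inner_def by (simp add: mult.assoc infsum_cmult_right')

lemma ell2_inner_cnj: "cnj (ell2_inner S f g) = ell2_inner S g f"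
  unfolding ell2_inner_def by (simp flip: infsum_cnj add: mult.commute)

lemma ell2_inner_add_right:
  assumes "f \<in> ell2 S" "g \<in> ell2 S" "h \<in> ell2 S"
  shows "ell2_inner S h (\<lambda>x. f x + g x) = ell2_inner S h f + ell2_inner S h g"
  unfolding ell2_inner_def using assms
  by (simp add: distrib_left infsum_add ell2_product_summable)

lemma ell2_inner_scale_right: "ell2_inner S h (\<lambda>x. c * f x) = cnj c * ell2_inner S h f"
  unfolding ell2_inner_def by (simp add: mult.left_commute[of _ "cnj c"] infsum_cmult_right')

lemma ell2_inner_diff_left:
  assumes "f \<in> ell2 S" "g \<in> ell2 S" "h \<in> ell2 S"
  shows "ell2_inner S (\<lambda>x. f x - g x) h = ell2_inner S f h - ell2_inner S g h"
  using ell2_inner_add_left[OF assms(1) ell2_scale(1)[OF assms(2), of "-1"] assms(3)]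
    ell2_inner_scale_left[of S "-1" g h] by simp

lemma ell2_inner_zero_left [simp]: "ell2_inner S (\<lambda>x. 0) h = 0"
  by (simp add: ell2_inner_def)

lemma ell2_inner_sum_left:
  assumes "\<And>i. i \<in> F \<Longrightarrow> f i \<in> ell2 S" "h \<in> ell2 S"
  shows "ell2_inner S (\<lambda>x. \<Sum>i\<in>F. f i x) h = (\<Sum>i\<in>F. ell2_inner S (f i) h)"
  using assms
  by (induction F rule: infinite_finite_induct) (auto simp: ell2_inner_add_left ell2_sum)

lemma ell2_inner_basis_left:
  assumes "h \<in> S"
  shows "ell2_inner S (ell2_basis h) g = cnj (g h)"
proof -
  have "ell2_inner S (ell2_basis h) g = infsum (\<lambda>x. ell2_basis h x * cnj (g x)) {h}"
    unfolding ell2_inner_def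
    by (rule infsum_cong_neutral) (use assms in \<open>auto simp: ell2_basis_def\<close>)
  then show ?thesis
    by (simp add: ell2_basis_def)
qed

lemma ell2_inner_basis_right:
  assumes "h \<in> S"
  shows "ell2_inner S g (ell2_basis h) = g h"
  using ell2_inner_basis_left[OF assms, of g] by (metis complex_cnj_cnj ell2_inner_cnj)

lemma ell2_inner_self:
  assumes "f \<in> ell2 S"
  shows "ell2_inner S f f = complex_of_real ((ell2_norm S f)\<^sup>2)"
proof -
  have "ell2_inner S f f = (\<Sum>\<^sub>\<infinity>x\<in>S. complex_of_real ((cmod (f x))\<^sup>2))"
    unfolding ell2_inner_def by (simp flip: complex_norm_square)
  also have "\<dots> = complex_of_real (\<Sum>\<^sub>\<infinity>x\<in>S. (cmod (f x))\<^sup>2)"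
    using assms by (intro infsumI has_sum_of_real_iff[THEN iffD2] has_sum_infsum) (simp add: ell2_def)
  finally show ?thesis
    by (simp add: ell2_norm_def infsum_nonneg)
qed

text \<open>The restriction of \<open>f\<close> to \<open>F\<close>, written as a combination of
  basis vectors so that linear maps and inner products can be expanded term by term.\<close>

definition ell2_cut :: "'g set \<Rightarrow> ('g \<Rightarrow> complex) \<Rightarrow> 'g \<Rightarrow> complex" where
  "ell2_cut F f = (\<lambda>x. \<Sum>i\<in>F. f i * ell2_basis i x)"

lemma ell2_cut_apply: "finite F \<Longrightarrow> ell2_cut F f x = (if x \<in> F then f x else 0)"
proof -
  assume "finite F"
  have "ell2_cut F f x = (\<Sum>i\<in>F. if i = x then f i else 0)"
    unfolding ell2_cut_def by (rule sum.cong) (auto simp: ell2_basis_def)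
  then show ?thesis
    using \<open>finite F\<close> by simp
qed

lemma ell2_cut:
  assumes "finite F" "F \<subseteq> S"
  shows "ell2_cut F f \<in> ell2 S" and "ell2_norm S (ell2_cut F f) = L2_set (\<lambda>x. cmod (f x)) F"
proof -
  show "ell2_cut F f \<in> ell2 S"
    unfolding ell2_cut_def using assms by (intro ell2_sum ell2_scale ell2_basis_in_ell2) auto
  have "infsum (\<lambda>x. (cmod (ell2_cut F f x))\<^sup>2) S = infsum (\<lambda>x. (cmod (f x))\<^sup>2) F"
    by (rule infsum_cong_neutral) (use assms in \<open>auto simp: ell2_cut_apply\<close>)
  then show "ell2_norm S (ell2_cut F f) = L2_set (\<lambda>x. cmod (f x)) F"
    using assms by (simp add: ell2_norm_def L2_set_def)
qed

text \<open>The squared error is the tail of a convergent series. The bound for finite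
  approximations is not strict, hence the target \<open>e\<^sup>2 / 2\<close> instead of
  \<open>e\<^sup>2\<close>.\<close>

lemma ell2_cut_approx:
  assumes f: "f \<in> ell2 S" and e: "0 < e"
  obtains F where "finite F" "F \<subseteq> S" "ell2_norm S (\<lambda>x. f x - ell2_cut F f x) < e"
proof -
  let ?u = "\<lambda>x. (cmod (f x))\<^sup>2"
  have s: "?u summable_on S"
    using f by (simp add: ell2_def)
  obtain F where F: "finite F" "F \<subseteq> S" "dist (sum ?u F) (infsum ?u S) \<le> e\<^sup>2 / 2"
    using infsum_finite_approximation[OF s, of "e\<^sup>2 / 2"] e by auto
  have "infsum (\<lambda>x. (cmod (f x - ell2_cut F f x))\<^sup>2) S = infsum ?u (S - F)"
    by (rule infsum_cong_neutral) (use F in \<open>auto simp: ell2_cut_apply\<close>)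
  also have "\<dots> = infsum ?u S - sum ?u F"
    using F s by (subst infsum_Diff) auto
  also have "\<dots> < e\<^sup>2"
    using F(3) zero_less_power[OF e, of 2] unfolding dist_real_def by linarith
  finally have "ell2_norm S (\<lambda>x. f x - ell2_cut F f x) < e"
    unfolding ell2_norm_def using e real_less_lsqrt by (metis less_imp_le)
  with F show thesis
    using that by blast
qed

subsection \<open>The C*-algebra of bounded operators\<close>

lemma bounded_opsD:
  assumes "A \<in> bounded_ops S"
  shows "f \<in> ell2 S \<Longrightarrow> A f \<in> ell2 S"
    and "f \<in> ell2 S \<Longrightarrow> g \<in> ell2 S \<Longrightarrow> A (\<lambda>x. f x + g x) = (\<lambda>x. A f x + A g x)"
    and "f \<in> ell2 S \<Longrightarrow> A (\<lambda>x. c * f x) = (\<lambda>x. c * A f x)"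
    and "A \<in> extensional (ell2 S)"
  using assms unfolding bounded_ops_def by (auto simp: PiE_def)

lemma bounded_ops_diff:
  assumes "A \<in> bounded_ops S" "f \<in> ell2 S" "g \<in> ell2 S"
  shows "A (\<lambda>x. f x - g x) = (\<lambda>x. A f x - A g x)"
  using bounded_opsD(2)[OF assms(1,2) ell2_scale(1)[OF assms(3), of "-1"]]
    bounded_opsD(3)[OF assms(1,3), of "-1"] by simp

lemma bounded_ops_zero: "A \<in> bounded_ops S \<Longrightarrow> A (\<lambda>x. 0) = (\<lambda>x. 0)"
  using bounded_opsD(3)[of A S "\<lambda>x. 0" 0] by simp

lemma bounded_ops_sum:
  assumes "A \<in> bounded_ops S" "\<And>i. i \<in> F \<Longrightarrow> f i \<in> ell2 S"
  shows "A (\<lambda>x. \<Sum>i\<in>F. f i x) = (\<lambda>x. \<Sum>i\<in>F. A (f i) x)"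
  using assms(2)
  by (induction F rule: infinite_finite_induct)
    (auto simp: bounded_opsD(2)[OF assms(1)] bounded_ops_zero[OF assms(1)] ell2_sum)

lemma bounded_ops_restrictI:
  assumes "\<And>f. f \<in> ell2 S \<Longrightarrow> A f \<in> ell2 S"
    and "\<And>f g. f \<in> ell2 S \<Longrightarrow> g \<in> ell2 S \<Longrightarrow> A (\<lambda>x. f x + g x) = (\<lambda>x. A f x + A g x)"
    and "\<And>c f. f \<in> ell2 S \<Longrightarrow> A (\<lambda>x. c * f x) = (\<lambda>x. c * A f x)"
    and "\<And>f. f \<in> ell2 S \<Longrightarrow> ell2_norm S (A f) \<le> C * ell2_norm S f"
  shows "restrict A (ell2 S) \<in> bounded_ops S"
proof -
  have "\<exists>C. \<forall>f\<in>ell2 S. ell2_norm S (A f) \<le> C * ell2_norm S f"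
    using assms(4) by blast
  then show ?thesis
    unfolding bounded_ops_def using assms(1-3) by (auto simp: ell2_add ell2_scale)
qed

lemma bounded_ops_eqI:
  assumes "A \<in> bounded_ops S" "B \<in> bounded_ops S" "\<And>f. f \<in> ell2 S \<Longrightarrow> A f = B f"
  shows "A = B"
  using assms bounded_opsD(4) extensionalityI by blast

section \<open>The operator norm\<close>

abbreviation op_norm :: "'g set \<Rightarrow> 'g ell2_op \<Rightarrow> real" where
  "op_norm S \<equiv> nrm (B_ell2 S)"

lemma op_norm_def: "op_norm S A = Sup {ell2_norm S (A f) | f. f \<in> ell2 S \<and> ell2_norm S f \<le> 1}"
  by (simp add: B_ell2_def)

lemma op_norm_le:
  assumes "0 \<le> C" "\<And>f. f \<in> ell2 S \<Longrightarrow> ell2_norm S (A f) \<le> C * ell2_norm S f"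
  shows "op_norm S A \<le> C"
  unfolding op_norm_def
proof (rule cSup_least)
  show "{ell2_norm S (A f) | f. f \<in> ell2 S \<and> ell2_norm S f \<le> 1} \<noteq> {}"
    using ell2_zero by (metis (mono_tags, lifting) empty_Collect_eq zero_le_one)
  fix y assume "y \<in> {ell2_norm S (A f) | f. f \<in> ell2 S \<and> ell2_norm S f \<le> 1}"
  then show "y \<le> C"
    using assms by (force intro: order_trans mult_left_le)
qed

text \<open>A supremum of reals says something only about a set that is bounded above; the constant
  contained in \<open>bounded_ops\<close> supplies the bound, and scaling \<open>f\<close> to a unit
  vector gives the estimate.\<close>

lemma op_norm_bound:
  assumes A: "A \<in> bounded_ops S" and f: "f \<in> ell2 S"
  shows "ell2_norm S (A f) \<le> op_norm S A * ell2_norm S f"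
proof (cases "ell2_norm S f = 0")
  case True
  then show ?thesis
    using ell2_norm_eq_0[OF f True] bounded_ops_zero[OF A] by simp
next
  case False
  then have pos: "0 < ell2_norm S f"
    using ell2_norm_nonneg[of S f] by linarith
  obtain C where C: "\<And>f. f \<in> ell2 S \<Longrightarrow> ell2_norm S (A f) \<le> C * ell2_norm S f"
    using A unfolding bounded_ops_def by blast
  let ?g = "\<lambda>x. complex_of_real (inverse (ell2_norm S f)) * f x"
  have g: "?g \<in> ell2 S" "ell2_norm S ?g = 1"
    using pos ell2_scale[OF f, of "complex_of_real (inverse (ell2_norm S f))"]
    by (auto simp: field_simps norm_inverse norm_divide)
  have le: "ell2_norm S (A ?g) \<le> op_norm S A"
    unfolding op_norm_def
  proof (rule cSup_upper)
    show "bdd_above {ell2_norm S (A f) | f. f \<in> ell2 S \<and> ell2_norm S f \<le> 1}"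
    proof (rule bdd_aboveI)
      fix y assume "y \<in> {ell2_norm S (A f) | f. f \<in> ell2 S \<and> ell2_norm S f \<le> 1}"
      then obtain f where f: "f \<in> ell2 S" "ell2_norm S f \<le> 1" "y = ell2_norm S (A f)"
        by blast
      \<comment> \<open>The constant in \<open>bounded_ops\<close> carries no sign, so its absolute
        value is used.\<close>
      have "y \<le> \<bar>C\<bar> * ell2_norm S f"
        using C[OF f(1)] f(3) by (smt (verit) ell2_norm_nonneg mult_right_mono)
      also have "\<dots> \<le> \<bar>C\<bar>"
        using f(2) by (simp add: mult_left_le)
      finally show "y \<le> \<bar>C\<bar>" .
    qed
  qed (use g in auto)
  have eq: "ell2_norm S (A ?g) = inverse (ell2_norm S f) * ell2_norm S (A f)"
    unfolding bounded_opsD(3)[OF A f] ell2_scale(2)[OF bounded_opsD(1)[OF A f]]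
    by (simp add: norm_inverse)
  from le[unfolded eq] show ?thesis
    using pos by (simp add: field_simps)
qed

lemma op_norm_nonneg:
  assumes "A \<in> bounded_ops S"
  shows "0 \<le> op_norm S A"
proof -
  have bdd: "bdd_above {ell2_norm S (A f) | f. f \<in> ell2 S \<and> ell2_norm S f \<le> 1}"
  proof (rule bdd_aboveI)
    fix y assume "y \<in> {ell2_norm S (A f) | f. f \<in> ell2 S \<and> ell2_norm S f \<le> 1}"
    then obtain f where f: "f \<in> ell2 S" "ell2_norm S f \<le> 1" "y = ell2_norm S (A f)"
      by blast
    show "y \<le> \<bar>op_norm S A\<bar>"
      using op_norm_bound[OF assms f(1)] f
      by (smt (verit) ell2_norm_nonneg mult_left_le mult_right_mono)
  qed
  have "ell2_norm S (A (\<lambda>x. 0)) \<le> op_norm S A"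
    unfolding op_norm_def by (rule cSup_upper[OF _ bdd]) (use ell2_zero in force)
  then show ?thesis
    using ell2_norm_nonneg order_trans by blast
qed

lemma restrict_bounded_ops: "A \<in> bounded_ops S \<Longrightarrow> restrict A (ell2 S) = A"
  by (simp add: bounded_opsD(4) extensional_restrict)

text \<open>The adjoint is forced on coordinates: its value at \<open>x\<close> must be
  \<open><g, A e_x>\<close>. Finite sections of this candidate are bounded by pairing with
  \<open>A\<close>, and the adjoint relation, clear for finitely supported \<open>f\<close>, extends
  by density.\<close>

lemma adjoint_exists:
  assumes A: "A \<in> bounded_ops S"
  shows "\<exists>B\<in>bounded_ops S. (\<forall>g\<in>ell2 S. ell2_norm S (B g) \<le> op_norm S A * ell2_norm S g) \<and>
    (\<forall>f\<in>ell2 S. \<forall>g\<in>ell2 S. ell2_inner S (A f) g = ell2_inner S f (B g))"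
proof -
  define B where "B = (\<lambda>g x. if x \<in> S then cnj (ell2_inner S (A (ell2_basis x)) g) else 0)"
  have Ae: "A (ell2_basis x) \<in> ell2 S" if "x \<in> S" for x
    using bounded_opsD(1)[OF A] ell2_basis_in_ell2[OF that] .
  have cut: "ell2_inner S (A (ell2_cut F f)) g = (\<Sum>x\<in>F. f x * cnj (B g x))"
    if "finite F" "F \<subseteq> S" "g \<in> ell2 S" for F f g
  proof -
    have b: "ell2_basis i \<in> ell2 S" if "i \<in> F" for i
      by (rule ell2_basis_in_ell2) (use that \<open>F \<subseteq> S\<close> in auto)
    have "A (ell2_cut F f) = (\<lambda>x. \<Sum>i\<in>F. A (\<lambda>x. f i * ell2_basis i x) x)"
      unfolding ell2_cut_def by (rule bounded_ops_sum[OF A]) (intro ell2_scale b)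
    also have "\<dots> = (\<lambda>x. \<Sum>i\<in>F. f i * A (ell2_basis i) x)"
      by (intro ext sum.cong) (simp_all add: bounded_opsD(3)[OF A b])
    finally have "ell2_inner S (A (ell2_cut F f)) g = (\<Sum>i\<in>F. ell2_inner S (\<lambda>x. f i * A (ell2_basis i) x) g)"
      using that by (simp add: ell2_inner_sum_left ell2_scale bounded_opsD(1)[OF A b])
    then show ?thesis
      using that by (auto simp: ell2_inner_scale_left B_def intro!: sum.cong)
  qed
  have L: "L2_set (\<lambda>x. cmod (B g x)) F \<le> op_norm S A * ell2_norm S g"
    if g: "g \<in> ell2 S" and F: "finite F" "F \<subseteq> S" for F g
  proof -
    let ?L = "L2_set (\<lambda>x. cmod (B g x)) F"
    \<comment> \<open>The squared norm of a section of \<open>B g\<close> equals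
      \<open><A v, g>\<close> for \<open>v\<close> that same section, hence is at most
      \<open>op_norm S A * ?L * ell2_norm S g\<close>; cancelling one factor \<open>?L\<close> gives
      the bound.\<close>
    have "complex_of_real (?L\<^sup>2) = (\<Sum>x\<in>F. B g x * cnj (B g x))"
      by (simp add: L2_set_def sum_nonneg flip: complex_norm_square)
    also have "\<dots> = ell2_inner S (A (ell2_cut F (B g))) g"
      using cut[OF F g] by simp
    finally have "?L\<^sup>2 = cmod (ell2_inner S (A (ell2_cut F (B g))) g)"
      by (auto dest: arg_cong[of _ _ cmod] simp del: of_real_power)
    also have "\<dots> \<le> ell2_norm S (A (ell2_cut F (B g))) * ell2_norm S g"
      by (intro ell2_inner_bound g bounded_opsD(1)[OF A] ell2_cut F)
    also have "\<dots> \<le> (op_norm S A * ?L) * ell2_norm S g"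
      using op_norm_bound[OF A ell2_cut(1)[OF F, of "B g"]] ell2_cut(2)[OF F, of "B g"]
      by (simp add: mult_right_mono)
    finally have "?L * ?L \<le> (op_norm S A * ell2_norm S g) * ?L"
      by (simp add: power2_eq_square mult_ac)
    then show "?L \<le> op_norm S A * ell2_norm S g"
      using op_norm_nonneg[OF A]
      by (cases "?L = 0") (simp_all add: mult_le_cancel_right less_le)
  qed
  have B: "B g \<in> ell2 S \<and> ell2_norm S (B g) \<le> op_norm S A * ell2_norm S g" if g: "g \<in> ell2 S" for g
  proof -
    have "B g x = 0" if "x \<notin> S" for x
      using that by (simp add: B_def)
    then show ?thesis
      using ell2I[OF _ L[OF g]] by blast
  qed
  have inner: "ell2_inner S (A f) g = ell2_inner S f (B g)" if f: "f \<in> ell2 S" and g: "g \<in> ell2 S" for f g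
  proof -
    let ?C = "2 * op_norm S A * ell2_norm S g"
    have le: "cmod (ell2_inner S (A f) g - ell2_inner S f (B g)) \<le> e * ?C" if e: "0 < e" for e
    proof -
      obtain F where F: "finite F" "F \<subseteq> S" "ell2_norm S (\<lambda>x. f x - ell2_cut F f x) < e"
        using ell2_cut_approx[OF f e] .
      let ?c = "ell2_cut F f" and ?d = "\<lambda>x. f x - ell2_cut F f x"
      have c: "?c \<in> ell2 S"
        using ell2_cut F by blast
      have d: "?d \<in> ell2 S"
        by (rule ell2_diff[OF f c])
      have "ell2_inner S ?c (B g) = (\<Sum>i\<in>F. ell2_inner S (\<lambda>x. f i * ell2_basis i x) (B g))"
        unfolding ell2_cut_def using B[OF g] F
        by (intro ell2_inner_sum_left ell2_scale ell2_basis_in_ell2) auto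
      also have "\<dots> = (\<Sum>i\<in>F. f i * cnj (B g i))"
        using F by (intro sum.cong) (auto simp: ell2_inner_scale_left ell2_inner_basis_left)
      finally have "ell2_inner S (A ?c) g = ell2_inner S ?c (B g)"
        using cut[OF F(1,2) g] by simp
      \<comment> \<open>The finitely supported part cancels, and each term in the remainder
        \<open>?d\<close> is at most half of \<open>ell2_norm S ?d * ?C\<close>.\<close>
      then have "ell2_inner S (A f) g - ell2_inner S f (B g) = ell2_inner S (A ?d) g - ell2_inner S ?d (B g)"
        using f g c d A B[OF g] by (simp add: bounded_ops_diff ell2_inner_diff_left bounded_opsD)
      also have "cmod \<dots> \<le> ell2_norm S (A ?d) * ell2_norm S g + ell2_norm S ?d * ell2_norm S (B g)"
        using ell2_inner_bound[OF bounded_opsD(1)[OF A d] g] ell2_inner_bound[OF d, of "B g"] B[OF g]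
          norm_triangle_ineq4[of "ell2_inner S (A ?d) g" "ell2_inner S ?d (B g)"] by linarith
      also have "\<dots> \<le> (op_norm S A * ell2_norm S ?d) * ell2_norm S g + ell2_norm S ?d * (op_norm S A * ell2_norm S g)"
        using op_norm_bound[OF A d] B[OF g] by (intro add_mono mult_right_mono mult_left_mono) auto
      also have "\<dots> = ell2_norm S ?d * ?C"
        by (simp add: algebra_simps)
      also have "\<dots> \<le> e * ?C"
        using F(3) op_norm_nonneg[OF A] by (intro mult_right_mono) auto
      finally show ?thesis .
    qed
    have C0: "0 \<le> ?C"
      using op_norm_nonneg[OF A] by simp
    have "cmod (ell2_inner S (A f) g - ell2_inner S f (B g)) \<le> 0"
    proof (rule field_le_epsilon)
      fix e :: real assume "0 < e"
      \<comment> \<open>Adding 1 to the denominator covers the case \<open>?C = 0\<close>.\<close>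
      then have "e / (?C + 1) * ?C \<le> e" "0 < e / (?C + 1)"
        using C0 by (simp_all add: field_simps)
      then show "cmod (ell2_inner S (A f) g - ell2_inner S f (B g)) \<le> 0 + e"
        using le[of "e / (?C + 1)"] by linarith
    qed
    then show ?thesis
      by simp
  qed
  have "restrict B (ell2 S) \<in> bounded_ops S"
  proof (rule bounded_ops_restrictI[where C="op_norm S A"])
    fix f g assume "f \<in> ell2 S" "g \<in> ell2 S"
    then show "B (\<lambda>x. f x + g x) = (\<lambda>x. B f x + B g x)"
      by (simp add: B_def fun_eq_iff ell2_inner_add_right Ae)
  next
    fix c f
    show "B (\<lambda>x. c * f x) = (\<lambda>x. c * B f x)"
      by (simp add: B_def fun_eq_iff ell2_inner_scale_right)
  qed (use B in blast)+
  with B inner show ?thesis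
    by (intro bexI[of _ "restrict B (ell2 S)"]) simp_all
qed

lemma adjoint_unique:
  assumes "B \<in> bounded_ops S" "B' \<in> bounded_ops S"
    and "\<And>f g. f \<in> ell2 S \<Longrightarrow> g \<in> ell2 S \<Longrightarrow> ell2_inner S f (B g) = ell2_inner S f (B' g)"
  shows "B = B'"
proof (rule bounded_ops_eqI[OF assms(1,2)])
  fix g assume g: "g \<in> ell2 S"
  show "B g = B' g"
  proof
    fix x
    show "B g x = B' g x"
    proof (cases "x \<in> S")
      case True
      then have "cnj (B g x) = cnj (B' g x)"
        using assms(3)[OF ell2_basis_in_ell2[OF True] g] by (simp add: ell2_inner_basis_left)
      then show ?thesis
        by simp
    next
      case False
      then show ?thesis
        using bounded_opsD(1)[OF assms(1) g] bounded_opsD(1)[OF assms(2) g] ell2_outside by metis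
    qed
  qed
qed

lemma adjoint_op:
  assumes A: "A \<in> bounded_ops S"
  shows "adjoint_op S A \<in> bounded_ops S"
    and "f \<in> ell2 S \<Longrightarrow> g \<in> ell2 S \<Longrightarrow> ell2_inner S (A f) g = ell2_inner S f (adjoint_op S A g)"
    and "op_norm S (adjoint_op S A) \<le> op_norm S A"
proof -
  obtain B where B: "B \<in> bounded_ops S" "\<forall>g\<in>ell2 S. ell2_norm S (B g) \<le> op_norm S A * ell2_norm S g"
    "\<forall>f\<in>ell2 S. \<forall>g\<in>ell2 S. ell2_inner S (A f) g = ell2_inner S f (B g)"
    using adjoint_exists[OF A] by blast
  have "adjoint_op S A = B"
    unfolding adjoint_op_def
  proof (rule the_equality)
    fix B' assume "B' \<in> bounded_ops S \<and> (\<forall>f\<in>ell2 S. \<forall>g\<in>ell2 S. ell2_inner S (A f) g = ell2_inner S f (B' g))"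
    with B show "B' = B"
      by (intro adjoint_unique) auto
  qed (use B in blast)
  with B op_norm_nonneg[OF A] show "adjoint_op S A \<in> bounded_ops S"
    "f \<in> ell2 S \<Longrightarrow> g \<in> ell2 S \<Longrightarrow> ell2_inner S (A f) g = ell2_inner S f (adjoint_op S A g)"
    "op_norm S (adjoint_op S A) \<le> op_norm S A"
    by (auto intro: op_norm_le)
qed

text \<open>The involution axioms for operators reduce to this test on inner products.\<close>

lemma adjoint_op_eqI:
  assumes A: "A \<in> bounded_ops S" and B: "B \<in> bounded_ops S"
    and "\<And>f g. f \<in> ell2 S \<Longrightarrow> g \<in> ell2 S \<Longrightarrow> ell2_inner S (A f) g = ell2_inner S f (B g)"
  shows "adjoint_op S A = B"
  by (rule adjoint_unique[OF adjoint_op(1)[OF A] B]) (simp add: assms flip: adjoint_op(2)[OF A])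

lemma adjoint_op_left:
  assumes A: "A \<in> bounded_ops S" "f \<in> ell2 S" "g \<in> ell2 S"
  shows "ell2_inner S (adjoint_op S A f) g = ell2_inner S f (A g)"
  using adjoint_op(2)[OF A(1,3,2)] by (metis ell2_inner_cnj)

section \<open>The operators as a complete normed algebra with involution\<close>

lemma B_ell2_simps:
  "carrier (B_ell2 S) = bounded_ops S"
  "x \<otimes>\<^bsub>B_ell2 S\<^esub> y = compose (ell2 S) x y"
  "\<one>\<^bsub>B_ell2 S\<^esub> = (\<lambda>f\<in>ell2 S. f)"
  "\<zero>\<^bsub>B_ell2 S\<^esub> = (\<lambda>f\<in>ell2 S. (\<lambda>x. 0))"
  "x \<oplus>\<^bsub>B_ell2 S\<^esub> y = (\<lambda>f\<in>ell2 S. (\<lambda>z. x f z + y f z))"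
  "c \<odot>\<^bsub>B_ell2 S\<^esub> x = (\<lambda>f\<in>ell2 S. (\<lambda>z. c * x f z))"
  "star (B_ell2 S) = adjoint_op S"
  by (simp_all add: B_ell2_def)

lemma bounded_ops_add:
  assumes x: "x \<in> bounded_ops S" and y: "y \<in> bounded_ops S"
  shows "(\<lambda>f\<in>ell2 S. (\<lambda>z. x f z + y f z)) \<in> bounded_ops S"
    and "op_norm S (\<lambda>f\<in>ell2 S. (\<lambda>z. x f z + y f z)) \<le> op_norm S x + op_norm S y"
proof -
  have *: "ell2_norm S (\<lambda>z. x f z + y f z) \<le> (op_norm S x + op_norm S y) * ell2_norm S f"
    if f: "f \<in> ell2 S" for f
    using ell2_add(2)[OF bounded_opsD(1)[OF x f] bounded_opsD(1)[OF y f]]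
      op_norm_bound[OF x f] op_norm_bound[OF y f] by (simp add: distrib_right)
  show "(\<lambda>f\<in>ell2 S. (\<lambda>z. x f z + y f z)) \<in> bounded_ops S"
    by (rule bounded_ops_restrictI[OF _ _ _ *])
      (auto simp: bounded_opsD[OF x] bounded_opsD[OF y] ell2_add distrib_left)
  show "op_norm S (\<lambda>f\<in>ell2 S. (\<lambda>z. x f z + y f z)) \<le> op_norm S x + op_norm S y"
    by (rule op_norm_le) (use * op_norm_nonneg[OF x] op_norm_nonneg[OF y] in auto)
qed

lemma bounded_ops_scale:
  assumes x: "x \<in> bounded_ops S"
  shows "(\<lambda>f\<in>ell2 S. (\<lambda>z. c * x f z)) \<in> bounded_ops S"
    and "op_norm S (\<lambda>f\<in>ell2 S. (\<lambda>z. c * x f z)) = cmod c * op_norm S x"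
proof -
  have *: "(\<lambda>f\<in>ell2 S. (\<lambda>z. c * x f z)) \<in> bounded_ops S
      \<and> op_norm S (\<lambda>f\<in>ell2 S. (\<lambda>z. c * x f z)) \<le> cmod c * op_norm S x"
    if x: "x \<in> bounded_ops S" for c x
  proof -
    have *: "ell2_norm S (\<lambda>z. c * x f z) \<le> (cmod c * op_norm S x) * ell2_norm S f"
      if f: "f \<in> ell2 S" for f
      using ell2_scale(2)[OF bounded_opsD(1)[OF x f]] op_norm_bound[OF x f]
      by (simp add: mult.assoc mult_left_mono)
    have "(\<lambda>f\<in>ell2 S. (\<lambda>z. c * x f z)) \<in> bounded_ops S"
      by (rule bounded_ops_restrictI[OF _ _ _ *])
        (simp_all add: bounded_opsD[OF x] ell2_scale distrib_left mult.left_commute)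
    moreover have "op_norm S (\<lambda>f\<in>ell2 S. (\<lambda>z. c * x f z)) \<le> cmod c * op_norm S x"
      by (rule op_norm_le) (simp_all add: * op_norm_nonneg[OF x])
    ultimately show ?thesis
      by blast
  qed
  show 1: "(\<lambda>f\<in>ell2 S. (\<lambda>z. c * x f z)) \<in> bounded_ops S"
    using *[OF x] by blast
  show "op_norm S (\<lambda>f\<in>ell2 S. (\<lambda>z. c * x f z)) = cmod c * op_norm S x"
  proof (rule antisym)
    show "cmod c * op_norm S x \<le> op_norm S (\<lambda>f\<in>ell2 S. (\<lambda>z. c * x f z))"
    \<comment> \<open>For nonzero \<open>c\<close> the reverse inequality is the forward one,
      applied to the scalar \<open>inverse c\<close> and the operator \<open>c x\<close>.\<close>
    proof (cases "c = 0")
      case False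
      let ?y = "\<lambda>f\<in>ell2 S. (\<lambda>z. c * x f z)"
      have "(\<lambda>f\<in>ell2 S. (\<lambda>z. inverse c * ?y f z)) = restrict x (ell2 S)"
        using False by (intro restrict_ext ext) simp
      then have "(\<lambda>f\<in>ell2 S. (\<lambda>z. inverse c * ?y f z)) = x"
        by (simp only: restrict_bounded_ops[OF x])
      then have "op_norm S x \<le> cmod (inverse c) * op_norm S ?y"
        using *[OF 1, of "inverse c"] by simp
      then show ?thesis
        using False by (simp add: field_simps norm_inverse norm_divide)
    qed (use op_norm_nonneg[OF 1] in simp)
  qed (use *[OF x] in blast)
qed

lemma bounded_ops_compose:
  assumes x: "x \<in> bounded_ops S" and y: "y \<in> bounded_ops S"
  shows "compose (ell2 S) x y \<in> bounded_ops S"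
    and "op_norm S (compose (ell2 S) x y) \<le> op_norm S x * op_norm S y"
proof -
  have *: "ell2_norm S (x (y f)) \<le> (op_norm S x * op_norm S y) * ell2_norm S f"
    if f: "f \<in> ell2 S" for f
  proof -
    have "ell2_norm S (x (y f)) \<le> op_norm S x * ell2_norm S (y f)"
      by (rule op_norm_bound[OF x bounded_opsD(1)[OF y f]])
    also have "\<dots> \<le> op_norm S x * (op_norm S y * ell2_norm S f)"
      by (rule mult_left_mono[OF op_norm_bound[OF y f] op_norm_nonneg[OF x]])
    finally show ?thesis
      by (simp add: mult.assoc)
  qed
  show "compose (ell2 S) x y \<in> bounded_ops S"
    unfolding compose_def by (rule bounded_ops_restrictI[OF _ _ _ *])
      (auto simp: bounded_opsD[OF x] bounded_opsD[OF y])
  show "op_norm S (compose (ell2 S) x y) \<le> op_norm S x * op_norm S y"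
    by (rule op_norm_le) (use * op_norm_nonneg[OF x] op_norm_nonneg[OF y] in \<open>auto simp: compose_def\<close>)
qed

lemma bounded_ops_id: "(\<lambda>f\<in>ell2 S. f) \<in> bounded_ops S"
  by (rule bounded_ops_restrictI[where C=1]) auto

lemma bounded_ops_0: "(\<lambda>f\<in>ell2 S. (\<lambda>x. 0)) \<in> bounded_ops S"
  by (rule bounded_ops_restrictI[where C=0]) auto

lemma ring_B_ell2: "ring (B_ell2 S)"
proof (rule ringI)
  show "abelian_group (B_ell2 S)"
  proof (rule abelian_groupI)
    fix x y z assume xyz: "x \<in> carrier (B_ell2 S)" "y \<in> carrier (B_ell2 S)" "z \<in> carrier (B_ell2 S)"
    show "x \<oplus>\<^bsub>B_ell2 S\<^esub> y \<oplus>\<^bsub>B_ell2 S\<^esub> z = x \<oplus>\<^bsub>B_ell2 S\<^esub> (y \<oplus>\<^bsub>B_ell2 S\<^esub> z)"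
      by (auto simp: B_ell2_simps fun_eq_iff)
  next
    fix x assume x: "x \<in> carrier (B_ell2 S)"
    show "\<zero>\<^bsub>B_ell2 S\<^esub> \<oplus>\<^bsub>B_ell2 S\<^esub> x = x"
      using x by (auto simp: B_ell2_simps fun_eq_iff bounded_ops_def)
    show "\<exists>y\<in>carrier (B_ell2 S). y \<oplus>\<^bsub>B_ell2 S\<^esub> x = \<zero>\<^bsub>B_ell2 S\<^esub>"
      by (rule bexI[of _ "\<lambda>f\<in>ell2 S. (\<lambda>z. (-1) * x f z)"])
        (use bounded_ops_scale(1)[of x S "-1"] x in \<open>auto simp: B_ell2_simps fun_eq_iff\<close>)
  qed (auto simp: B_ell2_simps bounded_ops_add bounded_ops_0 add.commute)
  show "monoid (B_ell2 S)"
  proof (rule monoidI)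
    fix x y z assume "x \<in> carrier (B_ell2 S)" "y \<in> carrier (B_ell2 S)" "z \<in> carrier (B_ell2 S)"
    then show "x \<otimes>\<^bsub>B_ell2 S\<^esub> y \<otimes>\<^bsub>B_ell2 S\<^esub> z = x \<otimes>\<^bsub>B_ell2 S\<^esub> (y \<otimes>\<^bsub>B_ell2 S\<^esub> z)"
      by (auto simp: B_ell2_simps fun_eq_iff compose_def bounded_opsD)
  next
    fix x assume x: "x \<in> carrier (B_ell2 S)"
    then have x': "x \<in> bounded_ops S"
      by (simp add: B_ell2_simps)
    show "\<one>\<^bsub>B_ell2 S\<^esub> \<otimes>\<^bsub>B_ell2 S\<^esub> x = x"
      unfolding B_ell2_simps
      by (rule bounded_ops_eqI[OF bounded_ops_compose(1)[OF bounded_ops_id x'] x'])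
        (simp add: compose_def bounded_opsD[OF x'])
    show "x \<otimes>\<^bsub>B_ell2 S\<^esub> \<one>\<^bsub>B_ell2 S\<^esub> = x"
      unfolding B_ell2_simps
      by (rule bounded_ops_eqI[OF bounded_ops_compose(1)[OF x' bounded_ops_id] x'])
        (simp add: compose_def)
  qed (auto simp: B_ell2_simps bounded_ops_compose bounded_ops_id)
qed (auto simp: B_ell2_simps fun_eq_iff compose_def bounded_opsD)

lemma a_minus_B_ell2:
  assumes x: "x \<in> bounded_ops S" and y: "y \<in> bounded_ops S"
  shows "x \<ominus>\<^bsub>B_ell2 S\<^esub> y = (\<lambda>f\<in>ell2 S. (\<lambda>z. x f z - y f z))"
proof -
  interpret ring "B_ell2 S"
    by (rule ring_B_ell2)
  have e: "(\<lambda>f\<in>ell2 S. (\<lambda>z. (-1) * y f z)) = \<ominus>\<^bsub>B_ell2 S\<^esub> y"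
    by (rule minus_equality[symmetric])
      (use bounded_ops_scale(1)[OF y, of "-1"] y in \<open>auto simp: B_ell2_simps fun_eq_iff\<close>)
  show ?thesis
    unfolding a_minus_def e[symmetric] by (auto simp: B_ell2_simps fun_eq_iff)
qed

text \<open>The limit operator is the pointwise limit of the values \<open>X k f z\<close>. Norm
  estimates survive because each finite section involves finitely many limits, and
  \<open>ell2I\<close> reassembles the sections.\<close>

lemma B_ell2_complete:
  fixes X :: "nat \<Rightarrow> 'g ell2_op"
  assumes X: "\<And>k. X k \<in> bounded_ops S"
    and Cauchy: "\<And>e. 0 < e \<Longrightarrow> \<exists>N. \<forall>k\<ge>N. \<forall>l\<ge>N. op_norm S (\<lambda>f\<in>ell2 S. (\<lambda>z. X k f z - X l f z)) < e"
  obtains x where "x \<in> bounded_ops S" "(\<lambda>k. op_norm S (\<lambda>f\<in>ell2 S. (\<lambda>z. X k f z - x f z))) \<longlonglongrightarrow> 0"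
proof -
  have diff: "(\<lambda>f\<in>ell2 S. (\<lambda>z. X k f z - X l f z)) \<in> bounded_ops S" for k l
    using bounded_ops_add(1)[OF X[of k] bounded_ops_scale(1)[OF X[of l], of "-1"]]
    by (simp cong: restrict_cong)
  have dist: "ell2_norm S (\<lambda>z. X k f z - X l f z) \<le> op_norm S (\<lambda>f\<in>ell2 S. (\<lambda>z. X k f z - X l f z)) * ell2_norm S f"
    if "f \<in> ell2 S" for f k l
    using op_norm_bound[OF diff that, of k l] that by simp
  have Xd: "(\<lambda>z. X k f z - X l f z) \<in> ell2 S" if "f \<in> ell2 S" for f k l
    by (intro ell2_diff bounded_opsD(1)[OF X] that)
  have Cau: "Cauchy (\<lambda>k. X k f z)" if f: "f \<in> ell2 S" for f z
  proof (rule metric_CauchyI)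
    fix e :: real assume "0 < e"
    then have pos: "0 < e / (ell2_norm S f + 1)"
      by (simp add: add_nonneg_pos)
    obtain N where N: "op_norm S (\<lambda>f\<in>ell2 S. (\<lambda>z. X k f z - X l f z)) < e / (ell2_norm S f + 1)"
      if "k \<ge> N" "l \<ge> N" for k l
      using Cauchy[OF pos] by blast
    have "dist (X k f z) (X l f z) < e" if "k \<ge> N" "l \<ge> N" for k l
    proof -
      have "dist (X k f z) (X l f z) \<le> op_norm S (\<lambda>f\<in>ell2 S. (\<lambda>z. X k f z - X l f z)) * ell2_norm S f"
        using cmod_le_ell2_norm[OF Xd[OF f, of k l], of z] dist[OF f, of k l] by (simp add: dist_norm)
      also have "\<dots> \<le> e / (ell2_norm S f + 1) * ell2_norm S f"
        using N[OF that] by (intro mult_right_mono) auto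
      also have "\<dots> < e"
      proof -
        have "0 < 1 + ell2_norm S f"
          by (simp add: add_pos_nonneg)
        then show ?thesis
          using \<open>0 < e\<close> by (simp add: field_simps)
      qed
      finally show ?thesis .
    qed
    then show "\<exists>M. \<forall>m\<ge>M. \<forall>n\<ge>M. dist (X m f z) (X n f z) < e"
      by blast
  qed
  define x where "x = (\<lambda>f z. lim (\<lambda>k. X k f z))"
  have lim: "(\<lambda>k. X k f z) \<longlonglongrightarrow> x f z" if "f \<in> ell2 S" for f z
    using Cauchy_convergent[OF Cau[OF that]] unfolding x_def by (simp add: convergent_LIMSEQ_iff)
  have out: "x f z = 0" if "f \<in> ell2 S" "z \<notin> S" for f z
  proof -
    have "X k f z = 0" for k
      using ell2_outside[OF bounded_opsD(1)[OF X that(1)] that(2)] .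
    then show ?thesis
      using lim[OF that(1), of z] by (simp add: LIMSEQ_const_iff)
  qed
  have L: "L2_set (\<lambda>z. cmod (X k f z - x f z)) F \<le> e * ell2_norm S f"
    if f: "f \<in> ell2 S" and e: "\<And>l. l \<ge> N \<Longrightarrow> op_norm S (\<lambda>f\<in>ell2 S. (\<lambda>z. X k f z - X l f z)) \<le> e"
      and F: "finite F" "F \<subseteq> S" for f k e N F
  proof -
    have "L2_set (\<lambda>z. cmod (X k f z - X l f z)) F \<le> e * ell2_norm S f" if "l \<ge> N" for l
    proof -
      have "L2_set (\<lambda>z. cmod (X k f z - X l f z)) F \<le> ell2_norm S (\<lambda>z. X k f z - X l f z)"
        using L2_set_le_ell2_norm[OF Xd[OF f] F] .
      also have "\<dots> \<le> e * ell2_norm S f"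
        using dist[OF f, of k l] mult_right_mono[OF e[OF that], of "ell2_norm S f"] by simp
      finally show ?thesis .
    qed
    moreover have "(\<lambda>l. L2_set (\<lambda>z. cmod (X k f z - X l f z)) F) \<longlonglongrightarrow> L2_set (\<lambda>z. cmod (X k f z - x f z)) F"
      unfolding L2_set_def by (intro tendsto_intros lim f)
    ultimately show "L2_set (\<lambda>z. cmod (X k f z - x f z)) F \<le> e * ell2_norm S f"
      by (intro LIMSEQ_le_const2) auto
  qed
  have close: "(\<lambda>z. X k f z - x f z) \<in> ell2 S \<and> ell2_norm S (\<lambda>z. X k f z - x f z) \<le> e * ell2_norm S f"
    if f: "f \<in> ell2 S" and e: "\<And>l. l \<ge> N \<Longrightarrow> op_norm S (\<lambda>f\<in>ell2 S. (\<lambda>z. X k f z - X l f z)) \<le> e" for f k e N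
  proof -
    have z: "X k f z - x f z = 0" if "z \<notin> S" for z
      using that out[OF f] ell2_outside[OF bounded_opsD(1)[OF X f]] by simp
    show ?thesis
    proof
      show "(\<lambda>z. X k f z - x f z) \<in> ell2 S"
        by (rule ell2I(1)[OF z L[OF f e]])
      show "ell2_norm S (\<lambda>z. X k f z - x f z) \<le> e * ell2_norm S f"
        by (rule ell2I(2)[OF z L[OF f e]])
    qed
  qed
  obtain N where N: "op_norm S (\<lambda>f\<in>ell2 S. (\<lambda>z. X k f z - X l f z)) < 1" if "k \<ge> N" "l \<ge> N" for k l
    using Cauchy[OF zero_less_one] by blast
  have close1: "(\<lambda>z. X N f z - x f z) \<in> ell2 S" "ell2_norm S (\<lambda>z. X N f z - x f z) \<le> 1 * ell2_norm S f"
    if "f \<in> ell2 S" for f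
    using close[OF that less_imp_le[OF N[OF order_refl]]] by blast+
  \<comment> \<open>The limit is a difference of two square summable functions; this gives both
    membership and the bound \<open>op_norm S (X N) + 1\<close>.\<close>
  have x_eq: "x f = (\<lambda>z. X N f z - (X N f z - x f z))" for f
    by simp
  have xr: "restrict x (ell2 S) \<in> bounded_ops S"
  proof (rule bounded_ops_restrictI)
    fix f assume f: "f \<in> ell2 S"
    show "x f \<in> ell2 S"
      by (subst x_eq) (intro ell2_diff close1 bounded_opsD[OF X] f)
    show "ell2_norm S (x f) \<le> (op_norm S (X N) + 1) * ell2_norm S f"
      using ell2_diff(2)[OF bounded_opsD(1)[OF X[of N] f] close1(1)[OF f]] close1(2)[OF f]
        op_norm_bound[OF X[of N] f] by (simp add: algebra_simps)
    show "x (\<lambda>x. c * f x) = (\<lambda>z. c * x f z)" for c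
    proof
      fix z
      have "(\<lambda>k. X k (\<lambda>x. c * f x) z) \<longlonglongrightarrow> c * x f z"
        by (simp add: bounded_opsD(3)[OF X f]) (intro tendsto_intros lim f)
      then show "x (\<lambda>x. c * f x) z = c * x f z"
        using lim[OF ell2_scale(1)[OF f]] LIMSEQ_unique by blast
    qed
    fix g assume g: "g \<in> ell2 S"
    show "x (\<lambda>x. f x + g x) = (\<lambda>z. x f z + x g z)"
    proof
      fix z
      have "(\<lambda>k. X k (\<lambda>x. f x + g x) z) \<longlonglongrightarrow> x f z + x g z"
        by (simp add: bounded_opsD(2)[OF X f g]) (intro tendsto_intros lim f g)
      then show "x (\<lambda>x. f x + g x) z = x f z + x g z"
        using lim[OF ell2_add(1)[OF f g]] LIMSEQ_unique by blast
    qed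
  qed
  have "(\<lambda>k. op_norm S (\<lambda>f\<in>ell2 S. (\<lambda>z. X k f z - restrict x (ell2 S) f z))) \<longlonglongrightarrow> 0"
  proof (rule LIMSEQ_I)
    fix e :: real assume e: "0 < e"
    obtain N where N: "op_norm S (\<lambda>f\<in>ell2 S. (\<lambda>z. X k f z - X l f z)) < e/2" if "k \<ge> N" "l \<ge> N" for k l
      using Cauchy[of "e/2"] half_gt_zero[OF e] by blast
    have "norm (op_norm S (\<lambda>f\<in>ell2 S. (\<lambda>z. X k f z - restrict x (ell2 S) f z)) - 0) < e" if "k \<ge> N" for k
    proof -
      have le: "op_norm S (\<lambda>f\<in>ell2 S. (\<lambda>z. X k f z - restrict x (ell2 S) f z)) \<le> e/2"
      proof (rule op_norm_le)
        fix f assume f: "f \<in> ell2 S"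
        show "ell2_norm S ((\<lambda>f\<in>ell2 S. (\<lambda>z. X k f z - restrict x (ell2 S) f z)) f) \<le> e/2 * ell2_norm S f"
          using close[OF f less_imp_le[OF N[OF that]]] f by simp
      qed (use e in simp)
      have mem: "(\<lambda>f\<in>ell2 S. (\<lambda>z. X k f z - restrict x (ell2 S) f z)) \<in> bounded_ops S"
        using bounded_ops_add(1)[OF X[of k] bounded_ops_scale(1)[OF xr, of "-1"]]
        by (simp cong: restrict_cong)
      show ?thesis
        using op_norm_nonneg[OF mem] le e by simp
    qed
    then show "\<exists>no. \<forall>n\<ge>no. norm (op_norm S (\<lambda>f\<in>ell2 S. (\<lambda>z. X n f z - restrict x (ell2 S) f z)) - 0) < e"
      by blast
  qed
  with xr show thesis
    by (rule that)
qed

lemma op_norm_eq_0: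
  assumes x: "x \<in> bounded_ops S" and 0: "op_norm S x = 0"
  shows "x = (\<lambda>f\<in>ell2 S. (\<lambda>z. 0))"
proof (rule bounded_ops_eqI[OF x bounded_ops_0])
  fix f assume f: "f \<in> ell2 S"
  have "ell2_norm S (x f) = 0"
    using op_norm_bound[OF x f] 0 by (simp add: antisym)
  then show "x f = (\<lambda>f\<in>ell2 S. (\<lambda>z. 0)) f"
    using ell2_norm_eq_0[OF bounded_opsD(1)[OF x f]] f by simp
qed

lemma unital_cstar_algebra_B_ell2: "unital_cstar_algebra (B_ell2 S)"
proof (intro unital_cstar_algebra.intro ring_B_ell2 unital_cstar_algebra_axioms.intro)
  fix x y :: "'a ell2_op" and c d :: complex
  assume x: "x \<in> carrier (B_ell2 S)"
  then have x': "x \<in> bounded_ops S"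
    by (simp add: B_ell2_simps)
  note sx = bounded_ops_scale(1)[OF x']
  show "c \<odot>\<^bsub>B_ell2 S\<^esub> x \<in> carrier (B_ell2 S)"
    by (simp add: B_ell2_simps sx)
  show "(c + d) \<odot>\<^bsub>B_ell2 S\<^esub> x = c \<odot>\<^bsub>B_ell2 S\<^esub> x \<oplus>\<^bsub>B_ell2 S\<^esub> d \<odot>\<^bsub>B_ell2 S\<^esub> x"
    "(c * d) \<odot>\<^bsub>B_ell2 S\<^esub> x = c \<odot>\<^bsub>B_ell2 S\<^esub> (d \<odot>\<^bsub>B_ell2 S\<^esub> x)"
    by (auto simp: B_ell2_simps fun_eq_iff distrib_right)
  show "1 \<odot>\<^bsub>B_ell2 S\<^esub> x = x"
    using restrict_bounded_ops[OF x'] by (simp add: B_ell2_simps restrict_def)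
  show "star (B_ell2 S) x \<in> carrier (B_ell2 S)"
    by (simp add: B_ell2_simps adjoint_op x')
  show "star (B_ell2 S) (star (B_ell2 S) x) = x"
    unfolding B_ell2_simps
    by (rule adjoint_op_eqI[OF adjoint_op(1)[OF x'] x' adjoint_op_left[OF x']])
  show "star (B_ell2 S) (c \<odot>\<^bsub>B_ell2 S\<^esub> x) = cnj c \<odot>\<^bsub>B_ell2 S\<^esub> star (B_ell2 S) x"
    unfolding B_ell2_simps using sx bounded_ops_scale(1)[OF adjoint_op(1)[OF x']]
    by (intro adjoint_op_eqI) (auto simp: adjoint_op(2)[OF x'] ell2_inner_scale_left ell2_inner_scale_right)
  show "0 \<le> op_norm S x"
    by (rule op_norm_nonneg[OF x'])
  show "op_norm S x = 0 \<longleftrightarrow> x = \<zero>\<^bsub>B_ell2 S\<^esub>"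
    using op_norm_eq_0[OF x'] bounded_ops_scale(2)[OF bounded_ops_0, of S 0]
    by (auto simp: B_ell2_simps cong: restrict_cong)
  show "op_norm S (c \<odot>\<^bsub>B_ell2 S\<^esub> x) = cmod c * op_norm S x"
    using bounded_ops_scale(2)[OF x'] by (simp add: B_ell2_simps)
  show "op_norm S (star (B_ell2 S) x \<otimes>\<^bsub>B_ell2 S\<^esub> x) = (op_norm S x)\<^sup>2"
  proof (rule antisym)
    let ?y = "compose (ell2 S) (adjoint_op S x) x"
    have y: "?y \<in> bounded_ops S"
      by (rule bounded_ops_compose[OF adjoint_op(1)[OF x'] x'])
    have "op_norm S ?y \<le> op_norm S (adjoint_op S x) * op_norm S x"
      by (rule bounded_ops_compose[OF adjoint_op(1)[OF x'] x'])
    also have "\<dots> \<le> op_norm S x * op_norm S x"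
      by (intro mult_right_mono adjoint_op(3)[OF x'] op_norm_nonneg[OF x'])
    finally show "op_norm S (star (B_ell2 S) x \<otimes>\<^bsub>B_ell2 S\<^esub> x) \<le> (op_norm S x)\<^sup>2"
      by (simp add: B_ell2_simps power2_eq_square)
    \<comment> \<open>This is the substantial half of the C*-identity; it comes from
      \<open><x f, x f> = <f, x* x f>\<close> and the Cauchy-Schwarz inequality.\<close>
    have "op_norm S x \<le> sqrt (op_norm S ?y)"
    proof (rule op_norm_le)
      fix f assume f: "f \<in> ell2 S"
      have xf: "x f \<in> ell2 S" "?y f \<in> ell2 S"
        using bounded_opsD(1)[OF x' f] bounded_opsD(1)[OF y f] .
      have "complex_of_real ((ell2_norm S (x f))\<^sup>2) = ell2_inner S (x f) (x f)"
        using ell2_inner_self[OF xf(1)] by simp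
      also have "\<dots> = ell2_inner S f (?y f)"
        using adjoint_op(2)[OF x' f xf(1)] f by (simp add: compose_def)
      finally have "(ell2_norm S (x f))\<^sup>2 = cmod (ell2_inner S f (?y f))"
        by (auto dest: arg_cong[of _ _ cmod] simp del: of_real_power)
      also have "\<dots> \<le> ell2_norm S f * ell2_norm S (?y f)"
        by (rule ell2_inner_bound[OF f xf(2)])
      also have "\<dots> \<le> ell2_norm S f * (op_norm S ?y * ell2_norm S f)"
        by (intro mult_left_mono op_norm_bound[OF y f]) simp
      also have "\<dots> = (sqrt (op_norm S ?y) * ell2_norm S f)\<^sup>2"
        using op_norm_nonneg[OF y] by (simp add: power_mult_distrib power2_eq_square)
      finally show "ell2_norm S (x f) \<le> sqrt (op_norm S ?y) * ell2_norm S f"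
        by (rule power2_le_imp_le) (simp add: op_norm_nonneg[OF y])
    qed (simp add: op_norm_nonneg[OF y])
    then have "(op_norm S x)\<^sup>2 \<le> (sqrt (op_norm S ?y))\<^sup>2"
      by (intro power_mono op_norm_nonneg[OF x'])
    then show "(op_norm S x)\<^sup>2 \<le> op_norm S (star (B_ell2 S) x \<otimes>\<^bsub>B_ell2 S\<^esub> x)"
      using op_norm_nonneg[OF y] by (simp add: B_ell2_simps)
  qed
  assume y: "y \<in> carrier (B_ell2 S)"
  then have y': "y \<in> bounded_ops S"
    by (simp add: B_ell2_simps)
  show "c \<odot>\<^bsub>B_ell2 S\<^esub> (x \<oplus>\<^bsub>B_ell2 S\<^esub> y) = c \<odot>\<^bsub>B_ell2 S\<^esub> x \<oplus>\<^bsub>B_ell2 S\<^esub> c \<odot>\<^bsub>B_ell2 S\<^esub> y"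
    by (auto simp: B_ell2_simps fun_eq_iff distrib_left)
  show "(c \<odot>\<^bsub>B_ell2 S\<^esub> x) \<otimes>\<^bsub>B_ell2 S\<^esub> y = c \<odot>\<^bsub>B_ell2 S\<^esub> (x \<otimes>\<^bsub>B_ell2 S\<^esub> y)"
    "x \<otimes>\<^bsub>B_ell2 S\<^esub> (c \<odot>\<^bsub>B_ell2 S\<^esub> y) = c \<odot>\<^bsub>B_ell2 S\<^esub> (x \<otimes>\<^bsub>B_ell2 S\<^esub> y)"
    by (auto simp: B_ell2_simps fun_eq_iff compose_def bounded_opsD[OF x'] bounded_opsD[OF y'])
  show "star (B_ell2 S) (x \<oplus>\<^bsub>B_ell2 S\<^esub> y) = star (B_ell2 S) x \<oplus>\<^bsub>B_ell2 S\<^esub> star (B_ell2 S) y"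
    unfolding B_ell2_simps
    by (intro adjoint_op_eqI bounded_ops_add x' y' adjoint_op(1))
      (auto simp: ell2_inner_add_left ell2_inner_add_right bounded_opsD[OF x'] bounded_opsD[OF y']
        adjoint_op(2)[OF x'] adjoint_op(2)[OF y'] bounded_opsD(1)[OF adjoint_op(1)[OF x']]
        bounded_opsD(1)[OF adjoint_op(1)[OF y']])
  show "star (B_ell2 S) (x \<otimes>\<^bsub>B_ell2 S\<^esub> y) = star (B_ell2 S) y \<otimes>\<^bsub>B_ell2 S\<^esub> star (B_ell2 S) x"
    unfolding B_ell2_simps
    by (intro adjoint_op_eqI bounded_ops_compose x' y' adjoint_op(1))
      (auto simp: compose_def bounded_opsD[OF x'] bounded_opsD[OF y'] adjoint_op(2)[OF x'] adjoint_op(2)[OF y']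
        bounded_opsD(1)[OF adjoint_op(1)[OF x']])
  show "op_norm S (x \<oplus>\<^bsub>B_ell2 S\<^esub> y) \<le> op_norm S x + op_norm S y"
    using bounded_ops_add(2)[OF x' y'] by (simp add: B_ell2_simps)
  show "op_norm S (x \<otimes>\<^bsub>B_ell2 S\<^esub> y) \<le> op_norm S x * op_norm S y"
    using bounded_ops_compose(2)[OF x' y'] by (simp add: B_ell2_simps)
next
  fix X :: "nat \<Rightarrow> 'a ell2_op"
  assume "\<And>k. X k \<in> carrier (B_ell2 S)"
  then have X: "X k \<in> bounded_ops S" for k
    by (simp add: B_ell2_simps)
  assume C: "\<And>e. 0 < e \<Longrightarrow> \<exists>N. \<forall>k\<ge>N. \<forall>l\<ge>N. op_norm S (X k \<ominus>\<^bsub>B_ell2 S\<^esub> X l) < e"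
  obtain x where x: "x \<in> bounded_ops S" "(\<lambda>k. op_norm S (\<lambda>f\<in>ell2 S. (\<lambda>z. X k f z - x f z))) \<longlonglongrightarrow> 0"
    by (rule B_ell2_complete[OF X C[unfolded a_minus_B_ell2[OF X X]]])
  show "\<exists>x\<in>carrier (B_ell2 S). (\<lambda>k. op_norm S (X k \<ominus>\<^bsub>B_ell2 S\<^esub> x)) \<longlonglongrightarrow> 0"
  proof (rule bexI)
    show "(\<lambda>k. op_norm S (X k \<ominus>\<^bsub>B_ell2 S\<^esub> x)) \<longlonglongrightarrow> 0"
      unfolding a_minus_B_ell2[OF X x(1)] by (rule x(2))
    show "x \<in> carrier (B_ell2 S)"
      unfolding B_ell2_simps by (rule x(1))
  qed
qed

subsection \<open>Unital C*-algebras\<close>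

context unital_cstar_algebra
begin

lemma smult_0:
  assumes "x \<in> carrier A"
  shows "0 \<odot> x = \<zero>"
proof -
  have c: "0 \<odot> x \<in> carrier A"
    by (rule smult_closed[OF assms])
  have "0 \<odot> x \<oplus> 0 \<odot> x = 0 \<odot> x"
    using smult_l_distr[OF assms, of 0 0] by simp
  then show ?thesis
    using c by (metis add.r_cancel_one)
qed

lemma smult_minus_1:
  assumes "x \<in> carrier A"
  shows "(-1) \<odot> x = \<ominus> x"
proof -
  have c: "(-1) \<odot> x \<in> carrier A"
    by (rule smult_closed[OF assms])
  have "(-1) \<odot> x \<oplus> x = \<zero>"
    using smult_l_distr[OF assms, of "-1" 1] smult_one[OF assms] smult_0[OF assms] by simp
  then show ?thesis
    using minus_equality[OF _ assms c] by simp
qed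

lemma minus_eq_smult: "y \<in> carrier A \<Longrightarrow> x \<ominus> y = x \<oplus> (-1) \<odot> y"
  by (simp add: a_minus_def smult_minus_1)

lemma minus_self: "x \<in> carrier A \<Longrightarrow> x \<ominus> x = \<zero>"
  by (simp add: a_minus_def r_neg)

lemma minus_zero_iff:
  assumes "x \<in> carrier A" "y \<in> carrier A"
  shows "x \<ominus> y = \<zero> \<longleftrightarrow> x = y"
  using assms by (metis a_minus_def a_inv_closed minus_equality minus_minus r_neg)

lemma minus_add_minus:
  assumes "x \<in> carrier A" "y \<in> carrier A" "z \<in> carrier A"
  shows "(x \<ominus> y) \<oplus> (y \<ominus> z) = x \<ominus> z"
  using assms by (simp add: a_minus_def a_assoc r_neg1)

lemma minus_uminus:
  assumes "x \<in> carrier A" "y \<in> carrier A"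
  shows "x \<ominus> y = (-1) \<odot> (y \<ominus> x)"
  using assms by (simp add: smult_minus_1 a_minus_def minus_add a_comm)

lemma nrm_minus_commute:
  assumes "x \<in> carrier A" "y \<in> carrier A"
  shows "nrm A (x \<ominus> y) = nrm A (y \<ominus> x)"
  using minus_uminus[OF assms] nrm_smult[of "y \<ominus> x" "-1"] assms by simp

lemma nrm_minus_triangle:
  assumes "x \<in> carrier A" "y \<in> carrier A" "z \<in> carrier A"
  shows "nrm A (x \<ominus> z) \<le> nrm A (x \<ominus> y) + nrm A (y \<ominus> z)"
  using nrm_triangle[of "x \<ominus> y" "y \<ominus> z"] minus_add_minus[OF assms] assms by simp

lemma nrm_zero: "nrm A \<zero> = 0"
  using nrm_eq_0_iff by simp

lemma nrm_le_minus_add: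
  assumes "x \<in> carrier A" "y \<in> carrier A"
  shows "nrm A x \<le> nrm A (x \<ominus> y) + nrm A y"
proof -
  have "x = (x \<ominus> y) \<oplus> y"
    using assms by (simp add: a_minus_def a_assoc l_neg)
  then show ?thesis
    using nrm_triangle[of "x \<ominus> y" y] assms by simp
qed

lemma star_one: "star A \<one> = \<one>"
proof -
  have c: "star A \<one> \<in> carrier A"
    by (simp add: star_closed)
  have "\<one> = star A (star A \<one> \<otimes> \<one>)"
    using c star_star[OF one_closed] by simp
  also have "\<dots> = star A \<one>"
    using star_mult[OF c one_closed] star_star[OF one_closed] c by simp
  finally show ?thesis
    by simp
qed

lemma star_minus:
  assumes "x \<in> carrier A" "y \<in> carrier A"
  shows "star A (x \<ominus> y) = star A x \<ominus> star A y"
  using assms by (simp add: minus_eq_smult star_add star_smult smult_closed star_closed)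

lemma nrm_star:
  assumes x: "x \<in> carrier A"
  shows "nrm A (star A x) = nrm A x"
proof -
  have le: "nrm A x \<le> nrm A (star A x)" if x: "x \<in> carrier A" for x
  proof (cases "nrm A x = 0")
    case False
    then have pos: "0 < nrm A x"
      using nrm_nonneg[OF x] by simp
    have "nrm A x * nrm A x \<le> nrm A (star A x) * nrm A x"
      using cstar_identity[OF x] nrm_mult[OF star_closed[OF x] x] by (simp add: power2_eq_square)
    with pos show ?thesis
      by simp
  qed (use nrm_nonneg[OF star_closed[OF x]] in simp)
  show ?thesis
    using le[OF x] le[OF star_closed[OF x]] star_star[OF x] by simp
qed

lemma nrm_one_le: "nrm A \<one> \<le> 1"
proof -
  have "nrm A \<one> = (nrm A \<one>)\<^sup>2"
    using cstar_identity[OF one_closed] by (simp add: star_one)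
  then have "nrm A \<one> = 0 \<or> nrm A \<one> = 1"
    by (simp add: power2_eq_square)
  then show ?thesis
    by auto
qed

lemma nrm_isometry_le:
  assumes u: "u \<in> carrier A" and "star A u \<otimes> u = \<one>"
  shows "nrm A u \<le> 1"
proof -
  have "(nrm A u)\<^sup>2 \<le> 1\<^sup>2"
    using cstar_identity[OF u] assms(2) nrm_one_le by simp
  then show ?thesis
    by (rule power2_le_imp_le) simp
qed

lemma mult_minus_mult:
  assumes "x \<in> carrier A" "y \<in> carrier A" "x' \<in> carrier A" "y' \<in> carrier A"
  shows "x \<otimes> y \<ominus> x' \<otimes> y' = x \<otimes> (y \<ominus> y') \<oplus> (x \<ominus> x') \<otimes> y'"
  using assms by (simp add: a_minus_def r_distr l_distr r_minus l_minus a_assoc r_neg1)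

lemma nrm_mult_minus_mult:
  assumes "x \<in> carrier A" "y \<in> carrier A" "x' \<in> carrier A" "y' \<in> carrier A"
  shows "nrm A (x \<otimes> y \<ominus> x' \<otimes> y') \<le> nrm A x * nrm A (y \<ominus> y') + nrm A (x \<ominus> x') * nrm A y'"
proof -
  have "nrm A (x \<otimes> y \<ominus> x' \<otimes> y') \<le> nrm A (x \<otimes> (y \<ominus> y')) + nrm A ((x \<ominus> x') \<otimes> y')"
    unfolding mult_minus_mult[OF assms] using assms by (intro nrm_triangle) simp_all
  also have "\<dots> \<le> nrm A x * nrm A (y \<ominus> y') + nrm A (x \<ominus> x') * nrm A y'"
    using assms by (intro add_mono nrm_mult) simp_all
  finally show ?thesis .
qed

lemma add_minus_add:
  assumes "x \<in> carrier A" "y \<in> carrier A" "x' \<in> carrier A" "y' \<in> carrier A"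
  shows "(x \<oplus> y) \<ominus> (x' \<oplus> y') = (x \<ominus> x') \<oplus> (y \<ominus> y')"
  using assms by (simp add: a_minus_def minus_add a_ac)

lemma smult_minus:
  assumes "x \<in> carrier A" "y \<in> carrier A"
  shows "c \<odot> (x \<ominus> y) = c \<odot> x \<ominus> c \<odot> y"
  using assms by (simp add: minus_eq_smult smult_closed smult_r_distr flip: smult_assoc1)

text \<open>Membership in the carrier is part of the predicate, which keeps the limit rules below
  free of most side conditions.\<close>

definition converges :: "(nat \<Rightarrow> 'a) \<Rightarrow> 'a \<Rightarrow> bool" where
  "converges X x \<longleftrightarrow> (\<forall>k. X k \<in> carrier A) \<and> x \<in> carrier A \<and> (\<lambda>k. nrm A (X k \<ominus> x)) \<longlonglongrightarrow> 0"

lemma convergesD: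
  assumes "converges X x"
  shows "X k \<in> carrier A" "x \<in> carrier A" "(\<lambda>k. nrm A (X k \<ominus> x)) \<longlonglongrightarrow> 0"
  using assms by (simp_all add: converges_def)

lemma convergesI:
  assumes X: "\<And>k. X k \<in> carrier A" and x: "x \<in> carrier A"
    and le: "\<And>k. nrm A (X k \<ominus> x) \<le> g k" and g: "g \<longlonglongrightarrow> 0"
  shows "converges X x"
  unfolding converges_def
proof (intro conjI allI X x)
  show "(\<lambda>k. nrm A (X k \<ominus> x)) \<longlonglongrightarrow> 0"
    by (rule tendsto_sandwich[OF _ _ tendsto_const g])
      (use le in \<open>simp_all add: nrm_nonneg X x\<close>)
qed

lemma converges_const: "x \<in> carrier A \<Longrightarrow> converges (\<lambda>k. x) x"
  by (simp add: converges_def minus_self nrm_zero)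

lemma converges_add:
  assumes "converges X x" "converges Y y"
  shows "converges (\<lambda>k. X k \<oplus> Y k) (x \<oplus> y)"
proof (rule convergesI)
  note c = convergesD[OF assms(1)] convergesD[OF assms(2)]
  show "nrm A ((X k \<oplus> Y k) \<ominus> (x \<oplus> y)) \<le> nrm A (X k \<ominus> x) + nrm A (Y k \<ominus> y)" for k
    using add_minus_add[OF c(1,4,2,5)] nrm_triangle[of "X k \<ominus> x" "Y k \<ominus> y"] c(1,4,2,5) by simp
  show "(\<lambda>k. nrm A (X k \<ominus> x) + nrm A (Y k \<ominus> y)) \<longlonglongrightarrow> 0"
    using tendsto_add[OF c(3) c(6)] by simp
qed (use convergesD[OF assms(1)] convergesD[OF assms(2)] in simp_all)

lemma converges_smult:
  assumes "converges X x"
  shows "converges (\<lambda>k. c \<odot> X k) (c \<odot> x)"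
proof (rule convergesI)
  note c = convergesD[OF assms(1)]
  show "nrm A (c \<odot> X k \<ominus> c \<odot> x) \<le> cmod c * nrm A (X k \<ominus> x)" for k
    using smult_minus[OF c(1,2), of c] nrm_smult[of "X k \<ominus> x" c] c by simp
  show "(\<lambda>k. cmod c * nrm A (X k \<ominus> x)) \<longlonglongrightarrow> 0"
    using tendsto_mult_left[OF c(3)] by simp
qed (use convergesD[OF assms(1)] in \<open>simp_all add: smult_closed\<close>)

lemma converges_star:
  assumes "converges X x"
  shows "converges (\<lambda>k. star A (X k)) (star A x)"
proof (rule convergesI)
  note c = convergesD[OF assms(1)]
  show "nrm A (star A (X k) \<ominus> star A x) \<le> nrm A (X k \<ominus> x)" for k
    using star_minus[OF c(1,2)] nrm_star[of "X k \<ominus> x"] c by simp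
  show "(\<lambda>k. nrm A (X k \<ominus> x)) \<longlonglongrightarrow> 0"
    by (rule c(3))
qed (use convergesD[OF assms(1)] in \<open>simp_all add: star_closed\<close>)

lemma converges_nrm:
  assumes "converges X x"
  shows "(\<lambda>k. nrm A (X k)) \<longlonglongrightarrow> nrm A x"
proof (rule LIM_zero_cancel, rule tendsto_rabs_zero_cancel)
  note c = convergesD[OF assms(1)]
  have "\<bar>nrm A (X k) - nrm A x\<bar> \<le> nrm A (X k \<ominus> x)" for k
    using nrm_le_minus_add[OF c(1,2), of k] nrm_le_minus_add[OF c(2,1), of k] nrm_minus_commute[OF c(1,2), of k]
    by linarith
  then show "(\<lambda>k. \<bar>nrm A (X k) - nrm A x\<bar>) \<longlonglongrightarrow> 0"
    by (intro tendsto_sandwich[OF _ _ tendsto_const c(3)]) simp_all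
qed

lemma converges_mult:
  assumes "converges X x" "converges Y y"
  shows "converges (\<lambda>k. X k \<otimes> Y k) (x \<otimes> y)"
proof (rule convergesI)
  note c = convergesD[OF assms(1)] convergesD[OF assms(2)]
  show "nrm A ((X k \<otimes> Y k) \<ominus> (x \<otimes> y)) \<le> nrm A (X k) * nrm A (Y k \<ominus> y) + nrm A (X k \<ominus> x) * nrm A y" for k
    by (rule nrm_mult_minus_mult[OF c(1,4,2,5)])
  show "(\<lambda>k. nrm A (X k) * nrm A (Y k \<ominus> y) + nrm A (X k \<ominus> x) * nrm A y) \<longlonglongrightarrow> 0"
    using tendsto_add[OF tendsto_mult[OF converges_nrm[OF assms(1)] c(6)]
        tendsto_mult[OF c(3) tendsto_const, of "nrm A y"]] by simp
qed (use convergesD[OF assms(1)] convergesD[OF assms(2)] in simp_all)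

lemma converges_unique:
  assumes "converges X x" "converges X y"
  shows "x = y"
proof -
  note c = convergesD[OF assms(1)] convergesD[OF assms(2)]
  have "converges (\<lambda>k. X k \<oplus> (-1) \<odot> X k) (x \<oplus> (-1) \<odot> y)"
    by (intro converges_add converges_smult assms)
  then have "converges (\<lambda>k. \<zero>) (x \<ominus> y)"
    using c by (simp add: minus_self flip: minus_eq_smult)
  then have "(\<lambda>k. nrm A \<zero>) \<longlonglongrightarrow> nrm A (x \<ominus> y)"
    by (rule converges_nrm)
  then have "nrm A (x \<ominus> y) = 0"
    by (simp add: nrm_zero LIMSEQ_const_iff)
  then show ?thesis
    using c minus_zero_iff nrm_eq_0_iff by simp
qed

lemma convergesE:
  assumes "\<And>k. X k \<in> carrier A"
    and "\<And>e. 0 < e \<Longrightarrow> \<exists>N. \<forall>k\<ge>N. \<forall>l\<ge>N. nrm A (X k \<ominus> X l) < e"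
  obtains x where "converges X x"
  using complete[OF assms] assms(1) unfolding converges_def by blast

lemma converges_Cauchy:
  assumes X: "converges X x" and e: "0 < e"
  shows "\<exists>N. \<forall>k\<ge>N. \<forall>l\<ge>N. nrm A (X k \<ominus> X l) < e"
proof -
  note c = convergesD[OF X]
  obtain N where N: "\<And>k. k \<ge> N \<Longrightarrow> norm (nrm A (X k \<ominus> x) - 0) < e / 2"
    using LIMSEQ_D[OF c(3) half_gt_zero[OF e]] by blast
  have "nrm A (X k \<ominus> X l) < e" if "k \<ge> N" "l \<ge> N" for k l
    using nrm_minus_triangle[OF c(1,2) c(1), of k l] N[OF that(1)] N[OF that(2)]
      nrm_minus_commute[OF c(1,2), of l] by simp
  then show ?thesis
    by blast
qed

lemma approx_converges:
  assumes x: "x \<in> carrier A" and D: "D \<subseteq> carrier A" and "\<And>e. 0 < e \<Longrightarrow> \<exists>d\<in>D. nrm A (d \<ominus> x) < e"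
  obtains X where "\<And>k. X k \<in> D" "converges X x"
proof -
  have "\<exists>d\<in>D. nrm A (d \<ominus> x) < 1 / real (Suc k)" for k
    using assms(3) by simp
  then obtain X where X: "X k \<in> D" "nrm A (X k \<ominus> x) < 1 / real (Suc k)" for k
    by metis
  have "converges X x"
  proof (rule convergesI[OF _ x])
    show "(\<lambda>k. 1 / real (Suc k)) \<longlonglongrightarrow> 0"
      using LIMSEQ_inverse_real_of_nat by (simp add: inverse_eq_divide)
  qed (use X D in \<open>auto intro: less_imp_le\<close>)
  with X(1) show thesis
    by (rule that)
qed

lemma converges_approx:
  assumes "converges X x" "0 < e"
  shows "\<exists>k. nrm A (X k \<ominus> x) < e"
proof -
  obtain N where "norm (nrm A (X N \<ominus> x) - 0) < e"
    using LIMSEQ_D[OF convergesD(3)[OF assms(1)] assms(2)] by blast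
  then have "nrm A (X N \<ominus> x) < e"
    by (simp add: abs_less_iff)
  then show ?thesis
    by blast
qed

text \<open>With \<open>s = 1 - y\<close> the equation \<open>s\<^sup>2 = 1 - x\<^sup>2\<close> becomes the fixed point equation
  \<open>y = (x\<^sup>2 + y\<^sup>2) / 2\<close>, whose right-hand side is a contraction of the ball of radius \<open>\<parallel>x\<parallel> < 1\<close>.\<close>

lemma sqrt_one_minus_square:
  assumes x: "x \<in> carrier A" and sa: "star A x = x" and less: "nrm A x < 1"
  obtains s where "s \<in> carrier A" "star A s = s" "s \<otimes> x = x \<otimes> s" "s \<otimes> s = \<one> \<ominus> x \<otimes> x"
proof -
  define r where "r = nrm A x"
  \<comment> \<open>All these conditions are closed and preserved by \<open>f\<close>, so the fixed
    point inherits self-adjointness and commutation with \<open>x\<close>, and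
    \<open>\<one> \<ominus> y\<close> has them too.\<close>
  define M where "M = {y \<in> carrier A. star A y = y \<and> y \<otimes> x = x \<otimes> y \<and> nrm A y \<le> r}"
  define f where "f = (\<lambda>y. (1/2) \<odot> (x \<otimes> x \<oplus> y \<otimes> y))"
  have r: "0 \<le> r" "r < 1"
    using nrm_nonneg[OF x] less by (auto simp: r_def)
  have M: "y \<in> carrier A" "star A y = y" "y \<otimes> x = x \<otimes> y" "nrm A y \<le> r" if "y \<in> M" for y
    using that by (auto simp: M_def)
  \<comment> \<open>\<open>Metric_space\<close> asks for nonnegativity and symmetry at all
    arguments, hence the default 0 off \<open>M\<close>.\<close>
  define d where "d = (\<lambda>y z. if y \<in> M \<and> z \<in> M then nrm A (y \<ominus> z) else 0)"
  interpret M: Metric_space M d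
  proof
    show "0 \<le> d y z" for y z
      using M(1) by (simp add: d_def nrm_nonneg)
    show "d y z = d z y" for y z
      using M(1) by (simp add: d_def nrm_minus_commute)
    fix y z assume yz: "y \<in> M" "z \<in> M"
    show "d y z = 0 \<longleftrightarrow> y = z"
      using yz M(1) by (simp add: d_def nrm_eq_0_iff minus_zero_iff)
    fix w assume "w \<in> M"
    with yz show "d y w \<le> d y z + d z w"
      using M(1) by (simp add: d_def nrm_minus_triangle)
  qed
  have mcomplete: "M.mcomplete"
    unfolding M.mcomplete_def
  proof (intro allI impI)
    fix Y assume "M.MCauchy Y"
    then have Y: "\<And>k. Y k \<in> M"
      and C: "\<And>e. 0 < e \<Longrightarrow> \<exists>N. \<forall>k l. N \<le> k \<longrightarrow> N \<le> l \<longrightarrow> d (Y k) (Y l) < e"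
      by (auto simp: M.MCauchy_def)
    obtain y where y: "converges Y y"
    proof (rule convergesE)
      show "Y k \<in> carrier A" for k
        using M(1)[OF Y] .
      show "\<exists>N. \<forall>k\<ge>N. \<forall>l\<ge>N. nrm A (Y k \<ominus> Y l) < e" if "0 < e" for e
        using C[OF that] by (simp add: d_def Y)
    qed
    have "star A y = y"
      by (rule converges_unique[OF _ y]) (use converges_star[OF y] in \<open>simp add: M(2)[OF Y]\<close>)
    moreover have "y \<otimes> x = x \<otimes> y"
      by (rule converges_unique[OF converges_mult[OF y converges_const[OF x]]])
        (use converges_mult[OF converges_const[OF x] y] in \<open>simp add: M(3)[OF Y]\<close>)
    moreover have "nrm A y \<le> r"
      by (rule LIMSEQ_le_const2[OF converges_nrm[OF y]]) (use M(4)[OF Y] in blast)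
    ultimately have yM: "y \<in> M"
      using convergesD(2)[OF y] by (simp add: M_def)
    have "limitin M.mtopology Y y sequentially"
      unfolding M.limitin_metric
    proof (intro conjI allI impI yM)
      fix e :: real assume e: "0 < e"
      have "\<forall>\<^sub>F k in sequentially. nrm A (Y k \<ominus> y) < e"
        by (rule order_tendstoD(2)[OF convergesD(3)[OF y] e])
      then show "\<forall>\<^sub>F k in sequentially. Y k \<in> M \<and> d (Y k) y < e"
        by (simp add: d_def Y yM)
    qed
    then show "\<exists>y. limitin M.mtopology Y y sequentially"
      by blast
  qed
  have ne: "M \<noteq> {}"
  proof -
    have "\<zero> \<in> M"
      using r x star_smult[OF zero_closed, of 0] by (simp add: M_def smult_0 star_closed nrm_zero)
    then show ?thesis
      by blast
  qed
  have fM: "f y \<in> M" if "y \<in> M" for y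
  proof -
    note y = M[OF that]
    have "nrm A (x \<otimes> x \<oplus> y \<otimes> y) \<le> nrm A x * nrm A x + nrm A y * nrm A y"
      using nrm_triangle[of "x \<otimes> x" "y \<otimes> y"] nrm_mult[OF x x] nrm_mult[OF y(1) y(1)] x y by simp
    \<comment> \<open>Here \<open>r < 1\<close> enters: \<open>r * r\<close> is at most
      \<open>r\<close>, so half of the sum stays in the ball of radius \<open>r\<close>.\<close>
    also have "\<dots> \<le> r * 1 + r * 1"
      unfolding r_def[symmetric] using y(4) r nrm_nonneg[OF y(1)] by (intro add_mono mult_mono) auto
    finally have "nrm A (f y) \<le> r"
      using x y by (simp add: f_def nrm_smult)
    moreover have "star A (f y) = f y"
      using x y sa by (simp add: f_def star_smult star_add star_mult)
    moreover have "f y \<otimes> x = x \<otimes> f y"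
    proof -
      have "y \<otimes> y \<otimes> x = x \<otimes> (y \<otimes> y)"
        using x y by (metis m_assoc)
      then show ?thesis
        using x y by (simp add: f_def smult_mult_left smult_mult_right l_distr r_distr m_assoc)
    qed
    ultimately show ?thesis
      using x y by (simp add: M_def f_def smult_closed)
  qed
  have contraction: "d (f y) (f z) \<le> r * d y z" if yz: "y \<in> M" "z \<in> M" for y z
  proof -
    note y = M[OF yz(1)] and z = M[OF yz(2)]
    have "f y \<ominus> f z = (1/2) \<odot> (y \<otimes> y \<ominus> z \<otimes> z)"
      using x y z by (simp add: f_def add_minus_add minus_self flip: smult_minus)
    then have "nrm A (f y \<ominus> f z) = nrm A (y \<otimes> y \<ominus> z \<otimes> z) / 2"
      using y z by (simp add: nrm_smult)
    \<comment> \<open>Elements of \<open>M\<close> need not commute with each other; the splitting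
      \<open>y y - z z = y (y - z) + (y - z) z\<close> still yields the factor
      \<open>(r + r) / 2 = r\<close>.\<close>
    also have "\<dots> \<le> (nrm A y * nrm A (y \<ominus> z) + nrm A (y \<ominus> z) * nrm A z) / 2"
      using nrm_mult_minus_mult[OF y(1) y(1) z(1) z(1)] by simp
    also have "\<dots> \<le> (r * nrm A (y \<ominus> z) + nrm A (y \<ominus> z) * r) / 2"
      using y z by (intro divide_right_mono add_mono mult_mono) (auto simp: nrm_nonneg r)
    finally show ?thesis
      by (simp add: d_def yz fM)
  qed
  obtain y where y: "y \<in> M" "f y = y"
    by (rule M.Banach_fixedpoint_thm[OF mcomplete ne _ r(2) contraction]) (auto simp: fM)
  note y' = M[OF y(1)]
  have xx: "x \<otimes> x \<oplus> y \<otimes> y = y \<oplus> y"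
  proof -
    have "x \<otimes> x \<oplus> y \<otimes> y = 2 \<odot> f y"
      using x y' by (simp add: f_def smult_one flip: smult_assoc1)
    also have "\<dots> = y \<oplus> y"
      using y smult_l_distr[OF y'(1), of 1 1] y' by (simp add: smult_one)
    finally show ?thesis .
  qed
  show thesis
  proof
    show "\<one> \<ominus> y \<in> carrier A" "star A (\<one> \<ominus> y) = \<one> \<ominus> y"
      using y' by (simp_all add: star_minus star_one)
    show "(\<one> \<ominus> y) \<otimes> x = x \<otimes> (\<one> \<ominus> y)"
      using x y' by (simp add: a_minus_def l_distr r_distr l_minus r_minus)
    have "(\<one> \<ominus> y) \<otimes> (\<one> \<ominus> y) = \<one> \<oplus> (y \<otimes> y \<ominus> (y \<oplus> y))"
      using y' by (simp add: a_minus_def l_distr r_distr l_minus r_minus minus_add a_ac)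
    also have "\<dots> = \<one> \<ominus> x \<otimes> x"
        unfolding xx[symmetric] using x y'
      by (simp add: a_minus_def minus_add a_lcomm[of "y \<otimes> y"] r_neg)
    finally show "(\<one> \<ominus> y) \<otimes> (\<one> \<ominus> y) = \<one> \<ominus> x \<otimes> x" .
  qed
qed

end

subsection \<open>Subalgebras\<close>

context unital_cstar_algebra
begin

lemma cstar_subalgebraD:
  assumes "cstar_subalgebra B A"
  shows "B \<subseteq> carrier A" "\<zero> \<in> B" "x \<in> B \<Longrightarrow> y \<in> B \<Longrightarrow> x \<oplus> y \<in> B"
    "x \<in> B \<Longrightarrow> y \<in> B \<Longrightarrow> x \<otimes> y \<in> B" "x \<in> B \<Longrightarrow> c \<odot> x \<in> B" "x \<in> B \<Longrightarrow> star A x \<in> B"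
    "(\<And>k. X k \<in> B) \<Longrightarrow> converges X x \<Longrightarrow> x \<in> B"
  using assms unfolding cstar_subalgebra_def converges_def by blast+

lemma cstar_subalgebraI:
  assumes "B \<subseteq> carrier A" "\<zero> \<in> B" "\<And>x y. x \<in> B \<Longrightarrow> y \<in> B \<Longrightarrow> x \<oplus> y \<in> B"
    "\<And>x y. x \<in> B \<Longrightarrow> y \<in> B \<Longrightarrow> x \<otimes> y \<in> B" "\<And>c x. x \<in> B \<Longrightarrow> c \<odot> x \<in> B"
    "\<And>x. x \<in> B \<Longrightarrow> star A x \<in> B" "\<And>X x. (\<And>k. X k \<in> B) \<Longrightarrow> converges X x \<Longrightarrow> x \<in> B"
  shows "cstar_subalgebra B A"
  unfolding cstar_subalgebra_def
proof (intro conjI ballI allI impI assms(1-6))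
  fix X x assume x: "x \<in> carrier A" and X: "(\<forall>k::nat. X k \<in> B) \<and> (\<lambda>k. nrm A (X k \<ominus> x)) \<longlonglongrightarrow> 0"
  show "x \<in> B"
  proof (rule assms(7)[of X])
    show "converges X x"
      using x X assms(1) unfolding converges_def by blast
  qed (use X in blast)
qed

lemma cstar_subalgebra_carrier: "cstar_subalgebra (carrier A) A"
  by (rule cstar_subalgebraI) (auto simp: smult_closed star_closed convergesD)

lemma cstar_generated:
  assumes G: "G \<subseteq> carrier A"
  shows "cstar_subalgebra (carrier (cstar_generated A G)) A"
    and "G \<subseteq> carrier (cstar_generated A G)"
    and "cstar_subalgebra B A \<Longrightarrow> G \<subseteq> B \<Longrightarrow> carrier (cstar_generated A G) \<subseteq> B"
proof -
  let ?F = "{B. cstar_subalgebra B A \<and> G \<subseteq> B}"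
  have F: "cstar_subalgebra B A" if "B \<in> ?F" for B
    using that by blast
  have ne: "carrier A \<in> ?F"
    using G cstar_subalgebra_carrier by blast
  have "cstar_subalgebra (\<Inter>?F) A"
  proof (rule cstar_subalgebraI)
    show "\<Inter>?F \<subseteq> carrier A"
      using ne by blast
    show "x \<in> \<Inter>?F" if "\<And>k. X k \<in> \<Inter>?F" "converges X x" for X x
    proof (rule InterI)
      fix B assume B: "B \<in> ?F"
      show "x \<in> B"
        by (rule cstar_subalgebraD(7)[OF F[OF B] _ that(2)]) (use that(1) B in blast)
    qed
  qed (auto intro: cstar_subalgebraD(2-6))
  then show "cstar_subalgebra (carrier (cstar_generated A G)) A"
    by (simp add: cstar_generated_def)
  show "G \<subseteq> carrier (cstar_generated A G)"
    by (auto simp: cstar_generated_def)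
  show "cstar_subalgebra B A \<Longrightarrow> G \<subseteq> B \<Longrightarrow> carrier (cstar_generated A G) \<subseteq> B"
    by (auto simp: cstar_generated_def)
qed

text \<open>Subtraction goes through the additive inverse, which is described relative to the
  carrier; so its agreement in the smaller algebra is a statement to prove. Both inverses are the
  multiple by -1.\<close>

lemma subalgebra_a_minus:
  assumes B: "cstar_subalgebra B A" and xy: "x \<in> B" "y \<in> B"
    and r: "ring (A\<lparr>carrier := B\<rparr>)"
  shows "x \<ominus>\<^bsub>A\<lparr>carrier := B\<rparr>\<^esub> y = x \<ominus> y"
proof -
  interpret B: ring "A\<lparr>carrier := B\<rparr>"
    by (rule r)
  note D = cstar_subalgebraD[OF B]
  have y: "y \<in> carrier A" "(-1) \<odot> y \<in> B"
    using D xy by auto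
  have "(-1) \<odot> y = \<ominus>\<^bsub>A\<lparr>carrier := B\<rparr>\<^esub> y"
    by (rule B.minus_equality[symmetric]) (use y xy in \<open>simp_all add: smult_minus_1 l_neg\<close>)
  then show ?thesis
    using y by (simp add: a_minus_def smult_minus_1)
qed

lemma unital_cstar_algebra_subalgebra:
  assumes B: "cstar_subalgebra B A" and one: "\<one> \<in> B"
  shows "unital_cstar_algebra (A\<lparr>carrier := B\<rparr>)"
proof -
  note D = cstar_subalgebraD[OF B]
  have c: "x \<in> carrier A" if "x \<in> B" for x
    using that D(1) by blast
  have r: "ring (A\<lparr>carrier := B\<rparr>)"
  proof (rule ringI)
    show "abelian_group (A\<lparr>carrier := B\<rparr>)"
    proof (rule abelian_groupI)
      fix x assume "x \<in> carrier (A\<lparr>carrier := B\<rparr>)"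
      then have x: "x \<in> B"
        by simp
      have "(-1) \<odot> x \<oplus> x = \<zero>"
        using smult_minus_1[OF c[OF x]] c[OF x] by (simp add: l_neg)
      then show "\<exists>y\<in>carrier (A\<lparr>carrier := B\<rparr>). y \<oplus>\<^bsub>A\<lparr>carrier := B\<rparr>\<^esub> x = \<zero>\<^bsub>A\<lparr>carrier := B\<rparr>\<^esub>"
        using D(5)[OF x, of "-1"] by auto
    qed (auto simp: D c a_ac)
    show "monoid (A\<lparr>carrier := B\<rparr>)"
      by (rule monoidI) (auto simp: D one m_assoc c)
  qed (auto simp: c l_distr r_distr)
  note m = subalgebra_a_minus[OF B _ _ r]
  show ?thesis
  proof (intro unital_cstar_algebra.intro r unital_cstar_algebra_axioms.intro)
    fix X :: "nat \<Rightarrow> 'a"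
    assume "\<And>k. X k \<in> carrier (A\<lparr>carrier := B\<rparr>)"
    then have X: "X k \<in> B" for k
      by simp
    assume C: "\<And>e. 0 < e \<Longrightarrow>
      \<exists>N. \<forall>k\<ge>N. \<forall>l\<ge>N. nrm (A\<lparr>carrier := B\<rparr>) (X k \<ominus>\<^bsub>A\<lparr>carrier := B\<rparr>\<^esub> X l) < e"
    obtain x where x: "converges X x"
      by (rule convergesE[OF c[OF X] C[unfolded m[OF X X], simplified]])
    have xB: "x \<in> B"
      by (rule D(7)[OF X x])
    show "\<exists>x\<in>carrier (A\<lparr>carrier := B\<rparr>).
        (\<lambda>k. nrm (A\<lparr>carrier := B\<rparr>) (X k \<ominus>\<^bsub>A\<lparr>carrier := B\<rparr>\<^esub> x)) \<longlonglongrightarrow> 0"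
    proof (rule bexI)
      show "(\<lambda>k. nrm (A\<lparr>carrier := B\<rparr>) (X k \<ominus>\<^bsub>A\<lparr>carrier := B\<rparr>\<^esub> x)) \<longlonglongrightarrow> 0"
        unfolding m[OF X xB] using convergesD(3)[OF x] by simp
    qed (simp add: xB)
  qed (auto simp: D c smult_l_distr smult_r_distr smult_assoc1 smult_one smult_mult_left smult_mult_right
      star_star star_add star_smult star_mult nrm_nonneg nrm_eq_0_iff nrm_triangle nrm_smult nrm_mult
      cstar_identity)
qed

lemma subalgebra_converges:
  assumes B: "cstar_subalgebra B A" and one: "\<one> \<in> B"
    and X: "\<And>k. X k \<in> B" "converges X x"
  shows "unital_cstar_algebra.converges (A\<lparr>carrier := B\<rparr>) X x"
proof -
  interpret B: unital_cstar_algebra "A\<lparr>carrier := B\<rparr>"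
    by (rule unital_cstar_algebra_subalgebra[OF B one])
  have x: "x \<in> B"
    by (rule cstar_subalgebraD(7)[OF B X])
  show ?thesis
    unfolding B.converges_def
    using X x convergesD(3)[OF X(2)] by (simp add: subalgebra_a_minus[OF B X(1) x B.ring_axioms])
qed

lemma subalgebra_trans:
  assumes B: "cstar_subalgebra B A" and one: "\<one> \<in> B" and C: "cstar_subalgebra C (A\<lparr>carrier := B\<rparr>)"
  shows "cstar_subalgebra C A"
proof -
  interpret B: unital_cstar_algebra "A\<lparr>carrier := B\<rparr>"
    by (rule unital_cstar_algebra_subalgebra[OF B one])
  note D = B.cstar_subalgebraD[OF C, simplified]
  show ?thesis
  proof (rule cstar_subalgebraI)
    show "C \<subseteq> carrier A"
      using D(1) cstar_subalgebraD(1)[OF B] by blast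
    fix X x assume X: "\<And>k. X k \<in> C" "converges X x"
    show "x \<in> C"
      by (rule D(7)[OF X(1) subalgebra_converges[OF B one _ X(2)]]) (use X(1) D(1) in blast)
  qed (use D in auto)
qed

text \<open>The algebraic operations pass to limits of sequences. The set of limits is itself closed
  because a limit of limits is again approximated from \<open>E\<close>, with an error of
  \<open>e / 2\<close> at each of the two stages.\<close>

lemma closure_subalgebra:
  assumes E: "E \<subseteq> carrier A" "\<zero> \<in> E" "\<And>x y. x \<in> E \<Longrightarrow> y \<in> E \<Longrightarrow> x \<oplus> y \<in> E"
    "\<And>x y. x \<in> E \<Longrightarrow> y \<in> E \<Longrightarrow> x \<otimes> y \<in> E" "\<And>c x. x \<in> E \<Longrightarrow> c \<odot> x \<in> E" "\<And>x. x \<in> E \<Longrightarrow> star A x \<in> E"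
  shows "cstar_subalgebra {x. \<exists>X. (\<forall>k. X k \<in> E) \<and> converges X x} A" (is "cstar_subalgebra ?L A")
proof -
  have L: "x \<in> ?L" if "\<And>k. X k \<in> E" "converges X x" for X x
    using that by auto
  show ?thesis
  proof (rule cstar_subalgebraI)
    show "?L \<subseteq> carrier A"
      using convergesD(2) by auto
    show "\<zero> \<in> ?L"
      by (rule L[OF _ converges_const[OF zero_closed]]) (rule E(2))
    fix x assume "x \<in> ?L"
    then obtain X where X: "\<forall>k. X k \<in> E" "converges X x"
      by auto
    show "c \<odot> x \<in> ?L" "star A x \<in> ?L" for c
      by (rule L[OF _ converges_smult[OF X(2)]] L[OF _ converges_star[OF X(2)]], simp add: X(1) E)+
    fix y assume "y \<in> ?L"
    then obtain Y where Y: "\<forall>k. Y k \<in> E" "converges Y y"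
      by auto
    show "x \<oplus> y \<in> ?L" "x \<otimes> y \<in> ?L"
      by (rule L[OF _ converges_add[OF X(2) Y(2)]] L[OF _ converges_mult[OF X(2) Y(2)]],
          simp add: X(1) Y(1) E)+
  next
    fix X x assume X: "\<And>k. X k \<in> ?L" "converges X x"
    have eps: "\<exists>d\<in>E. nrm A (d \<ominus> x) < e" if e: "0 < e" for e
    proof -
      obtain k where k: "nrm A (X k \<ominus> x) < e / 2"
        using converges_approx[OF X(2) half_gt_zero[OF e]] by blast
      obtain Z where Z: "\<forall>k. Z k \<in> E" "converges Z (X k)"
        using X(1)[of k] by blast
      obtain l where l: "nrm A (Z l \<ominus> X k) < e / 2"
        using converges_approx[OF Z(2) half_gt_zero[OF e]] by blast
      have "nrm A (Z l \<ominus> x) < e"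
        using nrm_minus_triangle[OF convergesD(1)[OF Z(2)] convergesD(2)[OF Z(2)] convergesD(2)[OF X(2)], of l] k l
        by simp
      then show ?thesis
        using Z(1) by blast
    qed
    show "x \<in> ?L"
      by (rule approx_converges[OF convergesD(2)[OF X(2)] E(1) eps]) (auto intro: L)
  qed
qed

end


subsection \<open>Unital *-homomorphisms\<close>

lemma unital_star_homI:
  assumes "\<And>x. x \<in> carrier A \<Longrightarrow> h x \<in> carrier B"
    "\<And>x y. x \<in> carrier A \<Longrightarrow> y \<in> carrier A \<Longrightarrow> h (x \<oplus>\<^bsub>A\<^esub> y) = h x \<oplus>\<^bsub>B\<^esub> h y"
    "\<And>x y. x \<in> carrier A \<Longrightarrow> y \<in> carrier A \<Longrightarrow> h (x \<otimes>\<^bsub>A\<^esub> y) = h x \<otimes>\<^bsub>B\<^esub> h y"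
    "h \<one>\<^bsub>A\<^esub> = \<one>\<^bsub>B\<^esub>" "\<And>c x. x \<in> carrier A \<Longrightarrow> h (c \<odot>\<^bsub>A\<^esub> x) = c \<odot>\<^bsub>B\<^esub> h x"
    "\<And>x. x \<in> carrier A \<Longrightarrow> h (star A x) = star B (h x)"
  shows "h \<in> unital_star_hom A B"
  using assms unfolding unital_star_hom_def ring_hom_def by blast

lemma unital_star_homD:
  assumes "h \<in> unital_star_hom A B"
  shows "x \<in> carrier A \<Longrightarrow> h x \<in> carrier B"
    "x \<in> carrier A \<Longrightarrow> y \<in> carrier A \<Longrightarrow> h (x \<oplus>\<^bsub>A\<^esub> y) = h x \<oplus>\<^bsub>B\<^esub> h y"
    "x \<in> carrier A \<Longrightarrow> y \<in> carrier A \<Longrightarrow> h (x \<otimes>\<^bsub>A\<^esub> y) = h x \<otimes>\<^bsub>B\<^esub> h y"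
    "h \<one>\<^bsub>A\<^esub> = \<one>\<^bsub>B\<^esub>" "x \<in> carrier A \<Longrightarrow> h (c \<odot>\<^bsub>A\<^esub> x) = c \<odot>\<^bsub>B\<^esub> h x"
    "x \<in> carrier A \<Longrightarrow> h (star A x) = star B (h x)"
  using assms unfolding unital_star_hom_def ring_hom_def by blast+

lemma unital_star_hom_compose:
  assumes "f \<in> unital_star_hom A B" "g \<in> unital_star_hom B C"
  shows "(\<lambda>x. g (f x)) \<in> unital_star_hom A C"
  by (rule unital_star_homI) (simp_all add: unital_star_homD[OF assms(1)] unital_star_homD[OF assms(2)])

lemma unital_star_hom_cong:
  assumes f: "f \<in> unital_star_hom A B" and A: "unital_cstar_algebra A"
    and eq: "\<And>x. x \<in> carrier A \<Longrightarrow> g x = f x"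
  shows "g \<in> unital_star_hom A B"
proof -
  interpret A: unital_cstar_algebra A
    by (rule A)
  show ?thesis
    by (rule unital_star_homI) (simp_all add: eq unital_star_homD[OF f] A.smult_closed A.star_closed)
qed

locale cstar_hom = A: unital_cstar_algebra A + B: unital_cstar_algebra B
  for A :: "'a cstar" and B :: "'b cstar" +
  fixes h :: "'a \<Rightarrow> 'b"
  assumes hom: "h \<in> unital_star_hom A B"
begin

lemmas hom_closed = unital_star_homD(1)[OF hom]
  and hom_add = unital_star_homD(2)[OF hom]
  and hom_mult = unital_star_homD(3)[OF hom]
  and hom_one = unital_star_homD(4)[OF hom]
  and hom_smult = unital_star_homD(5)[OF hom]
  and hom_star = unital_star_homD(6)[OF hom]

lemma hom_zero: "h \<zero>\<^bsub>A\<^esub> = \<zero>\<^bsub>B\<^esub>"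
  using hom_smult[OF A.zero_closed, of 0] by (simp add: A.smult_0 B.smult_0 hom_closed)

lemma hom_minus: "x \<in> carrier A \<Longrightarrow> y \<in> carrier A \<Longrightarrow> h (x \<ominus>\<^bsub>A\<^esub> y) = h x \<ominus>\<^bsub>B\<^esub> h y"
  by (simp add: A.minus_eq_smult B.minus_eq_smult hom_add hom_smult A.smult_closed hom_closed)

text \<open>A self-adjoint \<open>x\<close> of norm less than 1 is the real part of the unitary \<open>x + i s\<close> with
  \<open>s\<^sup>2 = 1 - x\<^sup>2\<close>, and homomorphisms map unitaries to unitaries.\<close>

lemma nrm_hom_le_1:
  assumes x: "x \<in> carrier A" and sa: "star A x = x" and less: "nrm A x < 1"
  shows "nrm B (h x) \<le> 1"
proof -
  obtain s where s: "s \<in> carrier A" "star A s = s" "s \<otimes>\<^bsub>A\<^esub> x = x \<otimes>\<^bsub>A\<^esub> s"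
    "s \<otimes>\<^bsub>A\<^esub> s = \<one>\<^bsub>A\<^esub> \<ominus>\<^bsub>A\<^esub> x \<otimes>\<^bsub>A\<^esub> x"
    by (rule A.sqrt_one_minus_square[OF x sa less])
  define u where "u = x \<oplus>\<^bsub>A\<^esub> \<i> \<odot>\<^bsub>A\<^esub> s"
  have cs: "c \<odot>\<^bsub>A\<^esub> s \<in> carrier A" for c
    by (rule A.smult_closed[OF s(1)])
  have u: "u \<in> carrier A"
    using x cs by (simp add: u_def)
  have star_u: "star A u = x \<oplus>\<^bsub>A\<^esub> (-\<i>) \<odot>\<^bsub>A\<^esub> s"
    using x cs by (simp add: u_def A.star_add A.star_smult sa s)
  have "star A u \<otimes>\<^bsub>A\<^esub> u = (x \<otimes>\<^bsub>A\<^esub> x \<oplus>\<^bsub>A\<^esub> \<i> \<odot>\<^bsub>A\<^esub> (x \<otimes>\<^bsub>A\<^esub> s)) \<oplus>\<^bsub>A\<^esub>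
      ((-\<i>) \<odot>\<^bsub>A\<^esub> (x \<otimes>\<^bsub>A\<^esub> s) \<oplus>\<^bsub>A\<^esub> s \<otimes>\<^bsub>A\<^esub> s)"
  proof -
    have "x \<otimes>\<^bsub>A\<^esub> (\<i> \<odot>\<^bsub>A\<^esub> s) = \<i> \<odot>\<^bsub>A\<^esub> (x \<otimes>\<^bsub>A\<^esub> s)" "((-\<i>) \<odot>\<^bsub>A\<^esub> s) \<otimes>\<^bsub>A\<^esub> x = (-\<i>) \<odot>\<^bsub>A\<^esub> (x \<otimes>\<^bsub>A\<^esub> s)"
      "((-\<i>) \<odot>\<^bsub>A\<^esub> s) \<otimes>\<^bsub>A\<^esub> (\<i> \<odot>\<^bsub>A\<^esub> s) = s \<otimes>\<^bsub>A\<^esub> s"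
      using x s(1,3) cs
      by (simp_all add: A.smult_mult_left A.smult_mult_right A.smult_one flip: A.smult_assoc1)
    moreover have "(x \<oplus>\<^bsub>A\<^esub> a) \<otimes>\<^bsub>A\<^esub> (x \<oplus>\<^bsub>A\<^esub> b) =
        (x \<otimes>\<^bsub>A\<^esub> x \<oplus>\<^bsub>A\<^esub> x \<otimes>\<^bsub>A\<^esub> b) \<oplus>\<^bsub>A\<^esub> (a \<otimes>\<^bsub>A\<^esub> x \<oplus>\<^bsub>A\<^esub> a \<otimes>\<^bsub>A\<^esub> b)"
      if "a \<in> carrier A" "b \<in> carrier A" for a b
      using x that by (simp add: A.l_distr A.r_distr A.a_ac)
    ultimately show ?thesis
      unfolding star_u unfolding u_def using cs by simp
  qed
  also have "\<dots> = \<one>\<^bsub>A\<^esub>"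
  proof -
    have "(\<i> \<odot>\<^bsub>A\<^esub> (x \<otimes>\<^bsub>A\<^esub> s)) \<oplus>\<^bsub>A\<^esub> ((-\<i>) \<odot>\<^bsub>A\<^esub> (x \<otimes>\<^bsub>A\<^esub> s)) = \<zero>\<^bsub>A\<^esub>"
      using A.smult_l_distr[of "x \<otimes>\<^bsub>A\<^esub> s" "\<i>" "-\<i>"] x s(1) by (simp add: A.smult_0)
    moreover have "(x \<otimes>\<^bsub>A\<^esub> x \<oplus>\<^bsub>A\<^esub> p) \<oplus>\<^bsub>A\<^esub> (q \<oplus>\<^bsub>A\<^esub> s \<otimes>\<^bsub>A\<^esub> s) = \<one>\<^bsub>A\<^esub> \<oplus>\<^bsub>A\<^esub> (p \<oplus>\<^bsub>A\<^esub> q)"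
      if "p \<in> carrier A" "q \<in> carrier A" for p q
    proof -
      have "(x \<otimes>\<^bsub>A\<^esub> x \<oplus>\<^bsub>A\<^esub> p) \<oplus>\<^bsub>A\<^esub> (q \<oplus>\<^bsub>A\<^esub> s \<otimes>\<^bsub>A\<^esub> s) = (x \<otimes>\<^bsub>A\<^esub> x \<oplus>\<^bsub>A\<^esub> s \<otimes>\<^bsub>A\<^esub> s) \<oplus>\<^bsub>A\<^esub> (p \<oplus>\<^bsub>A\<^esub> q)"
        using that x s(1) by (simp add: A.a_ac)
      also have "x \<otimes>\<^bsub>A\<^esub> x \<oplus>\<^bsub>A\<^esub> s \<otimes>\<^bsub>A\<^esub> s = \<one>\<^bsub>A\<^esub>"
        unfolding s(4) using x by (simp add: a_minus_def A.a_lcomm[of "x \<otimes>\<^bsub>A\<^esub> x"] A.r_neg)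
      finally show ?thesis .
    qed
    ultimately show ?thesis
      using x s(1) by (simp add: A.smult_closed)
  qed
  finally have unitary: "star A u \<otimes>\<^bsub>A\<^esub> u = \<one>\<^bsub>A\<^esub>" .
  have "star B (h u) \<otimes>\<^bsub>B\<^esub> h u = \<one>\<^bsub>B\<^esub>"
    using arg_cong[OF unitary, of h] u by (simp add: hom_mult hom_star hom_one A.star_closed)
  then have 1: "nrm B (h u) \<le> 1"
    by (rule B.nrm_isometry_le[OF hom_closed[OF u]])
  have "2 \<odot>\<^bsub>A\<^esub> x = u \<oplus>\<^bsub>A\<^esub> star A u"
  proof -
    have "u \<oplus>\<^bsub>A\<^esub> star A u = (x \<oplus>\<^bsub>A\<^esub> x) \<oplus>\<^bsub>A\<^esub> (\<i> \<odot>\<^bsub>A\<^esub> s \<oplus>\<^bsub>A\<^esub> (-\<i>) \<odot>\<^bsub>A\<^esub> s)"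
      unfolding star_u unfolding u_def using x cs by (simp add: A.a_ac)
    also have "\<i> \<odot>\<^bsub>A\<^esub> s \<oplus>\<^bsub>A\<^esub> (-\<i>) \<odot>\<^bsub>A\<^esub> s = \<zero>\<^bsub>A\<^esub>"
      using A.smult_l_distr[of s "\<i>" "-\<i>"] s(1) by (simp add: A.smult_0)
    finally show ?thesis
      using A.smult_l_distr[of x 1 1] x by (simp add: A.smult_one)
  qed
  then have "h (2 \<odot>\<^bsub>A\<^esub> x) = h u \<oplus>\<^bsub>B\<^esub> star B (h u)"
    using u by (simp add: hom_add hom_star A.star_closed)
  then have "2 * nrm B (h x) = nrm B (h u \<oplus>\<^bsub>B\<^esub> star B (h u))"
    using x B.nrm_smult[OF hom_closed[OF x], of 2] by (simp add: hom_smult)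
  also have "\<dots> \<le> nrm B (h u) + nrm B (star B (h u))"
    by (intro B.nrm_triangle B.star_closed hom_closed u)
  also have "\<dots> \<le> 2"
    using 1 B.nrm_star[OF hom_closed[OF u]] by simp
  finally show ?thesis
    by simp
qed

text \<open>The C*-identity reduces the claim to the self-adjoint element \<open>x* x\<close>. A
  self-adjoint \<open>y\<close> is divided by an arbitrary \<open>t\<close> above its norm to come
  under the unit ball estimate, and then \<open>t\<close> decreases to the norm.\<close>

lemma nrm_hom_le:
  assumes x: "x \<in> carrier A"
  shows "nrm B (h x) \<le> nrm A x"
proof -
  have sa: "nrm B (h y) \<le> nrm A y" if y: "y \<in> carrier A" and sa: "star A y = y" for y
  proof (rule dense_ge)
    fix t assume t: "nrm A y < t"
    then have t0: "0 < t"
      using A.nrm_nonneg[OF y] by linarith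
    let ?z = "complex_of_real (1 / t) \<odot>\<^bsub>A\<^esub> y"
    have le: "nrm B (h ?z) \<le> 1"
    proof (rule nrm_hom_le_1)
      show "?z \<in> carrier A"
        by (rule A.smult_closed[OF y])
      show "star A ?z = ?z"
        using A.star_smult[OF y, of "complex_of_real (1 / t)"] sa by simp
      show "nrm A ?z < 1"
        using A.nrm_smult[OF y, of "complex_of_real (1 / t)"] t t0 by (simp add: norm_divide)
    qed
    have eq: "nrm B (h ?z) = nrm B (h y) / t"
      using B.nrm_smult[OF hom_closed[OF y], of "complex_of_real (1 / t)"] hom_smult[OF y, of "complex_of_real (1 / t)"] t0
      by (simp add: norm_divide)
    from le[unfolded eq] show "nrm B (h y) \<le> t"
      using t0 by (simp add: field_simps)
  qed
  let ?y = "star A x \<otimes>\<^bsub>A\<^esub> x"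
  have y: "?y \<in> carrier A" "star A ?y = ?y"
    using x by (simp_all add: A.star_closed A.star_mult A.star_star)
  have "(nrm B (h x))\<^sup>2 = nrm B (h ?y)"
    using x B.cstar_identity[OF hom_closed[OF x]] by (simp add: hom_mult hom_star A.star_closed)
  also have "\<dots> \<le> (nrm A x)\<^sup>2"
    using sa[OF y] A.cstar_identity[OF x] by simp
  finally show ?thesis
    by (rule power2_le_imp_le) (rule A.nrm_nonneg[OF x])
qed

lemma hom_converges:
  assumes "A.converges X x"
  shows "B.converges (\<lambda>k. h (X k)) (h x)"
proof (rule B.convergesI)
  note c = A.convergesD[OF assms]
  show "nrm B (h (X k) \<ominus>\<^bsub>B\<^esub> h x) \<le> nrm A (X k \<ominus>\<^bsub>A\<^esub> x)" for k
    using nrm_hom_le[of "X k \<ominus>\<^bsub>A\<^esub> x"] c by (simp add: hom_minus)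
  show "(\<lambda>k. nrm A (X k \<ominus>\<^bsub>A\<^esub> x)) \<longlonglongrightarrow> 0"
    by (rule c(3))
qed (use A.convergesD[OF assms] hom_closed in auto)

text \<open>Automatic continuity makes preimages closed, so it can be checked on generators that an
  image lies in a given subalgebra.\<close>

lemma vimage_subalgebra:
  assumes C: "cstar_subalgebra C B"
  shows "cstar_subalgebra {x \<in> carrier A. h x \<in> C} A"
proof (rule A.cstar_subalgebraI)
  note D = B.cstar_subalgebraD[OF C]
  fix X x assume X: "\<And>k. X k \<in> {x \<in> carrier A. h x \<in> C}" "A.converges X x"
  have "h x \<in> C"
    by (rule D(7)[OF _ hom_converges[OF X(2)]]) (use X(1) in blast)
  then show "x \<in> {x \<in> carrier A. h x \<in> C}"
    using A.convergesD[OF X(2)] by simp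
qed (use B.cstar_subalgebraD(2-6)[OF C] in
    \<open>auto simp: A.smult_closed A.star_closed hom_zero hom_add hom_mult hom_smult hom_star\<close>)

text \<open>By automatic continuity the set of agreement is closed; hence homomorphisms that agree
  on generators agree on the algebra generated.\<close>

lemma equalizer_subalgebra:
  assumes g: "g \<in> unital_star_hom A B"
  shows "cstar_subalgebra {x \<in> carrier A. h x = g x} A"
proof -
  interpret g: cstar_hom A B g
    by unfold_locales (rule g)
  show ?thesis
  proof (rule A.cstar_subalgebraI)
    fix X x assume X: "\<And>k. X k \<in> {x \<in> carrier A. h x = g x}" "A.converges X x"
    have "h x = g x"
      by (rule B.converges_unique[OF hom_converges[OF X(2)]]) (use X(1) g.hom_converges[OF X(2)] in auto)
    then show "x \<in> {x \<in> carrier A. h x = g x}"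
      using A.convergesD[OF X(2)] by simp
  qed (auto simp: A.smult_closed A.star_closed hom_zero hom_add hom_mult hom_smult hom_star
      g.hom_zero g.hom_add g.hom_mult g.hom_smult g.hom_star)
qed

end


subsection \<open>Extending isometric relations\<close>

text \<open>\<open>R\<close> plays the part of a densely defined isometric homomorphism, but
  single-valuedness is not postulated: it follows from \<open>R_nrm\<close> applied to differences.
  The relational form can be reversed, so injectivity and surjectivity come from the same locale for
  the converse of \<open>R\<close>.\<close>

locale isometric_relation = A: unital_cstar_algebra A + B: unital_cstar_algebra B
  for A :: "'a cstar" and B :: "'b cstar" +
  fixes R :: "('a \<times> 'b) set"
  assumes R_closed: "(x, y) \<in> R \<Longrightarrow> x \<in> carrier A \<and> y \<in> carrier B"
    and R_one: "(\<one>\<^bsub>A\<^esub>, \<one>\<^bsub>B\<^esub>) \<in> R"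
    and R_add: "(x, y) \<in> R \<Longrightarrow> (x', y') \<in> R \<Longrightarrow> (x \<oplus>\<^bsub>A\<^esub> x', y \<oplus>\<^bsub>B\<^esub> y') \<in> R"
    and R_mult: "(x, y) \<in> R \<Longrightarrow> (x', y') \<in> R \<Longrightarrow> (x \<otimes>\<^bsub>A\<^esub> x', y \<otimes>\<^bsub>B\<^esub> y') \<in> R"
    and R_smult: "(x, y) \<in> R \<Longrightarrow> (c \<odot>\<^bsub>A\<^esub> x, c \<odot>\<^bsub>B\<^esub> y) \<in> R"
    and R_star: "(x, y) \<in> R \<Longrightarrow> (star A x, star B y) \<in> R"
    and R_nrm: "(x, y) \<in> R \<Longrightarrow> nrm B y = nrm A x"
    and R_dense: "x \<in> carrier A \<Longrightarrow> 0 < e \<Longrightarrow> \<exists>x'\<in>Domain R. nrm A (x' \<ominus>\<^bsub>A\<^esub> x) < e"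
begin

definition cl :: "('a \<times> 'b) set" where
  "cl = {(x, y). \<exists>X Y. (\<forall>k. (X k, Y k) \<in> R) \<and> A.converges X x \<and> B.converges Y y}"

lemma clI: "(\<And>k. (X k, Y k) \<in> R) \<Longrightarrow> A.converges X x \<Longrightarrow> B.converges Y y \<Longrightarrow> (x, y) \<in> cl"
  by (auto simp: cl_def)

lemma clE:
  assumes "(x, y) \<in> cl"
  obtains X Y where "\<And>k. (X k, Y k) \<in> R" "A.converges X x" "B.converges Y y"
proof -
  obtain X Y where XY: "\<forall>k. (X k, Y k) \<in> R" "A.converges X x" "B.converges Y y"
    using assms unfolding cl_def by blast
  show thesis
    by (rule that[OF spec[OF XY(1)] XY(2,3)])
qed

lemma cl_closed: "(x, y) \<in> cl \<Longrightarrow> x \<in> carrier A \<and> y \<in> carrier B"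
  by (auto elim!: clE dest: A.convergesD(2) B.convergesD(2))

lemma cl_one: "(\<one>\<^bsub>A\<^esub>, \<one>\<^bsub>B\<^esub>) \<in> cl"
  by (rule clI[OF R_one]) (simp_all add: A.converges_const B.converges_const)

lemma cl_add: "(x, y) \<in> cl \<Longrightarrow> (x', y') \<in> cl \<Longrightarrow> (x \<oplus>\<^bsub>A\<^esub> x', y \<oplus>\<^bsub>B\<^esub> y') \<in> cl"
  by (elim clE) (rule clI[OF R_add A.converges_add B.converges_add])

lemma cl_mult: "(x, y) \<in> cl \<Longrightarrow> (x', y') \<in> cl \<Longrightarrow> (x \<otimes>\<^bsub>A\<^esub> x', y \<otimes>\<^bsub>B\<^esub> y') \<in> cl"
  by (elim clE) (rule clI[OF R_mult A.converges_mult B.converges_mult])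

lemma cl_smult: "(x, y) \<in> cl \<Longrightarrow> (c \<odot>\<^bsub>A\<^esub> x, c \<odot>\<^bsub>B\<^esub> y) \<in> cl"
  by (elim clE) (rule clI[OF R_smult A.converges_smult B.converges_smult])

lemma cl_star: "(x, y) \<in> cl \<Longrightarrow> (star A x, star B y) \<in> cl"
  by (elim clE) (rule clI[OF R_star A.converges_star B.converges_star])

lemma cl_nrm:
  assumes "(x, y) \<in> cl"
  shows "nrm B y = nrm A x"
proof -
  obtain X Y where *: "\<And>k. (X k, Y k) \<in> R" "A.converges X x" "B.converges Y y"
    by (rule clE[OF assms]) (rule that, auto)
  have "(\<lambda>k. nrm A (X k)) \<longlonglongrightarrow> nrm B y"
    using B.converges_nrm[OF *(3)] by (simp add: R_nrm[OF *(1)])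
  then show ?thesis
    using A.converges_nrm[OF *(2)] LIMSEQ_unique by blast
qed

lemma cl_minus: "(x, y) \<in> cl \<Longrightarrow> (x', y') \<in> cl \<Longrightarrow> (x \<ominus>\<^bsub>A\<^esub> x', y \<ominus>\<^bsub>B\<^esub> y') \<in> cl"
  using cl_add[OF _ cl_smult[of x' y' "-1"]] cl_closed by (simp add: A.minus_eq_smult B.minus_eq_smult)

text \<open>The difference of two partners of \<open>x\<close> is a partner of zero and so has norm
  zero.\<close>

lemma cl_unique:
  assumes "(x, y) \<in> cl" "(x, y') \<in> cl"
  shows "y = y'"
proof -
  have "nrm B (y \<ominus>\<^bsub>B\<^esub> y') = nrm A (x \<ominus>\<^bsub>A\<^esub> x)"
    by (rule cl_nrm[OF cl_minus[OF assms]])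
  then show ?thesis
    using cl_closed[OF assms(1)] cl_closed[OF assms(2)]
    by (simp add: A.minus_self A.nrm_zero B.nrm_eq_0_iff B.minus_zero_iff)
qed

text \<open>Partners of an approximating sequence form a Cauchy sequence, since differences of
  related pairs are related and have equal norms; completeness of \<open>B\<close> supplies the
  limit.\<close>

lemma cl_total:
  assumes x: "x \<in> carrier A"
  shows "\<exists>y. (x, y) \<in> cl"
proof -
  have D: "Domain R \<subseteq> carrier A"
    using R_closed by blast
  obtain X where X: "\<And>k. X k \<in> Domain R" "A.converges X x"
    using A.approx_converges[OF x D R_dense[OF x]] by blast
  have "\<forall>k. \<exists>y. (X k, y) \<in> R"
    using X(1) by blast
  then obtain Y where "\<forall>k. (X k, Y k) \<in> R"
    using choice[of "\<lambda>k y. (X k, y) \<in> R"] by blast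
  then have Y: "(X k, Y k) \<in> R" for k
    by blast
  have sub: "(X k \<ominus>\<^bsub>A\<^esub> X l, Y k \<ominus>\<^bsub>B\<^esub> Y l) \<in> R" for k l
    using R_add[OF Y R_smult[OF Y, of "-1"]] R_closed[OF Y] by (simp add: A.minus_eq_smult B.minus_eq_smult)
  obtain y where "B.converges Y y"
  proof (rule B.convergesE)
    show "\<exists>N. \<forall>k\<ge>N. \<forall>l\<ge>N. nrm B (Y k \<ominus>\<^bsub>B\<^esub> Y l) < e" if "0 < e" for e
      unfolding R_nrm[OF sub] by (rule A.converges_Cauchy[OF X(2) that])
  qed (use R_closed[OF Y] in auto)
  with Y X(2) show ?thesis
    by (blast intro: clI)
qed

end

lemma isometric_relation_extends:
  assumes AB: "isometric_relation A B R" and BA: "isometric_relation B A (R\<inverse>)"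
  obtains h where "h \<in> unital_star_hom A B" "bij_betw h (carrier A) (carrier B)"
    "\<And>x. x \<in> carrier A \<Longrightarrow> nrm B (h x) = nrm A x"
proof -
  interpret AB: isometric_relation A B R
    by (rule AB)
  interpret BA: isometric_relation B A "R\<inverse>"
    by (rule BA)
  have conv: "(y, x) \<in> BA.cl \<longleftrightarrow> (x, y) \<in> AB.cl" for x y
    by (auto simp: AB.cl_def BA.cl_def)
  define h where "h = (\<lambda>x. THE y. (x, y) \<in> AB.cl)"
  have h: "(x, h x) \<in> AB.cl" if x: "x \<in> carrier A" for x
  proof -
    obtain y where y: "(x, y) \<in> AB.cl"
      using AB.cl_total[OF x] by blast
    show ?thesis
      unfolding h_def by (rule theI[of "\<lambda>y. (x, y) \<in> AB.cl", OF y AB.cl_unique[OF _ y]])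
  qed
  have hI: "h x = y" if "(x, y) \<in> AB.cl" for x y
    using AB.cl_unique[OF h that] AB.cl_closed[OF that] by blast
  show thesis
  proof
    show "h \<in> unital_star_hom A B"
    proof (rule unital_star_homI)
      show "h x \<in> carrier B" if "x \<in> carrier A" for x
        using AB.cl_closed[OF h[OF that]] by blast
    qed (auto intro!: hI AB.cl_add AB.cl_mult AB.cl_one AB.cl_smult AB.cl_star h)
    show "nrm B (h x) = nrm A x" if "x \<in> carrier A" for x
      by (rule AB.cl_nrm[OF h[OF that]])
    show "bij_betw h (carrier A) (carrier B)"
    proof (rule bij_betwI')
      fix x x' assume x: "x \<in> carrier A" "x' \<in> carrier A"
      show "h x = h x' \<longleftrightarrow> x = x'"
        using BA.cl_unique[of "h x" x x'] h[OF x(1)] h[OF x(2)] by (auto simp: conv)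
    next
      show "h x \<in> carrier B" if "x \<in> carrier A" for x
        using AB.cl_closed[OF h[OF that]] by blast
    next
      fix y assume "y \<in> carrier B"
      then obtain x where "(x, y) \<in> AB.cl"
        using BA.cl_total conv by blast
      then show "\<exists>x\<in>carrier A. y = h x"
        using hI AB.cl_closed by blast
    qed
  qed
qed

subsection \<open>Amplifications\<close>

text \<open>A bijection of \<open>R \<times> N\<close> with \<open>S\<close> identifies \<open>l\<^sup>2(S)\<close> with a direct sum of copies of
  \<open>l\<^sup>2(N)\<close>, on which the operators on \<open>l\<^sup>2(N)\<close> act diagonally.\<close>

locale amplification =
  fixes S :: "'g set" and N :: "'n set" and R :: "'r set"
    and c :: "'r \<Rightarrow> 'n \<Rightarrow> 'g" and p :: "'g \<Rightarrow> 'r" and q :: "'g \<Rightarrow> 'n"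
  assumes c_in: "r \<in> R \<Longrightarrow> z \<in> N \<Longrightarrow> c r z \<in> S"
    and p_c: "r \<in> R \<Longrightarrow> z \<in> N \<Longrightarrow> p (c r z) = r"
    and q_c: "r \<in> R \<Longrightarrow> z \<in> N \<Longrightarrow> q (c r z) = z"
    and p_in: "g \<in> S \<Longrightarrow> p g \<in> R"
    and q_in: "g \<in> S \<Longrightarrow> q g \<in> N"
    and c_p_q: "g \<in> S \<Longrightarrow> c (p g) (q g) = g"
begin

lemma bij: "bij_betw (\<lambda>(r, z). c r z) (R \<times> N) S"
  by (rule bij_betw_byWitness[where f'="\<lambda>g. (p g, q g)"]) (auto simp: c_in p_c q_c p_in q_in c_p_q)

text \<open>The component of \<open>f\<close> in the copy of \<open>l\<^sup>2(N)\<close> labelled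
  \<open>r\<close>, set to 0 off \<open>N\<close> as membership in \<open>ell2 N\<close>
  demands.\<close>

definition slice :: "('g \<Rightarrow> complex) \<Rightarrow> 'r \<Rightarrow> 'n \<Rightarrow> complex" where
  "slice f r = (\<lambda>z. if z \<in> N then f (c r z) else 0)"

lemma slice_add: "slice (\<lambda>x. f x + g x) r = (\<lambda>x. slice f r x + slice g r x)"
  by (auto simp: slice_def)

lemma slice_scale: "slice (\<lambda>x. a * f x) r = (\<lambda>x. a * slice f r x)"
  by (auto simp: slice_def)

text \<open>Tonelli's theorem for the nonnegative family of squared values on
  \<open>R \<times> N\<close>.\<close>

lemma ell2_iff:
  assumes "\<And>g. g \<notin> S \<Longrightarrow> f g = 0"
  shows "f \<in> ell2 S \<longleftrightarrow>
    (\<forall>r\<in>R. slice f r \<in> ell2 N) \<and> (\<lambda>r. (ell2_norm N (slice f r))\<^sup>2) summable_on R"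
proof -
  have nn: "(ell2_norm N (slice f r))\<^sup>2 = (\<Sum>\<^sub>\<infinity>z\<in>N. (cmod (f (c r z)))\<^sup>2)" for r
  proof -
    have "(\<Sum>\<^sub>\<infinity>z\<in>N. (cmod (slice f r z))\<^sup>2) = (\<Sum>\<^sub>\<infinity>z\<in>N. (cmod (f (c r z)))\<^sup>2)"
      by (rule infsum_cong) (simp add: slice_def)
    then show ?thesis
      by (simp add: ell2_norm_def infsum_nonneg)
  qed
  have sl: "slice f r \<in> ell2 N \<longleftrightarrow> (\<lambda>z. (cmod (f (c r z)))\<^sup>2) summable_on N" for r
  proof -
    have "(\<lambda>z. (cmod (slice f r z))\<^sup>2) summable_on N \<longleftrightarrow> (\<lambda>z. (cmod (f (c r z)))\<^sup>2) summable_on N"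
      by (rule summable_on_cong) (simp add: slice_def)
    then show ?thesis
      by (simp add: ell2_def) (simp add: slice_def)
  qed
  have "f \<in> ell2 S \<longleftrightarrow> (\<lambda>g. (cmod (f g))\<^sup>2) summable_on S"
    using assms by (simp add: ell2_def)
  also have "\<dots> \<longleftrightarrow> (\<lambda>(r, z). (cmod (f (c r z)))\<^sup>2) summable_on (R \<times> N)"
    using summable_on_reindex_bij_betw[OF bij, of "\<lambda>g. (cmod (f g))\<^sup>2"] by (simp add: case_prod_unfold)
  \<comment> \<open>The terms are nonnegative; the norm is inserted only to match the criterion for
    absolute summability on a product.\<close>
  also have "\<dots> \<longleftrightarrow> (\<lambda>x. norm ((\<lambda>(r, z). (cmod (f (c r z)))\<^sup>2) x)) summable_on (Sigma R (\<lambda>_. N))"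
    by (rule summable_on_cong) auto
  also have "\<dots> \<longleftrightarrow> (\<forall>r\<in>R. (\<lambda>z. (cmod (f (c r z)))\<^sup>2) summable_on N) \<and>
      (\<lambda>r. \<Sum>\<^sub>\<infinity>z\<in>N. (cmod (f (c r z)))\<^sup>2) summable_on R"
    using Infinite_Sum.abs_summable_on_Sigma_iff[of "\<lambda>(r, z). (cmod (f (c r z)))\<^sup>2" R "\<lambda>_. N"]
    by (simp add: infsum_nonneg)
  finally show ?thesis
    unfolding sl nn .
qed

lemma slice_ell2:
  assumes "f \<in> ell2 S"
  shows "r \<in> R \<Longrightarrow> slice f r \<in> ell2 N" and "(\<lambda>r. (ell2_norm N (slice f r))\<^sup>2) summable_on R"
  using assms ell2_iff[of f] ell2_outside[OF assms] by auto

lemma inner_slice: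
  assumes f: "f \<in> ell2 S" and g: "g \<in> ell2 S"
  shows "ell2_inner S f g = (\<Sum>\<^sub>\<infinity>r\<in>R. ell2_inner N (slice f r) (slice g r))"
proof -
  let ?u = "\<lambda>(r, z). f (c r z) * cnj (g (c r z))"
  have "ell2_inner S f g = infsum ?u (R \<times> N)"
    unfolding ell2_inner_def
    using infsum_reindex_bij_betw[OF bij, of "\<lambda>x. f x * cnj (g x)"] by (simp add: case_prod_unfold)
  also have "\<dots> = (\<Sum>\<^sub>\<infinity>r\<in>R. \<Sum>\<^sub>\<infinity>z\<in>N. f (c r z) * cnj (g (c r z)))"
  proof (rule infsum_Sigma'_banach[symmetric])
    show "?u summable_on (R \<times> N)"
      using summable_on_reindex_bij_betw[OF bij, of "\<lambda>x. f x * cnj (g x)"] ell2_product_summable(2)[OF f g]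
      by (simp add: case_prod_unfold)
  qed
  also have "\<dots> = (\<Sum>\<^sub>\<infinity>r\<in>R. ell2_inner N (slice f r) (slice g r))"
    unfolding ell2_inner_def by (intro infsum_cong) (simp add: slice_def)
  finally show ?thesis .
qed

lemma norm_slice:
  assumes f: "f \<in> ell2 S"
  shows "(ell2_norm S f)\<^sup>2 = (\<Sum>\<^sub>\<infinity>r\<in>R. (ell2_norm N (slice f r))\<^sup>2)"
proof -
  have "complex_of_real ((ell2_norm S f)\<^sup>2) = (\<Sum>\<^sub>\<infinity>r\<in>R. ell2_inner N (slice f r) (slice f r))"
    using ell2_inner_self[OF f] inner_slice[OF f f] by simp
  also have "\<dots> = (\<Sum>\<^sub>\<infinity>r\<in>R. complex_of_real ((ell2_norm N (slice f r))\<^sup>2))"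
    by (rule infsum_cong) (rule ell2_inner_self[OF slice_ell2(1)[OF f]])
  also have "\<dots> = complex_of_real (\<Sum>\<^sub>\<infinity>r\<in>R. (ell2_norm N (slice f r))\<^sup>2)"
    by (rule infsumI, rule has_sum_of_real_iff[THEN iffD2], rule has_sum_infsum, rule slice_ell2(2)[OF f])
  finally show ?thesis
    by (simp only: of_real_eq_iff)
qed

text \<open>This is the operator \<open>1 \<otimes> X\<close> on
  \<open>l\<^sup>2(R) \<otimes> l\<^sup>2(N)\<close>, transported to \<open>S\<close> along the
  bijection.\<close>

definition amp :: "'n ell2_op \<Rightarrow> 'g ell2_op" where
  "amp X = (\<lambda>f\<in>ell2 S. \<lambda>g. if g \<in> S then X (slice f (p g)) (q g) else 0)"

lemma slice_amp:
  assumes X: "X \<in> bounded_ops N" and f: "f \<in> ell2 S" and r: "r \<in> R"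
  shows "slice (amp X f) r = X (slice f r)"
proof
  fix z
  show "slice (amp X f) r z = X (slice f r) z"
    using ell2_outside[OF bounded_opsD(1)[OF X slice_ell2(1)[OF f r]]] f r
    by (simp add: slice_def amp_def c_in p_c q_c)
qed

lemma amp_ell2:
  assumes X: "X \<in> bounded_ops N" and f: "f \<in> ell2 S"
  shows "amp X f \<in> ell2 S" and "ell2_norm S (amp X f) \<le> op_norm N X * ell2_norm S f"
proof -
  let ?C = "(op_norm N X)\<^sup>2"
  have le: "(ell2_norm N (slice (amp X f) r))\<^sup>2 \<le> ?C * (ell2_norm N (slice f r))\<^sup>2" if "r \<in> R" for r
    unfolding slice_amp[OF X f that] power_mult_distrib[symmetric]
    by (intro power_mono op_norm_bound[OF X slice_ell2(1)[OF f that]]) simp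
  have sum: "(\<lambda>r. ?C * (ell2_norm N (slice f r))\<^sup>2) summable_on R"
    by (intro summable_on_cmult_right slice_ell2(2)[OF f])
  have sum': "(\<lambda>r. (ell2_norm N (slice (amp X f) r))\<^sup>2) summable_on R"
    by (rule summable_on_comparison_test[OF sum le]) simp_all
  have out: "amp X f g = 0" if "g \<notin> S" for g
    using f that by (simp add: amp_def)
  show *: "amp X f \<in> ell2 S"
    using ell2_iff[of "amp X f"] out sum' bounded_opsD(1)[OF X slice_ell2(1)[OF f]] slice_amp[OF X f] by simp
  have "(ell2_norm S (amp X f))\<^sup>2 \<le> (\<Sum>\<^sub>\<infinity>r\<in>R. ?C * (ell2_norm N (slice f r))\<^sup>2)"
    unfolding norm_slice[OF *] by (rule infsum_mono[OF sum' sum le])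
  also have "\<dots> = (op_norm N X * ell2_norm S f)\<^sup>2"
    using norm_slice[OF f] slice_ell2(2)[OF f] by (simp add: infsum_cmult_right' power_mult_distrib)
  finally show "ell2_norm S (amp X f) \<le> op_norm N X * ell2_norm S f"
    by (rule power2_le_imp_le) (simp add: op_norm_nonneg[OF X])
qed

lemma amp_bounded:
  assumes X: "X \<in> bounded_ops N"
  shows "amp X \<in> bounded_ops S"
  unfolding amp_def
proof (rule bounded_ops_restrictI)
  fix f assume f: "f \<in> ell2 S"
  have e: "(\<lambda>g. if g \<in> S then X (slice f (p g)) (q g) else 0) = amp X f"
    using f by (simp add: amp_def)
  show "(\<lambda>g. if g \<in> S then X (slice f (p g)) (q g) else 0) \<in> ell2 S"
    "ell2_norm S (\<lambda>g. if g \<in> S then X (slice f (p g)) (q g) else 0) \<le> op_norm N X * ell2_norm S f"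
    unfolding e by (rule amp_ell2[OF X f])+
qed (auto simp: fun_eq_iff slice_add slice_scale slice_ell2 p_in bounded_opsD[OF X])

lemma amp_hom: "amp \<in> unital_star_hom (B_ell2 N) (B_ell2 S)"
proof (rule unital_star_homI)
  fix X Y :: "'n ell2_op" and a
  assume "X \<in> carrier (B_ell2 N)"
  then have X: "X \<in> bounded_ops N"
    by (simp add: B_ell2_simps)
  show "amp X \<in> carrier (B_ell2 S)"
    by (simp add: B_ell2_simps amp_bounded X)
  show "amp (a \<odot>\<^bsub>B_ell2 N\<^esub> X) = a \<odot>\<^bsub>B_ell2 S\<^esub> amp X"
    by (auto simp: B_ell2_simps amp_def fun_eq_iff slice_ell2 p_in)
  show "amp (star (B_ell2 N) X) = star (B_ell2 S) (amp X)"
    unfolding B_ell2_simps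
  proof (rule adjoint_op_eqI[symmetric])
    fix f g assume f: "f \<in> ell2 S" and g: "g \<in> ell2 S"
    show "ell2_inner S (amp X f) g = ell2_inner S f (amp (adjoint_op N X) g)"
      unfolding inner_slice[OF amp_ell2(1)[OF X f] g] inner_slice[OF f amp_ell2(1)[OF adjoint_op(1)[OF X] g]]
      by (rule infsum_cong)
        (simp add: slice_amp[OF X f] slice_amp[OF adjoint_op(1)[OF X] g] adjoint_op(2)[OF X] slice_ell2 f g)
  qed (simp_all add: amp_bounded adjoint_op X)
  assume "Y \<in> carrier (B_ell2 N)"
  then have Y: "Y \<in> bounded_ops N"
    by (simp add: B_ell2_simps)
  show "amp (X \<oplus>\<^bsub>B_ell2 N\<^esub> Y) = amp X \<oplus>\<^bsub>B_ell2 S\<^esub> amp Y"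
    by (auto simp: B_ell2_simps amp_def fun_eq_iff slice_ell2 p_in)
  show "amp (X \<otimes>\<^bsub>B_ell2 N\<^esub> Y) = amp X \<otimes>\<^bsub>B_ell2 S\<^esub> amp Y"
    unfolding B_ell2_simps
  proof (rule bounded_ops_eqI)
    fix f assume f: "f \<in> ell2 S"
    have "amp X (amp Y f) = (\<lambda>g. if g \<in> S then X (slice (amp Y f) (p g)) (q g) else 0)"
      using amp_ell2(1)[OF Y f] by (simp add: amp_def[of X])
    also have "\<dots> = (\<lambda>g. if g \<in> S then X (Y (slice f (p g))) (q g) else 0)"
      by (auto simp: slice_amp[OF Y f] p_in)
    finally show "amp (compose (ell2 N) X Y) f = compose (ell2 S) (amp X) (amp Y) f"
      using f by (auto simp: compose_def amp_def[of "restrict _ _"] slice_ell2 p_in)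
  qed (simp_all add: amp_bounded bounded_ops_compose X Y)
next
  show "amp \<one>\<^bsub>B_ell2 N\<^esub> = \<one>\<^bsub>B_ell2 S\<^esub>"
    unfolding B_ell2_simps
  proof (rule bounded_ops_eqI)
    fix f assume f: "f \<in> ell2 S"
    show "amp (\<lambda>f\<in>ell2 N. f) f = (\<lambda>f\<in>ell2 S. f) f"
      using f ell2_outside[OF f]
      by (auto simp: amp_def fun_eq_iff slice_ell2 p_in) (auto simp: slice_def q_in c_p_q)
  qed (simp_all add: amp_bounded bounded_ops_id)
qed

end

subsection \<open>Semigroup C*-algebras\<close>

locale rat_semigroup =
  fixes S :: "rat set"
  assumes zero_in: "0 \<in> S" and add_in: "x \<in> S \<Longrightarrow> y \<in> S \<Longrightarrow> x + y \<in> S"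
begin

lemma shift_bounded:
  assumes g: "g \<in> S"
  shows "shift_op S g \<in> bounded_ops S"
  unfolding shift_op_def
proof (rule bounded_ops_restrictI)
  fix f assume f: "f \<in> ell2 S"
  have e: "(\<lambda>h. f (h - g)) = shift_op S g f"
    using f by (simp add: shift_op_def)
  show "(\<lambda>h. f (h - g)) \<in> ell2 S" "ell2_norm S (\<lambda>h. f (h - g)) \<le> 1 * ell2_norm S f"
    unfolding e using shift_op_isometry[OF add_in g f] by simp_all
qed simp_all

lemma shift_0: "shift_op S 0 = (\<lambda>f\<in>ell2 S. f)"
  by (simp add: shift_op_def)

lemma shift_add:
  assumes "g \<in> S" "h \<in> S"
  shows "compose (ell2 S) (shift_op S g) (shift_op S h) = shift_op S (g + h)"
proof (rule bounded_ops_eqI)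
  fix f assume f: "f \<in> ell2 S"
  have "shift_op S h f \<in> ell2 S"
    by (rule bounded_opsD(1)[OF shift_bounded[OF assms(2)] f])
  then show "compose (ell2 S) (shift_op S g) (shift_op S h) f = shift_op S (g + h) f"
    using f by (simp add: compose_def shift_op_def algebra_simps)
qed (intro bounded_ops_compose shift_bounded add_in assms)+

text \<open>The backward shift, read off from its pairing with \<open>e_x\<close>. The formula is
  for points of \<open>S\<close>: at other points the left side is 0, while \<open>g + x\<close> may
  well lie in \<open>S\<close>.\<close>

lemma adjoint_shift:
  assumes g: "g \<in> S" and f: "f \<in> ell2 S" and x: "x \<in> S"
  shows "adjoint_op S (shift_op S g) f x = f (g + x)"
proof -
  have "adjoint_op S (shift_op S g) f x = ell2_inner S (adjoint_op S (shift_op S g) f) (ell2_basis x)"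
    by (simp add: ell2_inner_basis_right x)
  also have "\<dots> = ell2_inner S f (shift_op S g (ell2_basis x))"
    by (rule adjoint_op_left[OF shift_bounded[OF g] f ell2_basis_in_ell2[OF x]])
  also have "\<dots> = f (g + x)"
    by (simp add: shift_op_ell2_basis ell2_inner_basis_right x g add_in)
  finally show ?thesis .
qed

definition C where "C = cstar_generated (B_ell2 S) (shift_op S ` S)"

sublocale B: unital_cstar_algebra "B_ell2 S"
  by (rule unital_cstar_algebra_B_ell2)

lemma gens: "shift_op S ` S \<subseteq> carrier (B_ell2 S)"
  by (auto simp: B_ell2_simps shift_bounded)

lemma C_subalgebra: "cstar_subalgebra (carrier C) (B_ell2 S)"
  unfolding C_def by (rule B.cstar_generated(1)[OF gens])

lemma shift_in_C: "g \<in> S \<Longrightarrow> shift_op S g \<in> carrier C"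
  using B.cstar_generated(2)[OF gens] by (auto simp: C_def)

lemma C_least: "cstar_subalgebra B (B_ell2 S) \<Longrightarrow> (\<And>g. g \<in> S \<Longrightarrow> shift_op S g \<in> B) \<Longrightarrow> carrier C \<subseteq> B"
  unfolding C_def by (rule B.cstar_generated(3)[OF gens]) auto

lemma C_eq: "C = B_ell2 S\<lparr>carrier := carrier C\<rparr>"
  by (simp add: C_def cstar_generated_def)

lemma C_simps:
  "x \<otimes>\<^bsub>C\<^esub> y = compose (ell2 S) x y"
  "\<one>\<^bsub>C\<^esub> = (\<lambda>f\<in>ell2 S. f)"
  "\<zero>\<^bsub>C\<^esub> = (\<lambda>f\<in>ell2 S. (\<lambda>x. 0))"
  "x \<oplus>\<^bsub>C\<^esub> y = (\<lambda>f\<in>ell2 S. (\<lambda>z. x f z + y f z))"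
  "c \<odot>\<^bsub>C\<^esub> x = (\<lambda>f\<in>ell2 S. (\<lambda>z. c * x f z))"
  "star C = adjoint_op S"
  "nrm C = op_norm S"
  unfolding C_def cstar_generated_def by (simp_all add: B_ell2_def)

lemma C_bounded: "x \<in> carrier C \<Longrightarrow> x \<in> bounded_ops S"
  using B.cstar_subalgebraD(1)[OF C_subalgebra] by (auto simp: B_ell2_simps)

text \<open>\<open>cstar_subalgebra\<close> does not ask for the unit; it is present as the
  translation by 0.\<close>

lemma one_in_C: "\<one>\<^bsub>B_ell2 S\<^esub> \<in> carrier C"
  using shift_in_C[OF zero_in] by (simp add: shift_0 B_ell2_simps)

sublocale C: unital_cstar_algebra C
  using B.unital_cstar_algebra_subalgebra[OF C_subalgebra one_in_C] by (simp flip: C_eq)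

lemma C_subalgebra_trans: "cstar_subalgebra B C \<Longrightarrow> cstar_subalgebra B (B_ell2 S)"
  using B.subalgebra_trans[OF C_subalgebra one_in_C] by (simp flip: C_eq)

text \<open>The induction principle for the generated algebra: a closed subalgebra that contains all
  translations is everything.\<close>

lemma C_least': "cstar_subalgebra B C \<Longrightarrow> (\<And>g. g \<in> S \<Longrightarrow> shift_op S g \<in> B) \<Longrightarrow> B = carrier C"
  using C_least[OF C_subalgebra_trans] C.cstar_subalgebraD(1) by blast

end

locale rat_subgroup =
  fixes \<Gamma> :: "rat set"
  assumes zero_in: "0 \<in> \<Gamma>" and add_in: "x \<in> \<Gamma> \<Longrightarrow> y \<in> \<Gamma> \<Longrightarrow> x + y \<in> \<Gamma>"
    and uminus_in: "x \<in> \<Gamma> \<Longrightarrow> - x \<in> \<Gamma>"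
begin

lemma of_nat_mult_in: "x \<in> \<Gamma> \<Longrightarrow> of_nat k * x \<in> \<Gamma>"
  by (induction k) (auto simp: zero_in distrib_right add_in)

lemma of_int_mult_in: "x \<in> \<Gamma> \<Longrightarrow> of_int k * x \<in> \<Gamma>"
  using of_nat_mult_in[of x "nat k"] uminus_in[OF of_nat_mult_in[of x "nat (- k)"]]
  by (cases "0 \<le> k") simp_all

lemma diff_in: "x \<in> \<Gamma> \<Longrightarrow> y \<in> \<Gamma> \<Longrightarrow> x - y \<in> \<Gamma>"
  using add_in[of x "- y"] uminus_in[of y] by simp

sublocale P: rat_semigroup "positive_part \<Gamma>"
  by unfold_locales (auto simp: positive_part_def zero_in add_in)

lemma reduced_cstar_eq: "reduced_cstar \<Gamma> = P.C"
  by (simp add: reduced_cstar_def P.C_def)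

end


subsection \<open>The Toeplitz algebra\<close>

interpretation Z: rat_subgroup "\<int>"
  by unfold_locales auto

abbreviation rat_nats :: "rat set" where
  "rat_nats \<equiv> positive_part \<int>"

lemma rat_nats_eq: "rat_nats = range of_nat"
proof -
  have "x \<in> range of_nat" if "x \<in> \<int>" "0 \<le> x" for x :: rat
    using that by (metis Ints_cases of_int_0_le_iff of_nat_nat rangeI of_int_of_nat_eq)
  then show ?thesis
    by (auto simp: positive_part_def)
qed

lemma toeplitz_eq: "toeplitz = Z.P.C"
  by (simp add: toeplitz_def Z.reduced_cstar_eq)

interpretation T: unital_cstar_algebra toeplitz
  unfolding toeplitz_eq by (rule Z.P.C.unital_cstar_algebra_axioms)

lemma toeplitz_shift_in: "shift_op rat_nats (of_nat k) \<in> carrier toeplitz"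
  unfolding toeplitz_eq by (rule Z.P.shift_in_C) (simp add: rat_nats_eq)

lemma toeplitz_T_in: "toeplitz_T \<in> carrier toeplitz"
  using toeplitz_shift_in[of 1] by (simp add: toeplitz_T_def)

lemma toeplitz_T_pow: "toeplitz_T [^]\<^bsub>toeplitz\<^esub> k = shift_op rat_nats (of_nat k)"
proof (induction k)
  case 0
  then show ?case
    by (simp add: toeplitz_eq Z.P.C_simps Z.P.shift_0)
next
  case (Suc k)
  have "toeplitz_T [^]\<^bsub>toeplitz\<^esub> Suc k = shift_op rat_nats (of_nat k) \<otimes>\<^bsub>toeplitz\<^esub> toeplitz_T"
    by (simp add: Suc)
  also have "\<dots> = shift_op rat_nats (of_nat k + 1)"
    unfolding toeplitz_eq Z.P.C_simps toeplitz_T_def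
    using rangeI[of of_nat k] rangeI[of of_nat 1] by (intro Z.P.shift_add) (auto simp: rat_nats_eq)
  finally show ?case
    by (simp add: add.commute)
qed

lemma unital_star_hom_pow:
  assumes A: "unital_cstar_algebra A" and B: "unital_cstar_algebra B"
    and h: "h \<in> unital_star_hom A B" and x: "x \<in> carrier A"
  shows "h (x [^]\<^bsub>A\<^esub> (k::nat)) = h x [^]\<^bsub>B\<^esub> k"
proof -
  interpret cstar_hom A B h
    by (intro cstar_hom.intro A B cstar_hom_axioms.intro h)
  show ?thesis
    by (induction k) (simp_all add: hom_one hom_mult x)
qed

text \<open>The generating translations are the powers of \<open>T\<close>, so the equalizer of
  \<open>g\<close> and \<open>h\<close> contains every generator.\<close>

lemma toeplitz_hom_unique:
  assumes B: "unital_cstar_algebra B" and g: "g \<in> unital_star_hom toeplitz B"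
    and h: "h \<in> unital_star_hom toeplitz B" and eq: "g toeplitz_T = h toeplitz_T"
    and x: "x \<in> carrier toeplitz"
  shows "g x = h x"
proof -
  interpret cstar_hom toeplitz B g
    by (intro cstar_hom.intro B cstar_hom_axioms.intro g T.unital_cstar_algebra_axioms)
  have "{x \<in> carrier toeplitz. g x = h x} = carrier Z.P.C"
  proof (rule Z.P.C_least')
    show "cstar_subalgebra {x \<in> carrier toeplitz. g x = h x} Z.P.C"
      using equalizer_subalgebra[OF h] by (simp add: toeplitz_eq)
    fix k assume "k \<in> rat_nats"
    then obtain m where k: "k = of_nat m"
      by (auto simp: rat_nats_eq)
    show "shift_op rat_nats k \<in> {x \<in> carrier toeplitz. g x = h x}"
      using unital_star_hom_pow[OF T.unital_cstar_algebra_axioms B g toeplitz_T_in, of m]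
        unital_star_hom_pow[OF T.unital_cstar_algebra_axioms B h toeplitz_T_in, of m]
      by (simp add: k toeplitz_shift_in toeplitz_T_pow eq)
  qed
  then show ?thesis
    using x by (auto simp: toeplitz_eq)
qed

text \<open>For \<open>d > 0\<close> in \<open>\<Gamma>\<close> every \<open>g \<in> \<Gamma>\<^sup>+\<close> is uniquely \<open>r + d z\<close> with \<open>0 \<le> r < d\<close> and a natural
  number \<open>z\<close>, and \<open>V\<^sub>d\<close> is the amplification of \<open>T\<close>.\<close>

context rat_subgroup
begin

context
  fixes d :: rat
  assumes d: "d \<in> \<Gamma>" "0 < d"
begin

interpretation amplification "positive_part \<Gamma>" rat_nats "{r \<in> positive_part \<Gamma>. r < d}"
  "\<lambda>r z. r + d * z" "\<lambda>g. g - d * of_int \<lfloor>g / d\<rfloor>" "\<lambda>g. of_int \<lfloor>g / d\<rfloor>"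
proof
  fix r z assume r: "r \<in> {r \<in> positive_part \<Gamma>. r < d}" and z: "z \<in> rat_nats"
  then obtain k where k: "z = of_nat k"
    by (auto simp: rat_nats_eq)
  have fl: "\<lfloor>(r + d * z) / d\<rfloor> = int k"
    using r d k by (intro floor_unique) (auto simp: positive_part_def field_simps)
  show "r + d * z - d * of_int \<lfloor>(r + d * z) / d\<rfloor> = r" "of_int \<lfloor>(r + d * z) / d\<rfloor> = z"
    unfolding fl by (simp_all add: k)
  show "r + d * z \<in> positive_part \<Gamma>"
    using r d of_nat_mult_in[OF d(1), of k] add_in by (auto simp: k positive_part_def mult.commute)
next
  fix g assume g: "g \<in> positive_part \<Gamma>"
  have "of_int \<lfloor>g / d\<rfloor> * d \<le> g"
    using of_int_floor_le[of "g / d"] by (simp only: pos_le_divide_eq[OF d(2)])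
  moreover have "g < (of_int \<lfloor>g / d\<rfloor> + 1) * d"
    using floor_correct[of "g / d"] d by (simp add: field_simps)
  ultimately show "g - d * of_int \<lfloor>g / d\<rfloor> \<in> {r \<in> positive_part \<Gamma>. r < d}"
    using g diff_in[OF _ of_int_mult_in[OF d(1)]]
    by (auto simp: positive_part_def algebra_simps)
  have "0 \<le> \<lfloor>g / d\<rfloor>"
    using g d by (simp add: positive_part_def)
  then show "of_int \<lfloor>g / d\<rfloor> \<in> rat_nats"
    by (simp add: positive_part_def)
qed simp

text \<open>Translation by \<open>k d\<close> keeps the remainder of \<open>g\<close> modulo
  \<open>d\<close> and raises the quotient by \<open>k\<close>.\<close>

lemma amp_shift: "amp (shift_op rat_nats (of_nat k)) = shift_op (positive_part \<Gamma>) (of_nat k * d)"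
proof (rule bounded_ops_eqI)
  have kd: "of_nat k * d \<in> positive_part \<Gamma>"
    using of_nat_mult_in[OF d(1)] d(2) by (simp add: positive_part_def)
  show "amp (shift_op rat_nats (of_nat k)) \<in> bounded_ops (positive_part \<Gamma>)"
    by (intro amp_bounded Z.P.shift_bounded) (simp add: rat_nats_eq)
  show "shift_op (positive_part \<Gamma>) (of_nat k * d) \<in> bounded_ops (positive_part \<Gamma>)"
    by (rule P.shift_bounded[OF kd])
  fix f assume f: "f \<in> ell2 (positive_part \<Gamma>)"
  show "amp (shift_op rat_nats (of_nat k)) f = shift_op (positive_part \<Gamma>) (of_nat k * d) f"
  proof
    fix g
    show "amp (shift_op rat_nats (of_nat k)) f g = shift_op (positive_part \<Gamma>) (of_nat k * d) f g"
    proof (cases "g \<in> positive_part \<Gamma>")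
      case True
      let ?q = "\<lfloor>g / d\<rfloor>"
      have lhs: "amp (shift_op rat_nats (of_nat k)) f g =
          (if of_int ?q - of_nat k \<in> rat_nats then f (g - d * of_int ?q + d * (of_int ?q - of_nat k)) else 0)"
        using f True slice_ell2(1)[OF f p_in[OF True]]
        by (simp add: amp_def shift_op_def) (simp add: slice_def)
      show ?thesis
      proof (cases "of_int ?q - of_nat k \<in> rat_nats")
        case True
        then show ?thesis
          unfolding lhs using f by (simp add: shift_op_def algebra_simps)
      next
        case False
        \<comment> \<open>The quotient is too small for \<open>T^k\<close> to give a nonzero value;
          this means \<open>g < k d\<close>, so the right-hand side evaluates \<open>f\<close> at a
          negative point and vanishes as well.\<close>
        have "?q < int k"
        proof (rule ccontr)
          assume "\<not> ?q < int k"
          then have "of_int ?q - of_nat k = (of_nat (nat (?q - int k)) :: rat)"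
            by simp
          then show False
            using False by (metis rangeI rat_nats_eq)
        qed
        then have "g < of_nat k * d"
          using d(2) by (simp add: floor_less_iff field_simps)
        then have "g - of_nat k * d \<notin> positive_part \<Gamma>"
          by (simp add: positive_part_def)
        then show ?thesis
          unfolding lhs using False f ell2_outside[OF f] by (simp add: shift_op_def)
      qed
    next
      case False
      then show ?thesis
        using f ell2_outside[OF bounded_opsD(1)[OF P.shift_bounded[OF kd] f] False] by (simp add: amp_def)
    qed
  qed
qed

text \<open>The amplification is defined on all bounded operators. Restricted to the Toeplitz
  algebra it lands in the semigroup algebra, because the preimage of the latter is a closed
  subalgebra containing the translations.\<close>

lemma ex_toeplitz_hom:
  "\<exists>h\<in>unital_star_hom toeplitz (reduced_cstar \<Gamma>).
    \<forall>k. h (shift_op rat_nats (of_nat k)) = shift_op (positive_part \<Gamma>) (of_nat k * d)"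
proof
  interpret amp: cstar_hom "B_ell2 rat_nats" "B_ell2 (positive_part \<Gamma>)" amp
    by (intro cstar_hom.intro unital_cstar_algebra_B_ell2 cstar_hom_axioms.intro amp_hom)
  have "carrier Z.P.C \<subseteq> {x \<in> carrier (B_ell2 rat_nats). amp x \<in> carrier P.C}"
  proof (rule Z.P.C_least[OF amp.vimage_subalgebra[OF P.C_subalgebra]])
    fix z assume z: "z \<in> rat_nats"
    then obtain k where k: "z = of_nat k"
      by (auto simp: rat_nats_eq)
    have "of_nat k * d \<in> positive_part \<Gamma>"
      using of_nat_mult_in[OF d(1)] d(2) by (simp add: positive_part_def)
    then show "shift_op rat_nats z \<in> {x \<in> carrier (B_ell2 rat_nats). amp x \<in> carrier P.C}"
      using Z.P.shift_bounded[OF z] P.shift_in_C by (simp add: B_ell2_simps k amp_shift)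
  qed
  then have in_C: "amp x \<in> carrier P.C" "x \<in> carrier (B_ell2 rat_nats)" if "x \<in> carrier Z.P.C" for x
    using that by auto
  show "amp \<in> unital_star_hom toeplitz (reduced_cstar \<Gamma>)"
    unfolding toeplitz_eq reduced_cstar_eq
    by (rule unital_star_homI)
      (use amp.hom_add amp.hom_mult amp.hom_one amp.hom_smult amp.hom_star in_C in
        \<open>simp_all add: Z.P.C_simps P.C_simps B_ell2_simps\<close>)
  show "\<forall>k. amp (shift_op rat_nats (of_nat k)) = shift_op (positive_part \<Gamma>) (of_nat k * d)"
    by (simp add: amp_shift)
qed

end

end

text \<open>Existence is the amplification over the group of integers with step
  \<open>d = m\<close>. The homomorphism is restricted to the carrier to meet the extensionality
  condition in the definite description.\<close>

lemma toeplitz_hom: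
  assumes "0 < m"
  shows "toeplitz_hom m \<in> unital_star_hom toeplitz toeplitz"
    and "toeplitz_hom m toeplitz_T = shift_op rat_nats (of_nat m)"
proof -
  obtain h where h: "h \<in> unital_star_hom toeplitz toeplitz"
    "\<And>k. h (shift_op rat_nats (of_nat k)) = shift_op rat_nats (of_nat k * of_nat m)"
    using Z.ex_toeplitz_hom[of "of_nat m"] assms by (auto simp: toeplitz_def)
  have h1: "h toeplitz_T = shift_op rat_nats (of_nat m)"
    using h(2)[of 1] by (simp add: toeplitz_T_def)
  let ?h = "restrict h (carrier toeplitz)"
  have h': "?h \<in> unital_star_hom toeplitz toeplitz"
    by (rule unital_star_hom_cong[OF h(1) T.unital_cstar_algebra_axioms]) simp
  have "toeplitz_hom m = ?h"
    unfolding toeplitz_hom_def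
  proof (rule the_equality)
    show "?h \<in> unital_star_hom toeplitz toeplitz \<and> ?h \<in> extensional (carrier toeplitz) \<and>
        ?h toeplitz_T = toeplitz_T [^]\<^bsub>toeplitz\<^esub> m"
      using h' h1 toeplitz_T_in by (simp add: toeplitz_T_pow)
    fix g assume g: "g \<in> unital_star_hom toeplitz toeplitz \<and> g \<in> extensional (carrier toeplitz) \<and>
        g toeplitz_T = toeplitz_T [^]\<^bsub>toeplitz\<^esub> m"
    show "g = ?h"
    proof (rule extensionalityI[of _ "carrier toeplitz"])
      fix x assume x: "x \<in> carrier toeplitz"
      show "g x = ?h x"
        by (rule toeplitz_hom_unique[OF T.unital_cstar_algebra_axioms _ h' _ x])
          (use g h1 toeplitz_T_in in \<open>simp_all add: toeplitz_T_pow\<close>)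
    qed (use g in auto)
  qed
  then show "toeplitz_hom m \<in> unital_star_hom toeplitz toeplitz"
    "toeplitz_hom m toeplitz_T = shift_op rat_nats (of_nat m)"
    using h' h1 toeplitz_T_in by simp_all
qed

text \<open>The rank one projection \<open>1 - T T*\<close> onto the line of \<open>e_0\<close>,
  written in terms of \<open>T\<close> so that its image under a homomorphism is determined by the
  image of \<open>T\<close>.\<close>

definition toeplitz_P :: "rat ell2_op" where
  "toeplitz_P = \<one>\<^bsub>toeplitz\<^esub> \<oplus>\<^bsub>toeplitz\<^esub> (-1) \<odot>\<^bsub>toeplitz\<^esub> (toeplitz_T \<otimes>\<^bsub>toeplitz\<^esub> star toeplitz toeplitz_T)"

lemmas toeplitz_simps = Z.P.C_simps[folded toeplitz_eq]

lemma toeplitz_bounded: "x \<in> carrier toeplitz \<Longrightarrow> x \<in> bounded_ops rat_nats"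
  by (rule Z.P.C_bounded) (simp add: toeplitz_eq)

lemma zero_in_rat_nats: "0 \<in> rat_nats" and one_in_rat_nats: "1 \<in> rat_nats"
  by (simp_all add: positive_part_def)

lemma toeplitz_P_in: "toeplitz_P \<in> carrier toeplitz"
  unfolding toeplitz_P_def
  by (intro T.add.m_closed T.one_closed T.smult_closed T.m_closed T.star_closed toeplitz_T_in)

lemma toeplitz_P_apply:
  assumes f: "f \<in> ell2 rat_nats"
  shows "toeplitz_P f = (\<lambda>x. f 0 * ell2_basis 0 x)"
proof
  fix x
  have T: "toeplitz_T \<in> bounded_ops rat_nats"
    by (rule toeplitz_bounded[OF toeplitz_T_in])
  let ?g = "adjoint_op rat_nats toeplitz_T f"
  have g: "?g \<in> ell2 rat_nats"
    by (rule bounded_opsD(1)[OF adjoint_op(1)[OF T] f])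
  \<comment> \<open>At \<open>x = 0\<close> the argument -1 lies outside the natural numbers, so
    \<open>T T*\<close> erases exactly the value of \<open>f\<close> at 0.\<close>
  have g_eq: "?g (x - 1) = (if x - 1 \<in> rat_nats then f x else 0)"
    using Z.P.adjoint_shift[OF one_in_rat_nats f, of "x - 1"] ell2_outside[OF g, of "x - 1"]
    by (simp add: toeplitz_T_def)
  have P: "toeplitz_P f x = f x - ?g (x - 1)"
    using f g unfolding toeplitz_P_def toeplitz_simps
    by (simp add: compose_def toeplitz_T_def shift_op_def)
  show "toeplitz_P f x = f 0 * ell2_basis 0 x"
  proof (cases "x \<in> rat_nats")
    case True
    then obtain k where "x = of_nat k"
      by (auto simp: rat_nats_eq)
    then show ?thesis
      unfolding P g_eq by (cases k) (auto simp: rat_nats_eq ell2_basis_def positive_part_def)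
  next
    case False
    then have "x \<noteq> 0"
      using zero_in_rat_nats by blast
    then show ?thesis
      unfolding P g_eq using ell2_outside[OF f False] by (simp add: ell2_basis_def)
  qed
qed

lemma ell2_basis_0: "ell2_basis 0 \<in> ell2 rat_nats"
  by (rule ell2_basis_in_ell2[OF zero_in_rat_nats])

lemma toeplitz_P_basis: "toeplitz_P (ell2_basis 0) = ell2_basis 0"
  unfolding toeplitz_P_apply[OF ell2_basis_0] by (simp add: ell2_basis_def)

lemma toeplitz_P_nonzero: "toeplitz_P \<noteq> \<zero>\<^bsub>toeplitz\<^esub>"
proof
  assume "toeplitz_P = \<zero>\<^bsub>toeplitz\<^esub>"
  then have "toeplitz_P (ell2_basis 0) 0 = \<zero>\<^bsub>toeplitz\<^esub> (ell2_basis 0) 0"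
    by (simp only:)
  also have "\<dots> = 0"
    by (simp add: toeplitz_simps ell2_basis_0)
  finally have "toeplitz_P (ell2_basis 0) 0 = 0" .
  then show False
    unfolding toeplitz_P_basis by (simp add: ell2_basis_def)
qed

text \<open>Both sides map \<open>f\<close> to \<open>f(0)\<langle>x V e\<^sub>0, W e\<^sub>0\<rangle> e\<^sub>0\<close>; so the matrix coefficients of \<open>x\<close> can be
  recovered algebraically.\<close>

lemma toeplitz_P_compress:
  assumes V: "V \<in> carrier toeplitz" and W: "W \<in> carrier toeplitz" and x: "x \<in> carrier toeplitz"
  shows "star toeplitz (W \<otimes>\<^bsub>toeplitz\<^esub> toeplitz_P) \<otimes>\<^bsub>toeplitz\<^esub> (x \<otimes>\<^bsub>toeplitz\<^esub> (V \<otimes>\<^bsub>toeplitz\<^esub> toeplitz_P)) =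
    ell2_inner rat_nats (x (V (ell2_basis 0))) (W (ell2_basis 0)) \<odot>\<^bsub>toeplitz\<^esub> toeplitz_P"
proof (rule bounded_ops_eqI)
  let ?c = "ell2_inner rat_nats (x (V (ell2_basis 0))) (W (ell2_basis 0))"
  let ?WP = "W \<otimes>\<^bsub>toeplitz\<^esub> toeplitz_P"
  have WP: "?WP \<in> carrier toeplitz"
    using W toeplitz_P_in by simp
  note b = toeplitz_bounded[OF V] toeplitz_bounded[OF x] toeplitz_bounded[OF WP]
  fix f assume f: "f \<in> ell2 rat_nats"
  have y: "x (V (ell2_basis 0)) \<in> ell2 rat_nats"
    by (intro bounded_opsD(1)[OF b(2)] bounded_opsD(1)[OF b(1)] ell2_basis_0)
  have adj: "adjoint_op rat_nats ?WP (x (V (ell2_basis 0))) = (\<lambda>z. ?c * ell2_basis 0 z)"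
  proof
    fix z
    let ?A = "adjoint_op rat_nats ?WP"
    have A: "?A (x (V (ell2_basis 0))) \<in> ell2 rat_nats"
      by (rule bounded_opsD(1)[OF adjoint_op(1)[OF b(3)] y])
    show "?A (x (V (ell2_basis 0))) z = ?c * ell2_basis 0 z"
    proof (cases "z \<in> rat_nats")
      case True
      have "?A (x (V (ell2_basis 0))) z = ell2_inner rat_nats (x (V (ell2_basis 0))) (?WP (ell2_basis z))"
        unfolding adjoint_op_left[OF b(3) y ell2_basis_in_ell2[OF True], symmetric]
        by (rule ell2_inner_basis_right[OF True, symmetric])
      \<comment> \<open>The factor \<open>ell2_basis z 0\<close> is a Kronecker delta: the
        projection kills every basis vector other than \<open>e_0\<close>.\<close>
      also have "?WP (ell2_basis z) = W (\<lambda>y. ell2_basis z 0 * ell2_basis 0 y)"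
        using ell2_basis_in_ell2[OF True] by (simp add: toeplitz_simps compose_def toeplitz_P_apply)
      also have "\<dots> = (\<lambda>y. ell2_basis z 0 * W (ell2_basis 0) y)"
        by (rule bounded_opsD(3)[OF toeplitz_bounded[OF W] ell2_basis_0])
      finally show ?thesis
        by (simp add: ell2_inner_scale_right) (simp add: ell2_basis_def)
    next
      case False
      then have "z \<noteq> 0"
        using zero_in_rat_nats by blast
      then show ?thesis
        using ell2_outside[OF A False] by (simp add: ell2_basis_def)
    qed
  qed
  have e0: "(\<lambda>x. a * ell2_basis 0 x) \<in> ell2 rat_nats" for a
    by (rule ell2_scale(1)[OF ell2_basis_0])
  have "(star toeplitz ?WP \<otimes>\<^bsub>toeplitz\<^esub> (x \<otimes>\<^bsub>toeplitz\<^esub> (V \<otimes>\<^bsub>toeplitz\<^esub> toeplitz_P))) f =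
      adjoint_op rat_nats ?WP (x (V (\<lambda>x. f 0 * ell2_basis 0 x)))"
    using f unfolding toeplitz_simps(1)[of "adjoint_op rat_nats _"] toeplitz_simps(1)[of x] toeplitz_simps(1)[of V] toeplitz_simps(6)
    by (simp add: compose_def toeplitz_P_apply e0 bounded_opsD(1)[OF b(1)])
  also have "\<dots> = (\<lambda>z. f 0 * (?c * ell2_basis 0 z))"
    using bounded_opsD(1)[OF b(1) ell2_basis_0] y
    by (simp add: bounded_opsD(3)[OF b(1) ell2_basis_0] bounded_opsD(3)[OF b(2)]
        bounded_opsD(3)[OF adjoint_op(1)[OF b(3)]] adj)
  also have "\<dots> = (?c \<odot>\<^bsub>toeplitz\<^esub> toeplitz_P) f"
    using f by (simp add: toeplitz_simps toeplitz_P_apply mult.left_commute)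
  finally show "(star toeplitz ?WP \<otimes>\<^bsub>toeplitz\<^esub> (x \<otimes>\<^bsub>toeplitz\<^esub> (V \<otimes>\<^bsub>toeplitz\<^esub> toeplitz_P))) f =
      (?c \<odot>\<^bsub>toeplitz\<^esub> toeplitz_P) f" .
qed (intro toeplitz_bounded T.m_closed T.star_closed T.smult_closed toeplitz_P_in assms)+

text \<open>Since \<open>T^k e_0 = e_k\<close>, a linear combination of powers of \<open>T\<close>
  sends \<open>e_0\<close> to any prescribed finitely supported vector.\<close>

lemma toeplitz_cyclic:
  assumes "finite F" "F \<subseteq> rat_nats"
  shows "\<exists>V\<in>carrier toeplitz. V (ell2_basis 0) = ell2_cut F f"
  using assms
proof (induction F)
  case empty
  show ?case
    by (rule bexI[OF _ T.zero_closed]) (simp add: toeplitz_simps ell2_basis_0 ell2_cut_def)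
next
  case (insert i F)
  then obtain V where V: "V \<in> carrier toeplitz" "V (ell2_basis 0) = ell2_cut F f"
    by auto
  obtain k where k: "i = of_nat k"
    using insert.prems by (auto simp: rat_nats_eq)
  let ?U = "f i \<odot>\<^bsub>toeplitz\<^esub> shift_op rat_nats (of_nat k) \<oplus>\<^bsub>toeplitz\<^esub> V"
  have "?U (ell2_basis 0) = ell2_cut (insert i F) f"
    using insert.hyps V(2) shift_op_ell2_basis[OF zero_in_rat_nats, of "of_nat k"]
    by (simp add: toeplitz_simps ell2_basis_0 ell2_cut_def k)
  moreover have "?U \<in> carrier toeplitz"
    by (intro T.add.m_closed T.smult_closed toeplitz_shift_in V(1))
  ultimately show ?case
    by blast
qed

lemma ell2_norm_cut_le:
  assumes "f \<in> ell2 S" "finite F" "F \<subseteq> S"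
  shows "ell2_norm S (ell2_cut F f) \<le> ell2_norm S f"
  using L2_set_le_ell2_norm[OF assms] ell2_cut(2)[OF assms(2,3), of f] by simp

text \<open>Contractivity is one half. For the other, \<open>h\<close> turns the compression
  identity into one in \<open>B\<close>, which bounds each coefficient \<open><x v, w>\<close> by
  \<open>nrm B (h x)\<close> times the norms of \<open>v\<close> and \<open>w\<close>, for finitely
  supported \<open>v\<close> and \<open>w\<close>. Density then bounds the operator norm of
  \<open>x\<close>.\<close>

lemma toeplitz_isometric:
  assumes B: "unital_cstar_algebra B" and h: "h \<in> unital_star_hom toeplitz B"
    and nz: "h toeplitz_P \<noteq> \<zero>\<^bsub>B\<^esub>" and x: "x \<in> carrier toeplitz"
  shows "nrm B (h x) = nrm toeplitz x"
proof (rule antisym)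
  interpret cstar_hom toeplitz B h
    by (intro cstar_hom.intro B cstar_hom_axioms.intro h T.unital_cstar_algebra_axioms)
  show "nrm B (h x) \<le> nrm toeplitz x"
    by (rule nrm_hom_le[OF x])
  let ?P = toeplitz_P and ?e = "ell2_basis (0::rat)" and ?C = "nrm B (h x)"
  note bx = toeplitz_bounded[OF x]
  have C0: "0 \<le> ?C"
    by (rule B.nrm_nonneg[OF hom_closed[OF x]])
  have P_nrm: "0 < nrm B (h ?P)"
    using B.nrm_nonneg[OF hom_closed[OF toeplitz_P_in]] nz B.nrm_eq_0_iff[OF hom_closed[OF toeplitz_P_in]]
    by simp
  have comp: "star B (h (W \<otimes>\<^bsub>toeplitz\<^esub> ?P)) \<otimes>\<^bsub>B\<^esub> (h y \<otimes>\<^bsub>B\<^esub> h (V \<otimes>\<^bsub>toeplitz\<^esub> ?P)) =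
      ell2_inner rat_nats (y (V ?e)) (W ?e) \<odot>\<^bsub>B\<^esub> h ?P"
    if "V \<in> carrier toeplitz" "W \<in> carrier toeplitz" "y \<in> carrier toeplitz" for V W y
    using arg_cong[OF toeplitz_P_compress[OF that], of h] that toeplitz_P_in
    by (simp add: hom_mult hom_star hom_smult T.star_closed)
  \<comment> \<open>The case \<open>W = V\<close>, \<open>y = \<one>\<close> of \<open>comp\<close>,
    combined with the C*-identity. The factor \<open>sqrt (nrm B (h ?P))\<close> later occurs twice
    and cancels against the norm of \<open>h ?P\<close>, which only has to be positive.\<close>
  have nrm_VP: "nrm B (h (V \<otimes>\<^bsub>toeplitz\<^esub> ?P)) = ell2_norm rat_nats (V ?e) * sqrt (nrm B (h ?P))"
    if V: "V \<in> carrier toeplitz" for V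
  proof -
    have VP: "h (V \<otimes>\<^bsub>toeplitz\<^esub> ?P) \<in> carrier B"
      by (intro hom_closed T.m_closed V toeplitz_P_in)
    have Ve: "V ?e \<in> ell2 rat_nats"
      by (rule bounded_opsD(1)[OF toeplitz_bounded[OF V] ell2_basis_0])
    have "(nrm B (h (V \<otimes>\<^bsub>toeplitz\<^esub> ?P)))\<^sup>2 = nrm B (star B (h (V \<otimes>\<^bsub>toeplitz\<^esub> ?P)) \<otimes>\<^bsub>B\<^esub> (h \<one>\<^bsub>toeplitz\<^esub> \<otimes>\<^bsub>B\<^esub> h (V \<otimes>\<^bsub>toeplitz\<^esub> ?P)))"
      using B.cstar_identity[OF VP] VP by (simp add: hom_one)
    also have "\<dots> = cmod (ell2_inner rat_nats (V ?e) (V ?e)) * nrm B (h ?P)"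
      unfolding comp[OF V V T.one_closed] using B.nrm_smult[OF hom_closed[OF toeplitz_P_in]] Ve
      by (simp add: toeplitz_simps)
    also have "\<dots> = (ell2_norm rat_nats (V ?e) * sqrt (nrm B (h ?P)))\<^sup>2"
      using P_nrm by (simp add: ell2_inner_self[OF Ve] power_mult_distrib norm_power)
    finally show ?thesis
      using P_nrm B.nrm_nonneg[OF VP] by (simp add: power2_eq_iff_nonneg)
  qed
  have coeff: "cmod (ell2_inner rat_nats (x (V ?e)) (W ?e)) \<le> ?C * ell2_norm rat_nats (V ?e) * ell2_norm rat_nats (W ?e)"
    if V: "V \<in> carrier toeplitz" and W: "W \<in> carrier toeplitz" for V W
  proof -
    let ?p = "nrm B (h ?P)"
    have VP: "h (V \<otimes>\<^bsub>toeplitz\<^esub> ?P) \<in> carrier B" and WP: "h (W \<otimes>\<^bsub>toeplitz\<^esub> ?P) \<in> carrier B"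
      by (intro hom_closed T.m_closed V W toeplitz_P_in)+
    have "cmod (ell2_inner rat_nats (x (V ?e)) (W ?e)) * ?p =
        nrm B (star B (h (W \<otimes>\<^bsub>toeplitz\<^esub> ?P)) \<otimes>\<^bsub>B\<^esub> (h x \<otimes>\<^bsub>B\<^esub> h (V \<otimes>\<^bsub>toeplitz\<^esub> ?P)))"
      unfolding comp[OF V W x] by (simp add: B.nrm_smult[OF hom_closed[OF toeplitz_P_in]])
    also have "\<dots> \<le> nrm B (star B (h (W \<otimes>\<^bsub>toeplitz\<^esub> ?P))) * nrm B (h x \<otimes>\<^bsub>B\<^esub> h (V \<otimes>\<^bsub>toeplitz\<^esub> ?P))"
      by (intro B.nrm_mult B.star_closed B.m_closed VP WP hom_closed[OF x])
    also have "\<dots> \<le> nrm B (star B (h (W \<otimes>\<^bsub>toeplitz\<^esub> ?P))) * (?C * nrm B (h (V \<otimes>\<^bsub>toeplitz\<^esub> ?P)))"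
      by (intro mult_left_mono B.nrm_mult VP hom_closed[OF x] B.nrm_nonneg B.star_closed WP)
    also have "\<dots> = (?C * ell2_norm rat_nats (V ?e) * ell2_norm rat_nats (W ?e)) * (sqrt ?p * sqrt ?p)"
      unfolding B.nrm_star[OF WP] nrm_VP[OF V] nrm_VP[OF W] by (simp only: mult_ac)
    also have "sqrt ?p * sqrt ?p = ?p"
      using P_nrm by simp
    finally show ?thesis
      using P_nrm by simp
  qed
  have cut: "ell2_norm rat_nats (x (ell2_cut F f)) \<le> ?C * ell2_norm rat_nats (ell2_cut F f)"
    if F: "finite F" "F \<subseteq> rat_nats" for F f
  proof (rule ell2I(2))
    let ?y = "x (ell2_cut F f)"
    have y: "?y \<in> ell2 rat_nats"
      by (rule bounded_opsD(1)[OF bx ell2_cut(1)[OF F]])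
    show "?y z = 0" if "z \<notin> rat_nats" for z
      by (rule ell2_outside[OF y that])
    fix G assume G: "finite G" "G \<subseteq> rat_nats"
    let ?l = "L2_set (\<lambda>z. cmod (?y z)) G"
    \<comment> \<open>Duality: \<open>W e_0\<close> is chosen as the section of \<open>?y\<close>
      over \<open>G\<close>, so the coefficient is \<open>?l\<^sup>2\<close> and one factor
      \<open>?l\<close> can be cancelled.\<close>
    obtain V W where V: "V \<in> carrier toeplitz" "V ?e = ell2_cut F f"
      and W: "W \<in> carrier toeplitz" "W ?e = ell2_cut G ?y"
      using toeplitz_cyclic[OF F, of f] toeplitz_cyclic[OF G, of ?y] by blast
    have "ell2_inner rat_nats ?y (ell2_cut G ?y) = cnj (ell2_inner rat_nats (ell2_cut G ?y) ?y)"
      by (simp add: ell2_inner_cnj)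
    also have "ell2_inner rat_nats (ell2_cut G ?y) ?y = (\<Sum>i\<in>G. ell2_inner rat_nats (\<lambda>z. ?y i * ell2_basis i z) ?y)"
      unfolding ell2_cut_def[of G] using G y
      by (intro ell2_inner_sum_left ell2_scale ell2_basis_in_ell2) auto
    also have "\<dots> = (\<Sum>i\<in>G. ?y i * cnj (?y i))"
      using G by (intro sum.cong) (auto simp: ell2_inner_scale_left ell2_inner_basis_left)
    also have "\<dots> = complex_of_real (?l\<^sup>2)"
      by (simp add: L2_set_def sum_nonneg flip: complex_norm_square)
    finally have "cmod (ell2_inner rat_nats ?y (ell2_cut G ?y)) = ?l\<^sup>2"
      by (simp add: norm_power del: of_real_power)
    then have "?l * ?l \<le> (?C * ell2_norm rat_nats (ell2_cut F f)) * ?l"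
      using coeff[OF V(1) W(1)] ell2_cut(2)[OF G, of ?y] by (simp add: V(2) W(2) power2_eq_square)
    then show "?l \<le> ?C * ell2_norm rat_nats (ell2_cut F f)"
      using C0 by (cases "?l = 0") (simp_all add: mult_le_cancel_right less_le)
  qed
  show "nrm toeplitz x \<le> ?C"
    unfolding toeplitz_simps
  proof (rule op_norm_le[OF C0])
    fix f assume f: "f \<in> ell2 rat_nats"
    let ?D = "op_norm rat_nats x"
    show "ell2_norm rat_nats (x f) \<le> ?C * ell2_norm rat_nats f"
    proof (rule field_le_epsilon)
      fix e :: real assume e: "0 < e"
      have D0: "0 \<le> ?D"
        by (rule op_norm_nonneg[OF bx])
      have e': "0 < e / (?D + 1)"
        using e D0 by simp
      obtain F where F: "finite F" "F \<subseteq> rat_nats" "ell2_norm rat_nats (\<lambda>z. f z - ell2_cut F f z) < e / (?D + 1)"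
        by (rule ell2_cut_approx[OF f e'])
      let ?v = "ell2_cut F f" and ?d = "\<lambda>z. f z - ell2_cut F f z"
      have v: "?v \<in> ell2 rat_nats"
        by (rule ell2_cut(1)[OF F(1,2)])
      have d: "?d \<in> ell2 rat_nats"
        by (rule ell2_diff(1)[OF f v])
      have "x f = x (\<lambda>z. ?v z + ?d z)"
        by simp
      also have "\<dots> = (\<lambda>z. x ?v z + x ?d z)"
        by (rule bounded_opsD(2)[OF bx v d])
      finally have "ell2_norm rat_nats (x f) \<le> ell2_norm rat_nats (x ?v) + ell2_norm rat_nats (x ?d)"
        using ell2_add(2)[OF bounded_opsD(1)[OF bx v] bounded_opsD(1)[OF bx d]] by simp
      moreover have "ell2_norm rat_nats (x ?v) \<le> ?C * ell2_norm rat_nats f"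
        using cut[OF F(1,2), of f] mult_left_mono[OF ell2_norm_cut_le[OF f F(1,2)] C0] by linarith
      moreover have "ell2_norm rat_nats (x ?d) \<le> e"
      proof -
        have "ell2_norm rat_nats (x ?d) \<le> ?D * ell2_norm rat_nats ?d"
          by (rule op_norm_bound[OF bx d])
        also have "\<dots> \<le> ?D * (e / (?D + 1))"
          using F(3) by (intro mult_left_mono D0) simp
        also have "\<dots> \<le> e"
          using D0 e by (simp add: field_simps)
        finally show ?thesis .
      qed
      ultimately show "ell2_norm rat_nats (x f) \<le> ?C * ell2_norm rat_nats f + e"
        by linarith
    qed
  qed
qed

context rat_subgroup
begin

text \<open>The image is \<open>1 - V V*\<close> for the translation \<open>V\<close> by
  \<open>d\<close>. As \<open>0 - d\<close> is negative, \<open>V V* e_0\<close> vanishes at 0, and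
  \<open>e_0\<close> keeps its value 1 there.\<close>

lemma toeplitz_P_image_nonzero:
  assumes h: "h \<in> unital_star_hom toeplitz (reduced_cstar \<Gamma>)" and d: "d \<in> \<Gamma>" "0 < d"
    and hT: "h toeplitz_T = shift_op (positive_part \<Gamma>) d"
  shows "h toeplitz_P \<noteq> \<zero>\<^bsub>reduced_cstar \<Gamma>\<^esub>"
proof
  interpret cstar_hom toeplitz P.C h
    by (intro cstar_hom.intro P.C.unital_cstar_algebra_axioms cstar_hom_axioms.intro
        T.unital_cstar_algebra_axioms h[unfolded reduced_cstar_eq])
  let ?S = "positive_part \<Gamma>" and ?e = "ell2_basis (0::rat)"
  have dS: "d \<in> ?S"
    using d by (simp add: positive_part_def)
  have V: "shift_op ?S d \<in> bounded_ops ?S"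
    by (rule P.shift_bounded[OF dS])
  have e: "?e \<in> ell2 ?S"
    by (rule ell2_basis_in_ell2[OF P.zero_in])
  let ?y = "adjoint_op ?S (shift_op ?S d) ?e"
  have y: "?y \<in> ell2 ?S"
    by (rule bounded_opsD(1)[OF adjoint_op(1)[OF V] e])
  have y0: "?y (- d) = 0"
    by (rule ell2_outside[OF y]) (use d in \<open>simp add: positive_part_def\<close>)
  have "h toeplitz_P = \<one>\<^bsub>P.C\<^esub> \<oplus>\<^bsub>P.C\<^esub> (-1) \<odot>\<^bsub>P.C\<^esub> (shift_op ?S d \<otimes>\<^bsub>P.C\<^esub> star P.C (shift_op ?S d))"
    unfolding toeplitz_P_def
    by (simp add: hom_add hom_one hom_smult hom_mult hom_star toeplitz_T_in T.smult_closed T.star_closed hT)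
  then have "h toeplitz_P ?e 0 = 1"
    using e y y0 by (simp add: P.C_simps compose_def shift_op_def) (simp add: ell2_basis_def)
  moreover assume "h toeplitz_P = \<zero>\<^bsub>reduced_cstar \<Gamma>\<^esub>"
  then have "h toeplitz_P ?e 0 = \<zero>\<^bsub>P.C\<^esub> ?e 0"
    by (simp only: reduced_cstar_eq)
  then have "h toeplitz_P ?e 0 = 0"
    using e by (simp add: P.C_simps)
  ultimately show False
    by simp
qed

end

subsection \<open>Rational groups with directed denominators\<close>

definition frac_group :: "nat set \<Rightarrow> rat set" where
  "frac_group P = {of_int m / of_nat p | m p. p \<in> P}"

text \<open>Directedness under divisibility provides common denominators, which make the union of
  the groups \<open>(1/p) \<int>\<close> closed under addition.\<close>

locale directed_denominators =
  fixes P :: "nat set"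
  assumes one: "1 \<in> P" and pos: "p \<in> P \<Longrightarrow> 0 < p"
    and dir: "p \<in> P \<Longrightarrow> q \<in> P \<Longrightarrow> \<exists>r\<in>P. p dvd r \<and> q dvd r"
begin

lemma frac_groupI: "p \<in> P \<Longrightarrow> of_int m / of_nat p \<in> frac_group P"
  by (auto simp: frac_group_def)

lemma frac_groupE:
  assumes "x \<in> frac_group P"
  obtains m p where "p \<in> P" "x = of_int m / of_nat p"
  using assms by (auto simp: frac_group_def)

lemma frac_dvd:
  assumes "p \<in> P" "r \<in> P" "p dvd r"
  shows "\<exists>m'. (of_int m / of_nat p :: rat) = of_int m' / of_nat r"
proof -
  obtain t where t: "r = p * t"
    using assms(3) by blast
  have "(of_int m / of_nat p :: rat) = of_int (m * int t) / of_nat r"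
    using pos[OF assms(1)] pos[OF assms(2)] by (simp add: t)
  then show ?thesis
    by blast
qed

sublocale rat_subgroup "frac_group P"
proof
  show "0 \<in> frac_group P"
    using frac_groupI[OF one, of 0] by simp
  show "- x \<in> frac_group P" if "x \<in> frac_group P" for x
    using that by (elim frac_groupE) (metis frac_groupI minus_divide_left of_int_minus)
  fix x y assume "x \<in> frac_group P" "y \<in> frac_group P"
  then obtain m p m' p' where xy: "p \<in> P" "x = of_int m / of_nat p" "p' \<in> P" "y = of_int m' / of_nat p'"
    by (metis frac_groupE)
  obtain r where r: "r \<in> P" "p dvd r" "p' dvd r"
    using dir[OF xy(1,3)] by blast
  obtain k k' where "x = of_int k / of_nat r" "y = of_int k' / of_nat r"
    using frac_dvd[OF xy(1) r(1,2), of m] frac_dvd[OF xy(3) r(1,3), of m'] xy by auto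
  then have "x + y = of_int (k + k') / of_nat r"
    by (simp add: add_divide_distrib)
  then show "x + y \<in> frac_group P"
    using frac_groupI[OF r(1), of "k + k'"] by simp
qed

text \<open>\<open>P\<close> is countable as a set of natural numbers. Along an enumeration, common
  multiples taken inside \<open>P\<close> form a divisibility chain that every element of
  \<open>P\<close> eventually divides; the successive quotients are the sequence.\<close>

lemma ex_Q_seq: "\<exists>M. (\<forall>s\<ge>1. 0 < M s) \<and> Q_seq M = frac_group P"
proof -
  define q where "q = from_nat_into P"
  have q: "range q = P"
    unfolding q_def using one by (intro range_from_nat_into) auto
  obtain r where r: "r a b \<in> P" "a dvd r a b" "b dvd r a b" if "a \<in> P" "b \<in> P" for a b
    using dir by metis
  \<comment> \<open>Each step passes to a common multiple in \<open>P\<close> of the current term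
    and the next enumerated denominator \<open>q k\<close>.\<close>
  define u where "u = rec_nat 1 (\<lambda>k a. r a (q k))"
  have u0: "u 0 = 1" and uS: "u (Suc k) = r (u k) (q k)" for k
    by (simp_all add: u_def)
  have qP: "q k \<in> P" for k
    using q by blast
  have uP: "u k \<in> P" for k
    by (induction k) (use one in \<open>simp_all add: u0 uS r qP\<close>)
  have dvd: "u k dvd u (Suc k)" "q k dvd u (Suc k)" for k
    by (simp_all add: uS r uP qP)
  \<comment> \<open>The product of the quotients telescopes to \<open>u s\<close>, because
    \<open>u 0 = 1\<close>.\<close>
  define M where "M = (\<lambda>j. u j div u (j - 1))"
  have M: "(\<Prod>j=1..s. M j) = u s" for s
  proof (induction s)
    case (Suc s)
    then show ?case
      using dvd(1)[of s] by (simp add: M_def)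
  qed (simp add: u0)
  have "0 < M s" if "s \<ge> 1" for s
  proof -
    obtain k where "s = Suc k"
      using \<open>s \<ge> 1\<close> by (cases s) auto
    then show ?thesis
      using dvd(1)[of k] pos[OF uP] by (simp add: M_def dvd_imp_le div_greater_zero_iff)
  qed
  moreover have "Q_seq M = frac_group P"
  proof
    show "Q_seq M \<subseteq> frac_group P"
      using frac_groupI[OF uP] unfolding Q_seq_def M by blast
    show "frac_group P \<subseteq> Q_seq M"
    proof
      fix x assume "x \<in> frac_group P"
      then obtain m p where x: "p \<in> P" "x = of_int m / of_nat p"
        by (rule frac_groupE)
      obtain k where k: "p = q k"
        using x(1) q by blast
      obtain m' where "x = of_int m' / of_nat (u (Suc k))"
        using frac_dvd[OF x(1) uP, of "Suc k" m] dvd(2)[of k] x(2) k by auto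
      then show "x \<in> Q_seq M"
        unfolding Q_seq_def M by force
    qed
  qed
  ultimately show ?thesis
    by blast
qed

end


subsection \<open>Inductive limits of Toeplitz algebras\<close>

text \<open>The limit and the semigroup algebra are both closures of directed unions of isometric
  copies of the Toeplitz algebra. The proof matches these copies over the cofinal set
  \<open>E\<close> of indices above a base point.\<close>

lemma inductive_limit_toeplitz:
  fixes D :: "'k::order set" and n :: "'k \<Rightarrow> 'k \<Rightarrow> nat" and A :: "'c cstar"
  assumes dir: "\<And>a b. a \<in> D \<Longrightarrow> b \<in> D \<Longrightarrow> \<exists>c\<in>D. a \<le> c \<and> b \<le> c" and ne: "D \<noteq> {}"
    and n_pos: "\<And>a b. a \<in> D \<Longrightarrow> b \<in> D \<Longrightarrow> a \<le> b \<Longrightarrow> 0 < n b a"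
    and n_factor: "\<And>a b c. a \<in> D \<Longrightarrow> b \<in> D \<Longrightarrow> c \<in> D \<Longrightarrow> a \<le> b \<Longrightarrow> b \<le> c \<Longrightarrow> n c a = n c b * n b a"
    and limit: "is_inductive_limit D (\<lambda>a. toeplitz) (\<lambda>b a. toeplitz_hom (n b a)) A \<tau>"
  shows "\<exists>M h. (\<forall>s\<ge>1. 0 < M s) \<and> h \<in> unital_star_hom A (reduced_cstar (Q_seq M)) \<and>
    bij_betw h (carrier A) (carrier (reduced_cstar (Q_seq M))) \<and>
    (\<forall>x\<in>carrier A. nrm (reduced_cstar (Q_seq M)) (h x) = nrm A x)"
proof -
  have A: "unital_cstar_algebra A"
    and \<tau>: "\<And>a. a \<in> D \<Longrightarrow> \<tau> a \<in> unital_star_hom toeplitz A"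
    and \<tau>_inj: "\<And>a. a \<in> D \<Longrightarrow> inj_on (\<tau> a) (carrier toeplitz)"
    and \<tau>_comp: "\<And>a b x. a \<in> D \<Longrightarrow> b \<in> D \<Longrightarrow> a \<le> b \<Longrightarrow> x \<in> carrier toeplitz \<Longrightarrow>
      \<tau> a x = \<tau> b (toeplitz_hom (n b a) x)"
    and \<tau>_dense: "\<And>x e. x \<in> carrier A \<Longrightarrow> 0 < e \<Longrightarrow>
      \<exists>a\<in>D. \<exists>y\<in>carrier toeplitz. nrm A (\<tau> a y \<ominus>\<^bsub>A\<^esub> x) < e"
    using limit unfolding is_inductive_limit_def by blast+
  interpret A: unital_cstar_algebra A
    by (rule A)
  obtain o' where o': "o' \<in> D"
    using ne by blast
  define E where "E = {b \<in> D. o' \<le> b}"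
  define P where "P = (\<lambda>b. n b o') ` E"
  have E: "b \<in> D" "o' \<le> b" if "b \<in> E" for b
    using that by (simp_all add: E_def)
  have E_dir: "\<exists>c\<in>E. a \<le> c \<and> b \<le> c" if "a \<in> E" "b \<in> D" for a b
    using dir[OF E(1)[OF that(1)] that(2)] E(2)[OF that(1)] by (auto simp: E_def intro: order_trans)
  have o'E: "o' \<in> E"
    using o' by (simp add: E_def)
  \<comment> \<open>Factorization makes this number equal to its own square, and it is
    positive.\<close>
  have n_o': "n o' o' = 1"
    using n_factor[OF o' o' o'] n_pos[OF o' o'] by simp
  have n_E: "n c o' = n c b * n b o'" "0 < n c b" if "b \<in> E" "c \<in> E" "b \<le> c" for b c
    using n_factor[OF o' E(1)[OF that(1)] E(1)[OF that(2)] E(2)[OF that(1)] that(3)]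
      n_pos[OF E(1)[OF that(1)] E(1)[OF that(2)] that(3)] .
  interpret P: directed_denominators P
  proof
    show "1 \<in> P"
      using n_o' o'E unfolding P_def by force
    show "0 < p" if "p \<in> P" for p
      using that n_pos[OF o' E(1) E(2)] by (auto simp: P_def)
    fix p q assume "p \<in> P" "q \<in> P"
    then obtain a b where ab: "a \<in> E" "b \<in> E" "p = n a o'" "q = n b o'"
      by (auto simp: P_def)
    obtain c where c: "c \<in> E" "a \<le> c" "b \<le> c"
      using E_dir[OF ab(1) E(1)[OF ab(2)]] by blast
    have "p dvd n c o'" "q dvd n c o'"
      unfolding ab using n_E(1)[OF ab(1) c(1,2)] n_E(1)[OF ab(2) c(1,3)] by (metis dvd_triv_right)+
    then show "\<exists>r\<in>P. p dvd r \<and> q dvd r"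
      using c(1) by (auto simp: P_def)
  qed
  let ?B = "reduced_cstar (frac_group P)" and ?S = "positive_part (frac_group P)"
  interpret B: unital_cstar_algebra ?B
    unfolding P.reduced_cstar_eq by (rule P.P.C.unital_cstar_algebra_axioms)
  define d where "d = (\<lambda>b. 1 / of_nat (n b o') :: rat)"
  have d: "d b \<in> frac_group P" "0 < d b" if "b \<in> E" for b
    using P.frac_groupI[of "n b o'" 1] P.pos[of "n b o'"] that by (auto simp: d_def P_def)
  have "\<forall>b\<in>E. \<exists>h. h \<in> unital_star_hom toeplitz ?B \<and>
      (\<forall>k. h (shift_op rat_nats (of_nat k)) = shift_op ?S (of_nat k * d b))"
    using P.ex_toeplitz_hom[OF d] by blast
  then obtain \<psi> where \<psi>: "\<And>b. b \<in> E \<Longrightarrow> \<psi> b \<in> unital_star_hom toeplitz ?B"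
    and \<psi>_shift: "\<And>b k. b \<in> E \<Longrightarrow> \<psi> b (shift_op rat_nats (of_nat k)) = shift_op ?S (of_nat k * d b)"
    using bchoice[of E "\<lambda>b h. h \<in> unital_star_hom toeplitz ?B \<and>
      (\<forall>k. h (shift_op rat_nats (of_nat k)) = shift_op ?S (of_nat k * d b))"] by blast
  have \<psi>_T: "\<psi> b toeplitz_T = shift_op ?S (d b)" if "b \<in> E" for b
    using \<psi>_shift[OF that, of 1] by (simp add: toeplitz_T_def)
  have \<psi>_comp: "\<psi> b x = \<psi> c (toeplitz_hom (n c b) x)"
    if b: "b \<in> E" and c: "c \<in> E" and le: "b \<le> c" and x: "x \<in> carrier toeplitz" for b c x
  proof (rule toeplitz_hom_unique[OF B.unital_cstar_algebra_axioms \<psi>[OF b] _ _ x])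
    note nE = n_E[OF b c le]
    show "(\<lambda>x. \<psi> c (toeplitz_hom (n c b) x)) \<in> unital_star_hom toeplitz ?B"
      by (rule unital_star_hom_compose[OF toeplitz_hom(1)[OF nE(2)] \<psi>[OF c]])
    show "\<psi> b toeplitz_T = \<psi> c (toeplitz_hom (n c b) toeplitz_T)"
      \<comment> \<open>Both sides are translations, and \<open>n c b * d c = d b\<close> because
        \<open>n c o' = n c b * n b o'\<close>.\<close>
      using nE by (simp add: \<psi>_T b toeplitz_hom(2) \<psi>_shift c d_def)
  qed
  have \<psi>_iso: "nrm ?B (\<psi> b x) = nrm toeplitz x" if "b \<in> E" "x \<in> carrier toeplitz" for b x
    by (rule toeplitz_isometric[OF B.unital_cstar_algebra_axioms \<psi>[OF that(1)]
        P.toeplitz_P_image_nonzero[OF \<psi>[OF that(1)] d[OF that(1)] \<psi>_T[OF that(1)]] that(2)])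
  have \<tau>_iso: "nrm A (\<tau> b x) = nrm toeplitz x" if b: "b \<in> D" and x: "x \<in> carrier toeplitz" for b x
  proof (rule toeplitz_isometric[OF A \<tau>[OF b] _ x])
    interpret \<tau>: cstar_hom toeplitz A "\<tau> b"
      by (intro cstar_hom.intro A cstar_hom_axioms.intro \<tau>[OF b] T.unital_cstar_algebra_axioms)
    show "\<tau> b toeplitz_P \<noteq> \<zero>\<^bsub>A\<^esub>"
      \<comment> \<open>Injectivity of the limit map yields isometry through the single element
        \<open>toeplitz_P\<close>.\<close>
      using inj_onD[OF \<tau>_inj[OF b], of toeplitz_P "\<zero>\<^bsub>toeplitz\<^esub>"] toeplitz_P_nonzero toeplitz_P_in \<tau>.hom_zero
      by auto
  qed
  define R where "R = {(\<tau> b x, \<psi> b x) | b x. b \<in> E \<and> x \<in> carrier toeplitz}"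
  have RI: "(\<tau> b x, \<psi> b x) \<in> R" if "b \<in> E" "x \<in> carrier toeplitz" for b x
    using that by (auto simp: R_def)
  have R_lift: "\<tau> b x = \<tau> c (toeplitz_hom (n c b) x)" "\<psi> b x = \<psi> c (toeplitz_hom (n c b) x)"
      "toeplitz_hom (n c b) x \<in> carrier toeplitz"
    if "b \<in> E" "c \<in> E" "b \<le> c" "x \<in> carrier toeplitz" for b c x
    using \<tau>_comp[OF E(1)[OF that(1)] E(1)[OF that(2)] that(3,4)] \<psi>_comp[OF that]
      unital_star_homD(1)[OF toeplitz_hom(1)[OF n_E(2)[OF that(1-3)]] that(4)] .
  have R1: "\<exists>b y. b \<in> E \<and> y \<in> carrier toeplitz \<and> p = (\<tau> b y, \<psi> b y)" if "p \<in> R" for p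
    using that by (auto simp: R_def)
  \<comment> \<open>Two related pairs may come from different indices; the compatibility of both
    families moves them to a common one, where sums and products are those of the Toeplitz
    algebra.\<close>
  have R2: "\<exists>b y y'. b \<in> E \<and> y \<in> carrier toeplitz \<and> y' \<in> carrier toeplitz \<and> p = (\<tau> b y, \<psi> b y) \<and> p' = (\<tau> b y', \<psi> b y')"
    if p: "p \<in> R" and p': "p' \<in> R" for p p'
  proof -
    obtain b x where 1: "b \<in> E" "x \<in> carrier toeplitz" "p = (\<tau> b x, \<psi> b x)"
      using R1[OF p] by blast
    obtain b' x' where 2: "b' \<in> E" "x' \<in> carrier toeplitz" "p' = (\<tau> b' x', \<psi> b' x')"
      using R1[OF p'] by blast
    obtain c where c: "c \<in> E" "b \<le> c" "b' \<le> c"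
      using E_dir[OF 1(1) E(1)[OF 2(1)]] by blast
    show ?thesis
      using R_lift[OF 1(1) c(1,2) 1(2)] R_lift[OF 2(1) c(1,3) 2(2)] 1(3) 2(3) c(1) by auto
  qed
  have R_one: "(\<one>\<^bsub>A\<^esub>, \<one>\<^bsub>?B\<^esub>) \<in> R"
    using RI[OF o'E T.one_closed] by (simp add: unital_star_homD(4)[OF \<tau>[OF o']] unital_star_homD(4)[OF \<psi>[OF o'E]])
  have R_add: "(x \<oplus>\<^bsub>A\<^esub> x', y \<oplus>\<^bsub>?B\<^esub> y') \<in> R" and R_mult: "(x \<otimes>\<^bsub>A\<^esub> x', y \<otimes>\<^bsub>?B\<^esub> y') \<in> R"
    if xy: "(x, y) \<in> R" "(x', y') \<in> R" for x y x' y'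
  proof -
    obtain b z z' where b: "b \<in> E" and z: "z \<in> carrier toeplitz" "z' \<in> carrier toeplitz"
      and eq: "(x, y) = (\<tau> b z, \<psi> b z)" "(x', y') = (\<tau> b z', \<psi> b z')"
      using R2[OF xy] by blast
    show "(x \<oplus>\<^bsub>A\<^esub> x', y \<oplus>\<^bsub>?B\<^esub> y') \<in> R" "(x \<otimes>\<^bsub>A\<^esub> x', y \<otimes>\<^bsub>?B\<^esub> y') \<in> R"
      using RI[OF b T.add.m_closed[OF z]] RI[OF b T.m_closed[OF z]] eq z
      by (simp_all add: unital_star_homD(2,3)[OF \<tau>[OF E(1)[OF b]]] unital_star_homD(2,3)[OF \<psi>[OF b]])
  qed
  have R_smult: "(c \<odot>\<^bsub>A\<^esub> x, c \<odot>\<^bsub>?B\<^esub> y) \<in> R" and R_star: "(star A x, star ?B y) \<in> R"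
    and R_nrm: "nrm ?B y = nrm A x" and R_closed: "x \<in> carrier A" "y \<in> carrier ?B"
    if xy: "(x, y) \<in> R" for x y c
  proof -
    obtain b z where b: "b \<in> E" and z: "z \<in> carrier toeplitz" and eq: "(x, y) = (\<tau> b z, \<psi> b z)"
      using R1[OF xy] by blast
    show "(c \<odot>\<^bsub>A\<^esub> x, c \<odot>\<^bsub>?B\<^esub> y) \<in> R" "(star A x, star ?B y) \<in> R"
      using RI[OF b T.smult_closed[OF z, of c]] RI[OF b T.star_closed[OF z]] eq z
      by (simp_all add: unital_star_homD(5,6)[OF \<tau>[OF E(1)[OF b]]] unital_star_homD(5,6)[OF \<psi>[OF b]])
    show "nrm ?B y = nrm A x" "x \<in> carrier A" "y \<in> carrier ?B"
      using eq \<psi>_iso[OF b z] \<tau>_iso[OF E(1)[OF b] z] unital_star_homD(1)[OF \<tau>[OF E(1)[OF b]] z]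
        unital_star_homD(1)[OF \<psi>[OF b] z] by simp_all
  qed
  have dense_A: "\<exists>x'\<in>Domain R. nrm A (x' \<ominus>\<^bsub>A\<^esub> x) < e" if "x \<in> carrier A" "0 < e" for x e
  proof -
    obtain a y where a: "a \<in> D" "y \<in> carrier toeplitz" "nrm A (\<tau> a y \<ominus>\<^bsub>A\<^esub> x) < e"
      using \<tau>_dense[OF \<open>x \<in> carrier A\<close> \<open>0 < e\<close>] by blast
    \<comment> \<open>The approximating index need not lie above the base point, so it is raised
      into \<open>E\<close>.\<close>
    obtain c where c: "c \<in> E" "a \<le> c"
      using E_dir[OF o'E a(1)] by blast
    have "\<tau> a y = \<tau> c (toeplitz_hom (n c a) y)" "toeplitz_hom (n c a) y \<in> carrier toeplitz"
      using \<tau>_comp[OF a(1) E(1)[OF c(1)] c(2) a(2)]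
        unital_star_homD(1)[OF toeplitz_hom(1)[OF n_pos[OF a(1) E(1)[OF c(1)] c(2)]] a(2)] .
    then have "\<tau> a y \<in> Domain R"
      using RI[OF c(1)] by (auto simp: Domain_iff)
    with a(3) show ?thesis
      by blast
  qed
  have dense_B: "\<exists>y'\<in>Range R. nrm ?B (y' \<ominus>\<^bsub>?B\<^esub> y) < e" if y: "y \<in> carrier ?B" and e: "0 < e" for y e
  proof -
    \<comment> \<open>The closure of the range of \<open>R\<close> is a closed subalgebra. It
      contains every generating translation, because \<open>m / n b o'\<close> with nonnegative
      \<open>m\<close> is a multiple of \<open>d b\<close>.\<close>
    have "cstar_subalgebra {x. \<exists>X. (\<forall>k. X k \<in> Range R) \<and> B.converges X x} ?B" (is "cstar_subalgebra ?L _")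
    proof (rule B.closure_subalgebra)
      show "Range R \<subseteq> carrier ?B"
        using R_closed by blast
      show "\<zero>\<^bsub>?B\<^esub> \<in> Range R"
        using R_smult[OF R_one, of 0] by (auto simp: B.smult_0)
    qed (use R_add R_mult R_smult R_star in \<open>blast+\<close>)
    then have "?L = carrier ?B"
    proof (rule P.P.C_least'[unfolded P.reduced_cstar_eq[symmetric]])
      fix g assume g: "g \<in> ?S"
      then have gP: "g \<in> frac_group P" "0 \<le> g"
        by (simp_all add: positive_part_def)
      obtain m p where mp: "p \<in> P" "g = of_int m / of_nat p"
        using gP(1) by (rule P.frac_groupE)
      obtain b where b: "b \<in> E" "p = n b o'"
        using mp(1) by (auto simp: P_def)
      have "0 \<le> m"
        using mp(2) gP(2) P.pos[OF mp(1)] by (simp add: zero_le_divide_iff)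
      then have "g = of_nat (nat m) * d b"
        using mp(2) b(2) by (simp add: d_def)
      then have "shift_op ?S g = \<psi> b (shift_op rat_nats (of_nat (nat m)))"
        using \<psi>_shift[OF b(1)] by simp
      then have "shift_op ?S g \<in> Range R"
        using RangeI[OF RI[OF b(1) toeplitz_shift_in]] by (simp only:)
      moreover have "shift_op ?S g \<in> carrier ?B"
        unfolding P.reduced_cstar_eq by (rule P.P.shift_in_C[OF g])
      ultimately show "shift_op ?S g \<in> ?L"
        using exI[of "\<lambda>X. (\<forall>k. X k \<in> Range R) \<and> B.converges X (shift_op ?S g)" "\<lambda>_. shift_op ?S g"]
          B.converges_const by simp
    qed
    then have "y \<in> ?L"
      using y by (simp only:)
    then obtain X where X: "\<forall>k. X k \<in> Range R" "B.converges X y"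
      by blast
    show ?thesis
      using B.converges_approx[OF X(2) e] X(1) by blast
  qed
  have AB: "isometric_relation A ?B R"
    by (intro isometric_relation.intro A B.unital_cstar_algebra_axioms isometric_relation_axioms.intro)
      (use R_closed R_one R_add R_mult R_smult R_star R_nrm dense_A in simp_all)
  have BA: "isometric_relation ?B A (R\<inverse>)"
    by (intro isometric_relation.intro A B.unital_cstar_algebra_axioms isometric_relation_axioms.intro)
      (use R_closed R_one R_add R_mult R_smult R_star R_nrm dense_B in simp_all)
  obtain h where h: "h \<in> unital_star_hom A ?B" "bij_betw h (carrier A) (carrier ?B)"
    "\<And>x. x \<in> carrier A \<Longrightarrow> nrm ?B (h x) = nrm A x"
    using isometric_relation_extends[OF AB BA] by blast
  obtain M where M: "\<forall>s\<ge>1. 0 < M s" "Q_seq M = frac_group P"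
    using P.ex_Q_seq by blast
  show ?thesis
    by (rule exI[of _ M], rule exI[of _ h]) (use M h in simp)
qed


subsection \<open>Direct products\<close>

text \<open>The carrier of the product is cut out by boundedness of the norms. Isometric factors
  leave this condition unchanged in both directions, so the coordinatewise map and its inverse stay
  inside the products.\<close>

lemma unital_star_isomorphic_product:
  assumes h: "\<And>i. i \<in> I \<Longrightarrow> h i \<in> unital_star_hom (A i) (B i)"
    and bij: "\<And>i. i \<in> I \<Longrightarrow> bij_betw (h i) (carrier (A i)) (carrier (B i))"
    and iso: "\<And>i x. i \<in> I \<Longrightarrow> x \<in> carrier (A i) \<Longrightarrow> nrm (B i) (h i x) = nrm (A i) x"
  shows "unital_star_isomorphic (cstar_product I A) (cstar_product I B)"
proof -
  define H where "H = (\<lambda>f. \<lambda>i\<in>I. h i (f i))"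
  have carr: "f \<in> carrier (cstar_product I C) \<longleftrightarrow>
      f \<in> (\<Pi>\<^sub>E i\<in>I. carrier (C i)) \<and> bdd_above ((\<lambda>i. nrm (C i) (f i)) ` I)" for f and C :: "_ \<Rightarrow> 'z cstar"
    by (simp add: cstar_product_def)
  have in_i: "f i \<in> carrier (C i)" if "f \<in> carrier (cstar_product I C)" "i \<in> I" for f i and C :: "_ \<Rightarrow> 'z cstar"
    using that by (auto simp: carr)
  have nrm_H: "(\<lambda>i. nrm (B i) (H f i)) ` I = (\<lambda>i. nrm (A i) (f i)) ` I"
    if "f \<in> (\<Pi>\<^sub>E i\<in>I. carrier (A i))" for f
    by (rule image_cong) (use PiE_mem[OF that] in \<open>simp_all add: H_def iso\<close>)
  have H_closed: "H f \<in> carrier (cstar_product I B)" if f: "f \<in> carrier (cstar_product I A)" for f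
    using f nrm_H[of f] unital_star_homD(1)[OF h] by (auto simp: carr H_def)
  have "H \<in> unital_star_hom (cstar_product I A) (cstar_product I B)"
  proof (rule unital_star_homI[OF H_closed])
    note simps = cstar_product_def H_def restrict_def fun_eq_iff unital_star_homD[OF h]
    show "H \<one>\<^bsub>cstar_product I A\<^esub> = \<one>\<^bsub>cstar_product I B\<^esub>"
      by (auto simp: simps)
    fix f assume f: "f \<in> carrier (cstar_product I A)"
    show "H (c \<odot>\<^bsub>cstar_product I A\<^esub> f) = c \<odot>\<^bsub>cstar_product I B\<^esub> H f" for c
      using in_i[OF f] by (simp add: simps)
    show "H (star (cstar_product I A) f) = star (cstar_product I B) (H f)"
      using in_i[OF f] by (simp add: simps)
    fix g assume g: "g \<in> carrier (cstar_product I A)"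
    show "H (f \<oplus>\<^bsub>cstar_product I A\<^esub> g) = H f \<oplus>\<^bsub>cstar_product I B\<^esub> H g"
      "H (f \<otimes>\<^bsub>cstar_product I A\<^esub> g) = H f \<otimes>\<^bsub>cstar_product I B\<^esub> H g"
      using in_i[OF f] in_i[OF g] by (simp_all add: simps)
  qed
  moreover have "bij_betw H (carrier (cstar_product I A)) (carrier (cstar_product I B))"
  proof (rule bij_betwI')
    fix f g assume f: "f \<in> carrier (cstar_product I A)" and g: "g \<in> carrier (cstar_product I A)"
    show "H f = H g \<longleftrightarrow> f = g"
    proof
      assume eq: "H f = H g"
      show "f = g"
      proof (rule extensionalityI[of _ I])
        fix i assume i: "i \<in> I"
        have "h i (f i) = h i (g i)"
          using fun_cong[OF eq, of i] i by (simp add: H_def)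
        then show "f i = g i"
          using bij_betw_imp_inj_on[OF bij[OF i]] in_i[OF f i] in_i[OF g i] by (simp add: inj_on_eq_iff)
      qed (use f g in \<open>auto simp: carr PiE_def\<close>)
    qed simp
  next
    fix g assume g: "g \<in> carrier (cstar_product I B)"
    define f where "f = (\<lambda>i\<in>I. inv_into (carrier (A i)) (h i) (g i))"
    have fi: "f i \<in> carrier (A i)" "h i (f i) = g i" if i: "i \<in> I" for i
    proof -
      have "g i \<in> h i ` carrier (A i)"
        using in_i[OF g i] bij_betw_imp_surj_on[OF bij[OF i]] by simp
      then show "f i \<in> carrier (A i)" "h i (f i) = g i"
        using i by (simp_all add: f_def inv_into_into f_inv_into_f)
    qed
    have f: "f \<in> (\<Pi>\<^sub>E i\<in>I. carrier (A i))"
      using fi(1) by (auto simp: f_def)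
    have Hf: "H f = g"
    proof (rule extensionalityI[of _ I])
      show "g \<in> extensional I"
        using g by (simp add: carr PiE_def)
    qed (simp_all add: H_def fi)
    have "f \<in> carrier (cstar_product I A)"
      \<comment> \<open>The coordinatewise preimage has the same norms as \<open>g\<close>, so its
        boundedness comes from that of \<open>g\<close>.\<close>
      using f g nrm_H[OF f] unfolding Hf by (simp add: carr)
    then show "\<exists>f\<in>carrier (cstar_product I A). g = H f"
      using Hf by blast
  qed (rule H_closed)
  ultimately show ?thesis
    unfolding unital_star_isomorphic_def by blast
qed

text \<open>The limits enter as arbitrary realisations \<open>A D\<close> with maps
  \<open>\<tau> D\<close>, in accordance with their uniqueness up to isomorphism. The index set of
  both products is the set of maximal directed subsets itself.\<close>

theorem theorem5p3:
  fixes K :: "'k::order set"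
    and n :: "'k \<Rightarrow> 'k \<Rightarrow> nat"
    and A :: "'k set \<Rightarrow> 'c cstar"
    and \<tau> :: "'k set \<Rightarrow> 'k \<Rightarrow> rat ell2_op \<Rightarrow> 'c"
  assumes n_pos: "\<And>a b. a \<in> K \<Longrightarrow> b \<in> K \<Longrightarrow> a \<le> b \<Longrightarrow> 0 < n b a"
    and n_factor: "\<And>a b c. a \<in> K \<Longrightarrow> b \<in> K \<Longrightarrow> c \<in> K \<Longrightarrow> a \<le> b \<Longrightarrow> b \<le> c \<Longrightarrow>
                     n c a = n c b * n b a"
    and limit: "\<And>D. D \<in> maximal_directed_subsets K \<Longrightarrow>
                  is_inductive_limit D (\<lambda>a. toeplitz) (\<lambda>b a. toeplitz_hom (n b a)) (A D) (\<tau> D)"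
  shows "\<exists>M :: 'k set \<Rightarrow> nat \<Rightarrow> nat.
           (\<forall>D\<in>maximal_directed_subsets K. \<forall>s\<ge>1. 0 < M D s) \<and>
           unital_star_isomorphic
             (cstar_product (maximal_directed_subsets K) A)
             (cstar_product (maximal_directed_subsets K) (\<lambda>D. reduced_cstar (Q_seq (M D))))"
proof -
  let ?I = "maximal_directed_subsets K"
  \<comment> \<open>Collecting the conditions in one predicate allows the sequences, and then the
    isomorphisms, to be chosen simultaneously for all \<open>D\<close>.\<close>
  define iso where "iso D M h \<longleftrightarrow> (\<forall>s\<ge>1. 0 < M s) \<and>
      h \<in> unital_star_hom (A D) (reduced_cstar (Q_seq M)) \<and>
      bij_betw h (carrier (A D)) (carrier (reduced_cstar (Q_seq M))) \<and>
      (\<forall>x\<in>carrier (A D). nrm (reduced_cstar (Q_seq M)) (h x) = nrm (A D) x)" for D M h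
  have "\<forall>D\<in>?I. \<exists>M h. iso D M h"
  proof
    fix D assume D: "D \<in> ?I"
    then have "a \<in> K" if "a \<in> D" for a
      using that by (auto simp: maximal_directed_subsets_def directed_subset_def)
    then show "\<exists>M h. iso D M h"
      unfolding iso_def
      by (intro inductive_limit_toeplitz[OF _ _ n_pos n_factor limit[OF D]])
        (use D in \<open>auto simp: maximal_directed_subsets_def directed_subset_def\<close>)
  qed
  then obtain M where "\<forall>D\<in>?I. \<exists>h. iso D (M D) h"
    by (rule bchoice[THEN exE])
  then obtain h where h: "\<forall>D\<in>?I. iso D (M D) (h D)"
    by (rule bchoice[THEN exE])
  show ?thesis
  proof (intro exI conjI)
    show "\<forall>D\<in>?I. \<forall>s\<ge>1. 0 < M D s"
      using h by (simp add: iso_def)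
    show "unital_star_isomorphic (cstar_product ?I A)
        (cstar_product ?I (\<lambda>D. reduced_cstar (Q_seq (M D))))"
      by (rule unital_star_isomorphic_product[where h=h]) (use h in \<open>simp_all add: iso_def\<close>)
  qed
qed

end
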